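(* Consider the spatial lunar three-body problem. Fix the masses $m_0,m_1,m_2>0$, semi major axes $a_1\ll a_2$ of the inner and outer ellipses, the energy $-f<0$, and the norm $C$ of the total angular momentum. After full symplectic reduction by the $SO(3)$-symmetry of rotations and by the Keplerian $\mathbb{T}^2$-action of the fast angles, there exists a fictitious value $m_2'>0$ of the outer mass such that, up to a constant factor depending only on $a_1$ and the masses $m_2$ and $m_2'$, the quadrupolar regularized system $\mathcal{F}_{quad}$ (with outer mass $m_2$) is conjugate to the quadrupolar system $F_{quad}$, extended analytically to degenerate inner ellipses, provided that $m_2'$ substitutes for $m_2$ in $F_{quad}$.
   Context: **Three-body problem.** After reduction of translations, in Jacobi coordinates $(P_1,Q_1,P_2,Q_2)\in(\mathbb{R}^3)^4$ with the canonical symplectic form, the Hamiltonian is $F=F_{Kep}+F_{pert}$ with $$F_{Kep}=\frac{\|P_1\|^2}{2\mu_1}+\frac{\|P_2\|^2}{2\mu_2}-\frac{\mu_1M_1}{\|Q_1\|}-\frac{\mu_2M_2}{\|Q_2\|},$$ $$F_{pert}=-\mu_1m_2\Bigl[\frac1{\sigma_0}\Bigl(\frac1{\|Q_2-\sigma_0Q_1\|}-\frac1{\|Q_2\|}\Bigr)+\frac1{\sigma_1}\Bigl(\frac1{\|Q_2+\sigma_1Q_1\|}-\frac1{\|Q_2\|}\Bigr)\Bigr],$$ where $\frac1{\sigma_0}=1+\frac{m_1}{m_0}$, $\frac1{\sigma_1}=1+\frac{m_0}{m_1}$, $\frac1{\mu_1}=\frac1{m_0}+\frac1{m_1}$, $\frac1{\mu_2}=\frac1{m_0+m_1}+\frac1{m_2}$,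 $M_1=m_0+m_1$, $M_2=m_0+m_1+m_2$. The inner (outer) ellipse is the Keplerian ellipse of $(P_1,Q_1)$ (of $(P_2,Q_2)$). For $i=1,2$, $a_i,e_i$ are semi major axis and eccentricity, $l_i$ is the mean anomaly, $L_i=\mu_i\sqrt{M_ia_i}$, $G_i=L_i\sqrt{1-e_i^2}$ is the norm of the angular momentum, and $g_i$ is the argument of pericenter. Put $\alpha=a_1/a_2$. The lunar case, written $a_1\ll a_2$, is the case of $\alpha$ sufficiently small. Throughout, inner and outer ellipses are non-circular and the outer ellipse is non-degenerate; inner ellipses may degenerate to line segments. **Quadrupolar system.** The secular system is $F_{sec}=\frac1{4\pi^2}\int_{\mathbb{T}^2}F_{pert}\,dl_1dl_2$, and $F_{quad}$ is defined by $F_{sec}=F_{quad}\,\alpha^3+O(\alpha^4)$. With the total angular momentum fixed vertical of norm $C$ and after quotient by the rotations around the vertical axis (Jacobi's elimination of the nodes), $$F_{quad}=-\frac{m_0m_1m_2}{m_0+m_1}\frac{L_2^3}{8a_1G_2^3}\Bigl\{3\frac{G_1^2}{L_1^2}\Bigl[1+\frac{(C^2-G_1^2-G_2^2)^2}{4G_1^2G_2^2}\Bigr]+15\Bigl(1-\frac{G_1^2}{L_1^2}\Bigr)\Bigl[\cos^2g_1+\sin^2g_1\frac{(C^2-G_1^2-G_2^2)^2}{4G_1^2G_2^2}\Bigr]-6\Bigl(1-\frac{G_1^2}{L_1^2}\Bigr)-4\Bigr\}.$$ It extends analytically to degenerate inner ellipses ($G_1=0$). After full reduction (at fixed $L_1,L_2$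 and $C$), $(G_1,g_1,G_2,g_2)$ are Darboux coordinates on a dense open subset of the reduced space. **Regularization.** $\mathbb{H}$ denotes the quaternions, $\mathbb{R}^3$ being identified with the purely imaginary ones. Let $\Sigma^0=\{(z,w)\in\mathbb{H}^2\setminus\{(0,0)\}:Re\{\bar z iw\}=0\}$, and let $V^0=\Sigma^0/S^1$ be its quotient by $(z,w)\mapsto(e^{i\vartheta}z,e^{i\vartheta}w)$, with the symplectic form induced by $Re\{d\bar w\wedge dz\}$. Let $K.S.(z,w,P_2,Q_2)=(Q_1=\bar ziz,\ P_1=\frac{\bar ziw}{2|z|^2},\ P_2,Q_2)$ (Kustaanheimo-Stiefel regularization of the inner double collisions). On the energy level $F=-f$, with new time $\tau$ given by $\|Q_1\|\,d\tau=dt$, the regularized Hamiltonian is $\mathcal{F}=K.S.^*(\|Q_1\|(F+f))=\mathcal{F}_{Kep}+\mathcal{F}_{pert}$, where $$\mathcal{F}_{Kep}=\frac{|w|^2}{8\mu_1}+\Bigl(f+\frac{\|P_2\|^2}{2\mu_2}-\frac{\mu_2M_2}{\|Q_2\|}\Bigr)|z|^2-\mu_1M_1,\qquad \mathcal{F}_{pert}=K.S.^*(\|Q_1\|F_{pert}),$$ regarded as functions on $V^0\times T^*(\mathbb{R}^3\setminus\{0\})$. Put $f_1(L_2)=f-\frac{\mu_2^3M_2^2}{2L_2^2}>0$. The inner KS-ellipse is the ellipse traced by $Q_1$ under the flow of $\frac{|w|^2}{8\mu_1}+f_1|z|^2-\mu_1M_1$ with $f_1$ held constant; for the regularized system, $a_1$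 is its semi major axis. Let $P_1'=cP_1$, $c>0$, be the rescaled momentum for which the Kepler orbit of $\frac{\|P\|^2}{2\mu_1}-\frac{\mu_1M_1}{\|Q\|}$ through $(P_1',Q_1)$ is this same ellipse, and let $L_1',G_1',u_1',g_1'$ be the Delaunay elements $L$, $G$, the eccentric anomaly and the argument of pericenter of $(P_1',Q_1)$. Put $$\mathcal{L}_1=\frac{\sqrt{2f_1}L_1'^2}{\mu_1^{3/2}M_1},\quad \delta_1=u_1',\quad \mathcal{G}_1=\frac{\sqrt{2f_1}L_1'G_1'}{\mu_1^{3/2}M_1},\quad \gamma_1=g_1',\quad l_2'=l_2+\frac{f_1'(L_2)}{2f_1(L_2)}Re\{\bar P_1Q_1\}.$$ The fast angles of the regularized problem are $\delta_1$ and $l_2'$. The secular regularized system is $\mathcal{F}_{sec}=\frac1{4\pi^2}\int_{\mathbb{T}^2}\mathcal{F}_{pert}\,d\delta_1dl_2'$, and $\mathcal{F}_{quad}$ is obtained from it by the same expansion and truncation: it is the coefficient of $\alpha^3$ in the expansion in powers of $\alpha$. It is well defined near degenerate inner ellipses. After full reduction (at fixed $\mathcal{L}_1,L_2$ and $C$), $(\mathcal{G}_1,\gamma_1,G_2,g_2)$ are Darboux coordinates on a dense open subset of the reduced space. Two reduced systems are conjugate up to a constant factor if a diffeomorphism between the reduced spaces carries one Hamiltonian dynamics to the other up to multiplication by that constant.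
   Formalization: F_quad with mass m2' is taken at total angular momentum C·L1/𝓛1 rather than C (with the same C the reduced spaces can differ topologically); the factor between Hamiltonians depends only on a1, m2, m2', while the factor between the vector fields may also depend on m0, m1. *)

theory Defs
  imports "HOL-Analysis.Analysis" "HOL-Library.Landau_Symbols"
begin

section \<open>Quaternions\<close>

text \<open>A quaternion is the pair of its real part and its imaginary part; space is identified with
  the purely imaginary quaternions. The inner product of the product type is the real part of
  the product of the conjugate of one factor with the other.\<close>

type_synonym vec = "real ^ 3"
type_synonym quat = "real \<times> vec"

definition qmult :: "quat \<Rightarrow> quat \<Rightarrow> quat" (infixl "\<odot>" 70) where
  "p \<odot> q = (fst p * fst q - snd p \<bullet> snd q,
            fst p *\<^sub>R snd q + fst q *\<^sub>R snd p + cross3 (snd p) (snd q))"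

definition qcnj :: "quat \<Rightarrow> quat" where
  "qcnj p = (fst p, - snd p)"

definition qi :: quat where
  "qi = (0, axis 1 1)"


section \<open>Reduced Hamiltonian systems\<close>

text \<open>A reduced system is presented upstairs, in a Euclidean space with a constant symplectic
  form: \<open>level\<close> is the level set of the momentum maps, \<open>same\<close> is the relation of lying in the same
  orbit of the group by which one reduces, and \<open>ham\<close> is the pull-back of the reduced Hamiltonian
  to the level set (only its values on the level set matter).\<close>

record 'a hsys =
  level :: "'a set"
  same :: "'a \<Rightarrow> 'a \<Rightarrow> bool"
  form :: "'a \<Rightarrow> 'a \<Rightarrow> real"
  ham :: "'a \<Rightarrow> real"

definition proj :: "'a hsys \<Rightarrow> 'a \<Rightarrow> 'a set" where
  "proj S x = {y \<in> level S. same S x y}"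

definition rspace :: "'a hsys \<Rightarrow> 'a set set" where
  "rspace S = proj S ` level S"

text \<open>Functions of class \<open>C\<^sup>n\<close> on an open set.\<close>

primrec Cn :: "nat \<Rightarrow> ('a::euclidean_space \<Rightarrow> real) \<Rightarrow> 'a set \<Rightarrow> bool" where
  "Cn 0 g U \<longleftrightarrow> continuous_on U g"
| "Cn (Suc n) g U \<longleftrightarrow> g differentiable_on U \<and>
     (\<forall>b\<in>Basis. Cn n (\<lambda>x. frechet_derivative g (at x) b) U)"

text \<open>A function on the reduced space is smooth iff its pull-back to the level set is, i.e. iff
  this pull-back is locally the restriction of a smooth function of the ambient space; a
  bijection is a diffeomorphism iff it identifies the smooth functions.\<close>

definition rsmooth :: "('a::euclidean_space) hsys \<Rightarrow> ('a set \<Rightarrow> real) \<Rightarrow> bool" where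
  "rsmooth S g \<longleftrightarrow> (\<forall>x\<in>level S. \<exists>U h. open U \<and> x \<in> U \<and> (\<forall>n. Cn n h U) \<and>
     (\<forall>y\<in>U \<inter> level S. g (proj S y) = h y))"

definition rdiffeo ::
  "('a::euclidean_space) hsys \<Rightarrow> ('b::euclidean_space) hsys \<Rightarrow> ('a set \<Rightarrow> 'b set) \<Rightarrow> bool" where
  "rdiffeo S T \<phi> \<longleftrightarrow> bij_betw \<phi> (rspace S) (rspace T) \<and>
     (\<forall>g. rsmooth T g \<longleftrightarrow> rsmooth S (g \<circ> \<phi>))"

text \<open>The reduced symplectic form is the one whose pull-back to the level set is the restriction
  of \<open>form\<close>. Hence a curve \<open>x\<close> in the level set projects to an integral curve of the reduced
  Hamiltonian vector field as soon as \<open>d ham(u) = form u x'\<close> for all vectors \<open>u\<close> tangent to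
  the level set, that is, for all velocities of curves \<open>y\<close> in the level set. (For the canonical
  form \<open>dp \<and> dq\<close> these are Hamilton's equations \<open>q' = \<partial>H/\<partial>p, p' = - \<partial>H/\<partial>q\<close>.)\<close>

definition hamilton_curve :: "('a::euclidean_space) hsys \<Rightarrow> real set \<Rightarrow> (real \<Rightarrow> 'a) \<Rightarrow> bool" where
  "hamilton_curve S I x \<longleftrightarrow> (\<forall>t\<in>I. x t \<in> level S \<and>
     (\<exists>v. (x has_vector_derivative v) (at t) \<and>
       (\<forall>y u. range y \<subseteq> level S \<and> y 0 = x t \<and> (y has_vector_derivative u) (at (0::real)) \<longrightarrow>
          ((\<lambda>s. ham S (y s)) has_real_derivative form S u v) (at 0))))"

text \<open>Motions of the reduced system over an open set of times: curves which locally lift to such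
  curves.\<close>

definition rmotion :: "('a::euclidean_space) hsys \<Rightarrow> real set \<Rightarrow> (real \<Rightarrow> 'a set) \<Rightarrow> bool" where
  "rmotion S I c \<longleftrightarrow> (\<forall>t\<in>I. \<exists>J x. open J \<and> t \<in> J \<and> J \<subseteq> I \<and>
     hamilton_curve S J x \<and> (\<forall>s\<in>J. c s = proj S (x s)))"

text \<open>\<open>\<phi>\<close> conjugates \<open>S\<close> to \<open>T\<close> up to the factor \<open>\<kappa>\<close>: it carries the vector field of \<open>S\<close> to \<open>\<kappa>\<close>
  times that of \<open>T\<close>.\<close>

definition rconjugate ::
  "('a::euclidean_space) hsys \<Rightarrow> ('b::euclidean_space) hsys \<Rightarrow> real \<Rightarrow> ('a set \<Rightarrow> 'b set) \<Rightarrow> bool"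
  where
  "rconjugate S T \<kappa> \<phi> \<longleftrightarrow> rdiffeo S T \<phi> \<and>
     (\<forall>I c. open I \<and> c ` I \<subseteq> rspace S \<longrightarrow>
        (rmotion S I c \<longleftrightarrow> rmotion T ((\<lambda>t. \<kappa> * t) ` I) (\<lambda>t. \<phi> (c (t / \<kappa>)))))"


section \<open>Kepler ellipses\<close>

definition kep_axis :: "real \<Rightarrow> real \<Rightarrow> vec \<Rightarrow> vec \<Rightarrow> real" where
  "kep_axis \<mu> M P Q = - \<mu> * M / (2 * ((norm P)\<^sup>2 / (2 * \<mu>) - \<mu> * M / norm Q))"

definition circ_L :: "real \<Rightarrow> real \<Rightarrow> real \<Rightarrow> real" where
  "circ_L \<mu> M a = \<mu> * sqrt (M * a)"

text \<open>The eccentricity vector, pointing to the pericentre and of length the eccentricity.\<close>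

definition kep_ecc :: "real \<Rightarrow> real \<Rightarrow> vec \<Rightarrow> vec \<Rightarrow> vec" where
  "kep_ecc \<mu> M P Q = (1 / (\<mu>\<^sup>2 * M)) *\<^sub>R cross3 P (cross3 Q P) - (1 / norm Q) *\<^sub>R Q"

text \<open>The angular momentum divided by \<open>L\<close>; its length is \<open>G / L\<close>.\<close>

definition kep_ang :: "real \<Rightarrow> real \<Rightarrow> vec \<Rightarrow> vec \<Rightarrow> vec" where
  "kep_ang \<mu> M P Q = (1 / circ_L \<mu> M (kep_axis \<mu> M P Q)) *\<^sub>R cross3 Q P"

text \<open>Position and momentum at eccentric anomaly \<open>u\<close> on the ellipse of semi major axis \<open>a\<close>,
  eccentricity vector \<open>e \<noteq> 0\<close> and normalized angular momentum \<open>j\<close>, where \<open>e \<bullet> j = 0\<close> and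
  \<open>\<bar>e\<bar>\<^sup>2 + \<bar>j\<bar>\<^sup>2 = 1\<close>. As \<open>\<bar>j\<bar> = sqrt (1 - \<bar>e\<bar>\<^sup>2)\<close>, the second term has the length
  of the semi minor axis; \<open>j = 0\<close> gives the degenerate ellipse.\<close>

definition ell_pos :: "real \<Rightarrow> vec \<Rightarrow> vec \<Rightarrow> real \<Rightarrow> vec" where
  "ell_pos a e j u = (a * (cos u - norm e)) *\<^sub>R sgn e + (a * sin u) *\<^sub>R cross3 j (sgn e)"

definition ell_mom :: "real \<Rightarrow> real \<Rightarrow> real \<Rightarrow> vec \<Rightarrow> vec \<Rightarrow> real \<Rightarrow> vec" where
  "ell_mom \<mu> M a e j u = (\<mu> * sqrt (M / a ^ 3) / (1 - norm e * cos u)) *\<^sub>R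
     ((- a * sin u) *\<^sub>R sgn e + (a * cos u) *\<^sub>R cross3 j (sgn e))"

text \<open>The eccentric anomaly as a function of the mean anomaly (Kepler's equation).\<close>

definition ecc_anomaly :: "real \<Rightarrow> real \<Rightarrow> real" where
  "ecc_anomaly e l = (THE u. u - e * sin u = l)"


section \<open>The three-body problem\<close>

definition mu1 :: "real \<Rightarrow> real \<Rightarrow> real" where
  "mu1 m0 m1 = 1 / (1 / m0 + 1 / m1)"

definition mu2 :: "real \<Rightarrow> real \<Rightarrow> real \<Rightarrow> real" where
  "mu2 m0 m1 m2 = 1 / (1 / (m0 + m1) + 1 / m2)"

definition Mass1 :: "real \<Rightarrow> real \<Rightarrow> real" where
  "Mass1 m0 m1 = m0 + m1"

definition Mass2 :: "real \<Rightarrow> real \<Rightarrow> real \<Rightarrow> real" where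
  "Mass2 m0 m1 m2 = m0 + m1 + m2"

definition Fpert :: "real \<Rightarrow> real \<Rightarrow> real \<Rightarrow> vec \<Rightarrow> vec \<Rightarrow> real" where
  "Fpert m0 m1 m2 Q1 Q2 =
     (let \<sigma>0 = 1 / (1 + m1 / m0); \<sigma>1 = 1 / (1 + m0 / m1) in
      - mu1 m0 m1 * m2 *
        (1 / \<sigma>0 * (1 / norm (Q2 - \<sigma>0 *\<^sub>R Q1) - 1 / norm Q2) +
         1 / \<sigma>1 * (1 / norm (Q2 + \<sigma>1 *\<^sub>R Q1) - 1 / norm Q2)))"

text \<open>The shapes and positions in space of a pair of ellipses, up to the semi major axes:
  the eccentricity vector and normalized angular momentum of the inner ellipse, then those of
  the outer one.\<close>

type_synonym shape = "vec \<times> vec \<times> vec \<times> vec"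

definition noncirc :: "shape \<Rightarrow> bool" where
  "noncirc \<equiv> \<lambda>(e1, j1, e2, j2). e1 \<noteq> 0 \<and> e2 \<noteq> 0 \<and> j2 \<noteq> 0"

definition proper_shapes :: "shape set" where
  "proper_shapes = {(e1, j1, e2, j2). e1 \<bullet> j1 = 0 \<and> (norm e1)\<^sup>2 + (norm j1)\<^sup>2 = 1 \<and>
      e2 \<bullet> j2 = 0 \<and> (norm e2)\<^sup>2 + (norm j2)\<^sup>2 = 1 \<and> noncirc (e1, j1, e2, j2) \<and> j1 \<noteq> 0}"

text \<open>The pairs of ellipses differ by a rotation about the vertical axis. Two states with the
  same semi major axes lie in the same orbit of the Keplerian torus action iff their pairs of
  (oriented) ellipses coincide.\<close>

definition same_shape :: "shape \<Rightarrow> shape \<Rightarrow> bool" where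
  "same_shape \<equiv> \<lambda>(e1, j1, e2, j2) s'. \<exists>R. rotation_matrix R \<and> R *v axis 3 1 = axis 3 1 \<and>
      s' = (R *v e1, R *v j1, R *v e2, R *v j2)"

text \<open>The coefficient of \<open>\<alpha>\<^sup>3\<close>, for functions which are \<open>q \<alpha>\<^sup>3 + O(\<alpha>\<^sup>4)\<close> as \<open>\<alpha>\<close> tends to 0. In
  the expansions below \<open>a1\<close> and the shapes of the ellipses are fixed, and \<open>a2 = a1 / \<alpha>\<close>.\<close>

definition cubic_coeff :: "(real \<Rightarrow> real) \<Rightarrow> real" where
  "cubic_coeff F = (THE q. (\<lambda>\<alpha>. F \<alpha> - q * \<alpha> ^ 3) \<in> O[at_right 0](\<lambda>\<alpha>. \<alpha> ^ 4))"


subsection \<open>The quadrupolar system\<close>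

definition Fsec :: "real \<Rightarrow> real \<Rightarrow> real \<Rightarrow> real \<Rightarrow> shape \<Rightarrow> real \<Rightarrow> real" where
  "Fsec m0 m1 m2 a1 \<equiv> \<lambda>(e1, j1, e2, j2) \<alpha>.
     1 / (4 * pi\<^sup>2) * integral (cbox (0, 0) (2 * pi, 2 * pi)) (\<lambda>(l1, l2).
       Fpert m0 m1 m2 (ell_pos a1 e1 j1 (ecc_anomaly (norm e1) l1))
                      (ell_pos (a1 / \<alpha>) e2 j2 (ecc_anomaly (norm e2) l2)))"

text \<open>For degenerate inner ellipses (\<open>j1 = 0\<close>) the value is that of the analytic extension, i.e.
  the limit along non-degenerate ones.\<close>

definition Fquad :: "real \<Rightarrow> real \<Rightarrow> real \<Rightarrow> real \<Rightarrow> shape \<Rightarrow> real" where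
  "Fquad m0 m1 m2 a1 s =
     (if fst (snd s) \<noteq> 0 then cubic_coeff (Fsec m0 m1 m2 a1 s)
      else Lim (at s within proper_shapes) (\<lambda>s'. cubic_coeff (Fsec m0 m1 m2 a1 s')))"

text \<open>States are \<open>(P1, Q1, P2, Q2)\<close>.\<close>

type_synonym state = "vec \<times> vec \<times> vec \<times> vec"

definition shape_of :: "real \<Rightarrow> real \<Rightarrow> real \<Rightarrow> state \<Rightarrow> shape" where
  "shape_of m0 m1 m2 \<equiv> \<lambda>(P1, Q1, P2, Q2).
     (kep_ecc (mu1 m0 m1) (Mass1 m0 m1) P1 Q1, kep_ang (mu1 m0 m1) (Mass1 m0 m1) P1 Q1,
      kep_ecc (mu2 m0 m1 m2) (Mass2 m0 m1 m2) P2 Q2,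
      kep_ang (mu2 m0 m1 m2) (Mass2 m0 m1 m2) P2 Q2)"

text \<open>Full reduction at given semi major axes and at total angular momentum vertical of norm \<open>C\<close>.
  Every degenerate inner ellipse is represented, by its points outside the collision.\<close>

definition quad_system ::
  "real \<Rightarrow> real \<Rightarrow> real \<Rightarrow> real \<Rightarrow> real \<Rightarrow> real \<Rightarrow> state hsys" where
  "quad_system m0 m1 m2 a1 a2 C =
     \<lparr>level = {(P1, Q1, P2, Q2). Q1 \<noteq> 0 \<and> Q2 \<noteq> 0 \<and>
         kep_axis (mu1 m0 m1) (Mass1 m0 m1) P1 Q1 = a1 \<and>
         kep_axis (mu2 m0 m1 m2) (Mass2 m0 m1 m2) P2 Q2 = a2 \<and>
         noncirc (shape_of m0 m1 m2 (P1, Q1, P2, Q2)) \<and>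
         cross3 Q1 P1 + cross3 Q2 P2 = C *\<^sub>R axis 3 1},
      same = (\<lambda>x y. same_shape (shape_of m0 m1 m2 x) (shape_of m0 m1 m2 y)),
      form = (\<lambda>(P1, Q1, P2, Q2) (P1', Q1', P2', Q2').
         P1 \<bullet> Q1' - Q1 \<bullet> P1' + P2 \<bullet> Q2' - Q2 \<bullet> P2'),
      ham = (\<lambda>x. Fquad m0 m1 m2 a1 (shape_of m0 m1 m2 x))\<rparr>"


subsection \<open>The quadrupolar regularized system\<close>

text \<open>Position and momentum of the Kustaanheimo-Stiefel map.\<close>

definition ks_Q :: "quat \<Rightarrow> vec" where
  "ks_Q z = snd (qcnj z \<odot> qi \<odot> z)"

definition ks_P :: "quat \<Rightarrow> quat \<Rightarrow> vec" where
  "ks_P z w = (1 / (2 * (norm z)\<^sup>2)) *\<^sub>R snd (qcnj z \<odot> qi \<odot> w)"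

definition f1 :: "real \<Rightarrow> real \<Rightarrow> real \<Rightarrow> real \<Rightarrow> real \<Rightarrow> real" where
  "f1 m0 m1 m2 f L2 = f - (mu2 m0 m1 m2) ^ 3 * (Mass2 m0 m1 m2)\<^sup>2 / (2 * L2\<^sup>2)"

text \<open>The flow of \<open>\<bar>w\<bar>\<^sup>2 / (8 \<mu>1) + \<phi> \<bar>z\<bar>\<^sup>2 - \<mu>1 M1\<close> (\<open>\<phi>\<close> is the constant value of \<open>f1\<close>) is, up to
  the scale of time, \<open>z(\<theta>) = cos \<theta> z + sin \<theta> b w\<close> with \<open>b\<^sup>2 = 1 / (8 \<mu>1 \<phi>)\<close>, so that \<open>Q1\<close> traces an
  ellipse, at eccentric anomaly \<open>2 \<theta>\<close> up to a constant. Its semi major axis is the mean over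
  \<open>\<theta>\<close> of the distance \<open>\<bar>z(\<theta>)\<bar>\<^sup>2\<close> to the focus 0, and its centre, which is \<open>- a\<close> times the
  eccentricity vector, is the mean of \<open>Q1\<close>. These expressions, unlike \<open>ks_P\<close>, make sense at the
  collisions \<open>z = 0\<close>; \<open>ks_ellipse\<close> below is the comparison outside the collisions.\<close>

definition ks_axis :: "real \<Rightarrow> real \<Rightarrow> quat \<Rightarrow> quat \<Rightarrow> real" where
  "ks_axis \<mu> \<phi> z w = ((norm z)\<^sup>2 + (norm w)\<^sup>2 / (8 * \<mu> * \<phi>)) / 2"

definition ks_ecc :: "real \<Rightarrow> real \<Rightarrow> quat \<Rightarrow> quat \<Rightarrow> vec" where
  "ks_ecc \<mu> \<phi> z w =
     (- 1 / (2 * ks_axis \<mu> \<phi> z w)) *\<^sub>R (ks_Q z + (1 / (8 * \<mu> * \<phi>)) *\<^sub>R ks_Q w)"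

text \<open>The angular momentum of \<open>(P1, Q1)\<close>.\<close>

definition ks_G :: "quat \<Rightarrow> quat \<Rightarrow> vec" where
  "ks_G z w = (- 1 / 2) *\<^sub>R snd (qcnj z \<odot> w)"

text \<open>The factor \<open>c\<close> such that the Kepler orbit of \<open>(c P1, Q1)\<close> is the inner KS-ellipse, of semi
  major axis \<open>a\<close>: on it, \<open>\<bar>P1\<bar>\<^sup>2 / (2 \<mu>) - 2 \<phi> a / \<bar>Q1\<bar> = - \<phi>\<close>.\<close>

definition resc :: "real \<Rightarrow> real \<Rightarrow> real \<Rightarrow> real \<Rightarrow> real" where
  "resc \<mu> M \<phi> a = sqrt (\<mu> * M / (2 * \<phi> * a))"

text \<open>The angular momentum of \<open>(c P1, Q1)\<close> divided by \<open>L1'\<close>.\<close>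

definition ks_ang :: "real \<Rightarrow> real \<Rightarrow> real \<Rightarrow> quat \<Rightarrow> quat \<Rightarrow> vec" where
  "ks_ang \<mu> M \<phi> z w = (let a = ks_axis \<mu> \<phi> z w in (resc \<mu> M \<phi> a / circ_L \<mu> M a) *\<^sub>R ks_G z w)"

text \<open>Outside the collisions, the inner KS-ellipse is the Kepler ellipse of \<open>(c P1, Q1)\<close>.\<close>

lemma ks_norm: "norm (ks_Q z) = (norm z)\<^sup>2"
proof -
  have "(norm (ks_Q z))\<^sup>2 = ((norm z)\<^sup>2)\<^sup>2"
    unfolding power2_norm_eq_inner ks_Q_def qmult_def qcnj_def qi_def
    by (cases z) (simp add: inner_vec_def sum_3 cross3_def axis_def vec_eq_iff power2_norm_eq_inner inner_prod_def
        algebra_simps power2_eq_square)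
  then show ?thesis by (rule power2_eq_imp_eq) auto
qed

lemma ks_P_norm:
  assumes "fst (qcnj z \<odot> qi \<odot> w) = 0" "z \<noteq> 0"
  shows "(norm (ks_P z w))\<^sup>2 = (norm w)\<^sup>2 / (4 * (norm z)\<^sup>2)"
proof -
  have "(norm (qcnj z \<odot> qi \<odot> w))\<^sup>2 = (norm z)\<^sup>2 * (norm w)\<^sup>2"
    unfolding power2_norm_eq_inner qmult_def qcnj_def qi_def
    by (cases z; cases w) (simp add: inner_vec_def sum_3 cross3_def axis_def vec_eq_iff inner_prod_def
        algebra_simps power2_eq_square)
  then have "(norm (snd (qcnj z \<odot> qi \<odot> w)))\<^sup>2 = (norm z)\<^sup>2 * (norm w)\<^sup>2"
    using assms(1) by (simp add: power2_norm_eq_inner inner_prod_def)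
  then show ?thesis using assms(2)
    by (simp add: ks_P_def power_mult_distrib power_divide) (simp add: field_simps eval_nat_numeral)
qed

lemma ks_cross:
  assumes "z \<noteq> 0" and h: "fst (qcnj z \<odot> qi \<odot> w) = 0"
  shows "cross3 (ks_Q z) (ks_P z w) = ks_G z w"
proof -
  have "cross3 (ks_Q z) (snd (qcnj z \<odot> qi \<odot> w)) = (- ((norm z)\<^sup>2)) *\<^sub>R snd (qcnj z \<odot> w)
        - fst (qcnj z \<odot> qi \<odot> w) *\<^sub>R ks_Q z"
    unfolding power2_norm_eq_inner ks_Q_def qmult_def qcnj_def qi_def
    by (cases z; cases w) (simp add: inner_vec_def sum_3 cross3_def axis_def vec_eq_iff forall_3 inner_prod_def algebra_simps)
  then show ?thesis using assms by (simp add: ks_P_def ks_G_def cross_mult_right)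
qed

lemma ks_PxG:
  "4 *\<^sub>R cross3 (snd (qcnj z \<odot> qi \<odot> w)) (ks_G z w) =
     (norm w)\<^sup>2 *\<^sub>R ks_Q z - (norm z)\<^sup>2 *\<^sub>R ks_Q w"
proof -
  have "(- 2) *\<^sub>R cross3 (snd (qcnj z \<odot> qi \<odot> w)) (snd (qcnj z \<odot> w)) =
     (norm w)\<^sup>2 *\<^sub>R ks_Q z - (norm z)\<^sup>2 *\<^sub>R ks_Q w"
    unfolding power2_norm_eq_inner ks_Q_def qmult_def qcnj_def qi_def
    by (cases z; cases w)
      (simp add: inner_vec_def sum_3 cross3_def axis_def vec_eq_iff forall_3 inner_prod_def algebra_simps)
  then show ?thesis by (simp add: ks_G_def cross_mult_right)
qed

lemma ks_ellipse:
  assumes "z \<noteq> 0" and h: "fst (qcnj z \<odot> qi \<odot> w) = 0" and pos: "\<mu> > 0" "M > 0" "\<phi> > 0"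
  defines "c \<equiv> resc \<mu> M \<phi> (ks_axis \<mu> \<phi> z w)"
  shows "kep_axis \<mu> M (c *\<^sub>R ks_P z w) (ks_Q z) = ks_axis \<mu> \<phi> z w"
    and "kep_ecc \<mu> M (c *\<^sub>R ks_P z w) (ks_Q z) = ks_ecc \<mu> \<phi> z w"
    and "kep_ang \<mu> M (c *\<^sub>R ks_P z w) (ks_Q z) = ks_ang \<mu> M \<phi> z w"
proof -
  define a where "a = ks_axis \<mu> \<phi> z w"
  define r where "r = (norm z)\<^sup>2"
  define W where "W = (norm w)\<^sup>2"
  have r: "r > 0" and W: "W \<ge> 0" using assms by (auto simp: r_def W_def)
  have a: "a = (r + W / (8 * \<mu> * \<phi>)) / 2" by (simp add: a_def ks_axis_def r_def W_def)
  have ap: "a > 0" unfolding a using r W pos by (simp add: add_pos_nonneg)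
  have c2: "c\<^sup>2 = \<mu> * M / (2 * \<phi> * a)"
    using ap pos by (simp add: c_def resc_def flip: a_def)
  have P2: "(norm (ks_P z w))\<^sup>2 = W / (4 * r)"
    using ks_P_norm[OF h] assms by (simp add: r_def W_def)
  have E: "(norm (c *\<^sub>R ks_P z w))\<^sup>2 / (2 * \<mu>) - \<mu> * M / norm (ks_Q z) = - \<mu> * M / (2 * a)"
  proof -
    have W': "W = (2 * a - r) * (8 * \<mu> * \<phi>)" using pos by (simp add: a field_simps)
    show ?thesis
      using ap pos r
      by (simp add: power_mult_distrib c2 P2 ks_norm W' flip: r_def) (simp add: field_simps)
  qed
  show ax: "kep_axis \<mu> M (c *\<^sub>R ks_P z w) (ks_Q z) = ks_axis \<mu> \<phi> z w"
    unfolding kep_axis_def E using ap pos by (simp add: flip: a_def)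
  show "kep_ang \<mu> M (c *\<^sub>R ks_P z w) (ks_Q z) = ks_ang \<mu> M \<phi> z w"
    unfolding kep_ang_def ax
    by (simp add: ks_ang_def Let_def cross_mult_right ks_cross[OF assms(1) h] c_def)
  have PG: "cross3 (ks_P z w) (ks_G z w) = (1 / (8 * r)) *\<^sub>R (W *\<^sub>R ks_Q z - r *\<^sub>R ks_Q w)"
    unfolding W_def r_def ks_PxG[symmetric] by (simp add: ks_P_def cross_mult_left)
  have "kep_ecc \<mu> M (c *\<^sub>R ks_P z w) (ks_Q z) =
      (c\<^sup>2 / (\<mu>\<^sup>2 * M)) *\<^sub>R cross3 (ks_P z w) (ks_G z w) - (1 / r) *\<^sub>R ks_Q z"
    by (simp add: kep_ecc_def cross_mult_right cross_mult_left ks_cross[OF assms(1) h] ks_norm r_def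
        power2_eq_square)
  also have "c\<^sup>2 / (\<mu>\<^sup>2 * M) = 1 / (2 * \<mu> * \<phi> * a)"
    using pos ap unfolding c2 by (simp add: power2_eq_square)
  also have "(1 / (2 * \<mu> * \<phi> * a)) *\<^sub>R cross3 (ks_P z w) (ks_G z w) - (1 / r) *\<^sub>R ks_Q z =
      (W / (16 * \<mu> * \<phi> * a * r) - 1 / r) *\<^sub>R ks_Q z - (1 / (16 * \<mu> * \<phi> * a)) *\<^sub>R ks_Q w"
    unfolding PG using r by (simp add: algebra_simps)
  also have "W / (16 * \<mu> * \<phi> * a * r) - 1 / r = - 1 / (2 * a)"
  proof -
    have W': "W = (2 * a - r) * (8 * \<mu> * \<phi>)" using pos by (simp add: a field_simps)
    show ?thesis using ap pos r unfolding W' by (simp add: field_simps)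
  qed
  finally show "kep_ecc \<mu> M (c *\<^sub>R ks_P z w) (ks_Q z) = ks_ecc \<mu> \<phi> z w"
    by (simp add: ks_ecc_def scaleR_add_right algebra_simps flip: a_def)
qed

text \<open>The action conjugate to \<open>\<delta>\<^sub>1\<close>, with \<open>L1'\<close> the value of \<open>L\<close> at the semi major axis \<open>a\<close>.\<close>

definition calL1 :: "real \<Rightarrow> real \<Rightarrow> real \<Rightarrow> real \<Rightarrow> real" where
  "calL1 \<mu> M \<phi> a = sqrt (2 * \<phi>) * (circ_L \<mu> M a)\<^sup>2 / (\<mu> powr (3/2) * M)"

text \<open>The torus of the fast angles is parametrized by \<open>(\<delta>1, l2')\<close>: \<open>\<delta>1\<close> is the eccentric anomaly
  on the inner KS-ellipse and \<open>l2 = l2' - f1'(L2) / (2 f1(L2)) Re (cnj P1 Q1)\<close>. Being a pull-back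
  from the positions, the regularized perturbing function is \<open>\<bar>Q1\<bar> Fpert\<close> there.\<close>

definition FFsec :: "real \<Rightarrow> real \<Rightarrow> real \<Rightarrow> real \<Rightarrow> real \<Rightarrow> shape \<Rightarrow> real \<Rightarrow> real" where
  "FFsec m0 m1 m2 f a1 \<equiv> \<lambda>(e1, j1, e2, j2) \<alpha>.
     (let \<mu> = mu1 m0 m1; M = Mass1 m0 m1; a2 = a1 / \<alpha>;
          L2 = circ_L (mu2 m0 m1 m2) (Mass2 m0 m1 m2) a2;
          \<phi> = f1 m0 m1 m2 f L2; \<phi>' = deriv (f1 m0 m1 m2 f) L2
      in 1 / (4 * pi\<^sup>2) * integral (cbox (0, 0) (2 * pi, 2 * pi)) (\<lambda>(\<delta>1, l2').
        (let Q1 = ell_pos a1 e1 j1 \<delta>1;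
             P1 = (1 / resc \<mu> M \<phi> a1) *\<^sub>R ell_mom \<mu> M a1 e1 j1 \<delta>1;
             l2 = l2' - \<phi>' / (2 * \<phi>) * (P1 \<bullet> Q1);
             Q2 = ell_pos a2 e2 j2 (ecc_anomaly (norm e2) l2)
         in norm Q1 * Fpert m0 m1 m2 Q1 Q2)))"

definition FFquad :: "real \<Rightarrow> real \<Rightarrow> real \<Rightarrow> real \<Rightarrow> real \<Rightarrow> shape \<Rightarrow> real" where
  "FFquad m0 m1 m2 f a1 s = cubic_coeff (FFsec m0 m1 m2 f a1 s)"

text \<open>States are \<open>(z, w, P2, Q2)\<close>.\<close>

type_synonym rstate = "quat \<times> quat \<times> vec \<times> vec"

definition rf1 :: "real \<Rightarrow> real \<Rightarrow> real \<Rightarrow> real \<Rightarrow> vec \<Rightarrow> vec \<Rightarrow> real" where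
  "rf1 m0 m1 m2 f P2 Q2 =
     (let \<mu> = mu2 m0 m1 m2; M = Mass2 m0 m1 m2 in
      f1 m0 m1 m2 f (circ_L \<mu> M (kep_axis \<mu> M P2 Q2)))"

definition rshape_of :: "real \<Rightarrow> real \<Rightarrow> real \<Rightarrow> real \<Rightarrow> rstate \<Rightarrow> shape" where
  "rshape_of m0 m1 m2 f \<equiv> \<lambda>(z, w, P2, Q2).
     (let \<phi> = rf1 m0 m1 m2 f P2 Q2 in
      (ks_ecc (mu1 m0 m1) \<phi> z w, ks_ang (mu1 m0 m1) (Mass1 m0 m1) \<phi> z w,
       kep_ecc (mu2 m0 m1 m2) (Mass2 m0 m1 m2) P2 Q2,
       kep_ang (mu2 m0 m1 m2) (Mass2 m0 m1 m2) P2 Q2))"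

text \<open>The level set lies in \<open>\<Sigma>\<^sup>0 \<times> T\<^sup>*(\<real>\<^sup>3 - 0)\<close>, collisions \<open>z = 0\<close> included. The passage from
  \<open>\<Sigma>\<^sup>0\<close> to \<open>V\<^sup>0\<close> is part of the reduction, since \<open>rshape_of\<close> is invariant under the circle
  action; a fibre of \<open>rshape_of\<close> in the level set is one orbit of this circle and of the torus.\<close>

definition rquad_system ::
  "real \<Rightarrow> real \<Rightarrow> real \<Rightarrow> real \<Rightarrow> real \<Rightarrow> real \<Rightarrow> real \<Rightarrow> rstate hsys" where
  "rquad_system m0 m1 m2 a1 a2 f C =
     \<lparr>level = {(z, w, P2, Q2). (z, w) \<noteq> (0, 0) \<and> fst (qcnj z \<odot> qi \<odot> w) = 0 \<and> Q2 \<noteq> 0 \<and>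
         ks_axis (mu1 m0 m1) (rf1 m0 m1 m2 f P2 Q2) z w = a1 \<and>
         kep_axis (mu2 m0 m1 m2) (Mass2 m0 m1 m2) P2 Q2 = a2 \<and>
         noncirc (rshape_of m0 m1 m2 f (z, w, P2, Q2)) \<and>
         ks_G z w + cross3 Q2 P2 = C *\<^sub>R axis 3 1},
      same = (\<lambda>x y. same_shape (rshape_of m0 m1 m2 f x) (rshape_of m0 m1 m2 f y)),
      form = (\<lambda>(z, w, P2, Q2) (z', w', P2', Q2').
         w \<bullet> z' - z \<bullet> w' + P2 \<bullet> Q2' - Q2 \<bullet> P2'),
      ham = (\<lambda>x. FFquad m0 m1 m2 f a1 (rshape_of m0 m1 m2 f x))\<rparr>"

end

theory Submission
  imports Defs
begin

text \<open>Both reduced spaces are presented by the shapes of the pairs of ellipses, that is, by the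
  eccentricity vectors and normalized angular momenta. The inner ellipses of given semi major axis
  are a product of two spheres, and the Kustaanheimo-Stiefel variables lie over them through a pair
  of Hopf maps; hence the symplectic forms of both systems are combinations of area forms, weighted
  by \<open>\<L>\<^sub>1, L\<^sub>2\<close> for the regularized and by \<open>L\<^sub>1, L\<^sub>2\<close> for the other one. The outer mass only enters
  \<open>L\<^sub>2\<close>, and \<open>m\<^sub>2'\<close> is chosen such that \<open>L\<^sub>2(m\<^sub>2') : L\<^sub>1 = L\<^sub>2(m\<^sub>2) : \<L>\<^sub>1\<close>. Then both spaces of shapes coincide
  and their forms are proportional. Finally \<open>\<bar>Q\<^sub>1\<bar> d\<delta>\<^sub>1 = a\<^sub>1 dl\<^sub>1\<close>, and the shift from \<open>l\<^sub>2'\<close> to \<open>l\<^sub>2\<close> does not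
  change averages, so that the two Hamiltonians are proportional functions of the shape.\<close>

section \<open>Smooth maps\<close>

text \<open>The definitions test reduced systems by functions and curves on level sets, not by
  charts. What replaces charts is a smooth local section of the map to shapes through every point:
  it lifts functions and test curves alike. Sections are built for the inner and outer motions
  separately; the momentum constraint then costs nothing, because it is a condition on the shape
  alone. Only the Kustaanheimo-Stiefel factor is computed. Ordinary Kepler motion is its case
  \<open>\<phi> = \<mu> M / (2 a)\<close>, in which the momentum is not rescaled, seen through the
  Kustaanheimo-Stiefel map outside the collisions. The momentum relation is homogeneous, so
  \<open>C\<close> has to be scaled by the same ratio \<open>r\<close> as the actions. With
  Hamiltonians in the ratio \<open>K\<close>, the vector fields are then in the ratio
  \<open>K r\<close>. Although \<open>r\<close> depends on \<open>f\<close> and \<open>a2\<close>,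
  it is also a ratio of functions of the two outer masses, so the conjugating factor can be named
  beforehand. At degenerate inner ellipses, of eccentricity 1, the change to the mean anomaly loses
  its Lipschitz bound; all averages are therefore written in eccentric anomalies.\<close>

lemma Cn_cong_imp:
  assumes "open U" "Cn n f U" "\<And>x. x \<in> U \<Longrightarrow> f x = g x"
  shows "Cn n g U"
  using assms(2,3)
proof (induction n arbitrary: f g)
  case 0
  then show ?case by (simp cong: continuous_on_cong)
next
  case (Suc n)
  have d: "f differentiable (at x)" if "x \<in> U" for x
    using Suc.prems(1) that assms(1) by (simp add: differentiable_on_eq_differentiable_at)
  have eq: "frechet_derivative f (at x) = frechet_derivative g (at x)" if "x \<in> U" for x
    by (rule frechet_derivative_transform_within_open[OF d[OF that] assms(1) that Suc.prems(2)])
  have "g differentiable (at x)" if "x \<in> U" for x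
  proof -
    from d[OF that] obtain D where "(f has_derivative D) (at x)" unfolding differentiable_def by blast
    from has_derivative_transform_within_open[OF this assms(1) that Suc.prems(2)]
    show ?thesis by (rule differentiableI)
  qed
  moreover have "Cn n (\<lambda>x. frechet_derivative g (at x) b) U" if "b \<in> Basis" for b
  proof (rule Suc.IH)
    show "Cn n (\<lambda>x. frechet_derivative f (at x) b) U" using Suc.prems(1) that by simp
  qed (simp add: eq)
  ultimately show ?case by (simp add: differentiable_on_eq_differentiable_at assms(1))
qed

lemma Cn_cong:
  assumes "open U" "\<And>x. x \<in> U \<Longrightarrow> f x = g x"
  shows "Cn n f U \<longleftrightarrow> Cn n g U"
  by (metis Cn_cong_imp[OF assms(1)] assms(2))

text \<open>\<open>frechet_derivative\<close> is a choice, but on an open set it agrees with every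
  derivative found by hand. This rule and \<open>Cn_SucE\<close> let the inductions below work with
  explicit derivatives.\<close>

lemma Cn_SucI:
  assumes "open U" "\<And>x. x \<in> U \<Longrightarrow> (g has_derivative g' x) (at x)"
    and "\<And>b. b \<in> Basis \<Longrightarrow> Cn n (\<lambda>x. g' x b) U"
  shows "Cn (Suc n) g U"
proof -
  have "g differentiable_on U"
    using assms(1,2) by (auto simp: differentiable_on_eq_differentiable_at differentiable_def)
  moreover have "Cn n (\<lambda>x. frechet_derivative g (at x) b) U" if "b \<in> Basis" for b
    using assms(3)[OF that] frechet_derivative_at[OF assms(2)]
    by (subst Cn_cong[OF assms(1)]) (auto dest: fun_cong)
  ultimately show ?thesis by simp
qed

lemma Cn_SucE:
  assumes "open U" "Cn (Suc n) g U"
  obtains g' where "\<And>x. x \<in> U \<Longrightarrow> (g has_derivative g' x) (at x)"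
    "\<And>b. b \<in> Basis \<Longrightarrow> Cn n (\<lambda>x. g' x b) U"
proof (rule that[of "\<lambda>x. frechet_derivative g (at x)"])
  show "(g has_derivative frechet_derivative g (at x)) (at x)" if "x \<in> U" for x
    using assms that frechet_derivative_works by (auto simp: differentiable_on_eq_differentiable_at)
  show "Cn n (\<lambda>x. frechet_derivative g (at x) b) U" if "b \<in> Basis" for b
    using assms(2) that by simp
qed

lemma Cn_Suc_imp: "open U \<Longrightarrow> Cn (Suc n) g U \<Longrightarrow> Cn n g U"
  by (induction n arbitrary: g) (simp_all add: differentiable_imp_continuous_on)

lemma Cn_subset:
  assumes "Cn n g U" "V \<subseteq> U" shows "Cn n g V"
  using assms(1)
proof (induction n arbitrary: g)
  case 0
  then show ?case using assms(2) continuous_on_subset by auto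
next
  case (Suc n)
  then show ?case using assms(2) differentiable_on_subset by auto
qed

lemma Cn_const: "open U \<Longrightarrow> Cn n (\<lambda>x. c) U"
proof (induction n arbitrary: c)
  case (Suc n)
  show ?case
    by (rule Cn_SucI[OF Suc.prems has_derivative_const Suc.IH[OF Suc.prems]])
qed simp

lemma Cn_linear:
  assumes "open U" "bounded_linear g"
  shows "Cn n g U"
proof (cases n)
  case (Suc k)
  show ?thesis unfolding Suc
    by (rule Cn_SucI[OF assms(1) bounded_linear_imp_has_derivative[OF assms(2)] Cn_const[OF assms(1)]])
qed (simp add: linear_continuous_on assms)

lemma Cn_add:
  assumes "open U" shows "Cn n f U \<Longrightarrow> Cn n g U \<Longrightarrow> Cn n (\<lambda>x. f x + g x) U"
proof (induction n arbitrary: f g)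
  case (Suc n)
  from Cn_SucE[OF assms Suc.prems(1)] obtain f' where f': "\<And>x. x \<in> U \<Longrightarrow> (f has_derivative f' x) (at x)"
    "\<And>b. b \<in> Basis \<Longrightarrow> Cn n (\<lambda>x. f' x b) U" by blast
  from Cn_SucE[OF assms Suc.prems(2)] obtain g' where g': "\<And>x. x \<in> U \<Longrightarrow> (g has_derivative g' x) (at x)"
    "\<And>b. b \<in> Basis \<Longrightarrow> Cn n (\<lambda>x. g' x b) U" by blast
  show ?case
    by (rule Cn_SucI[where g' = "\<lambda>x v. f' x v + g' x v"])
      (use assms f' g' Suc.IH in \<open>auto intro: has_derivative_add\<close>)
qed (simp add: continuous_on_add)

lemma Cn_mult:
  assumes "open U" shows "Cn n f U \<Longrightarrow> Cn n g U \<Longrightarrow> Cn n (\<lambda>x. f x * g x) U"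
proof (induction n arbitrary: f g)
  case (Suc n)
  from Cn_SucE[OF assms Suc.prems(1)] obtain f' where f': "\<And>x. x \<in> U \<Longrightarrow> (f has_derivative f' x) (at x)"
    "\<And>b. b \<in> Basis \<Longrightarrow> Cn n (\<lambda>x. f' x b) U" by blast
  from Cn_SucE[OF assms Suc.prems(2)] obtain g' where g': "\<And>x. x \<in> U \<Longrightarrow> (g has_derivative g' x) (at x)"
    "\<And>b. b \<in> Basis \<Longrightarrow> Cn n (\<lambda>x. g' x b) U" by blast
  show ?case
  proof (rule Cn_SucI[OF assms])
    show "((\<lambda>x. f x * g x) has_derivative (\<lambda>v. f x * g' x v + f' x v * g x)) (at x)" if "x \<in> U" for x
      by (rule has_derivative_mult[OF f'(1) g'(1)]) (fact that)+
    show "Cn n (\<lambda>x. f x * g' x b + f' x b * g x) U" if "b \<in> Basis" for b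
      by (intro Cn_add Suc.IH f'(2) g'(2) that assms Suc.prems[THEN Cn_Suc_imp[OF assms]])
  qed
qed (simp add: continuous_on_mult)

lemma Cn_sum:
  assumes "open U" "finite A" "\<And>i. i \<in> A \<Longrightarrow> Cn n (f i) U"
  shows "Cn n (\<lambda>x. \<Sum>i\<in>A. f i x) U"
  using assms(2,3) by (induction A) (auto intro: Cn_add[OF assms(1)] Cn_const[OF assms(1)])

text \<open>The derivative of \<open>inverse f\<close> is a product of \<open>f'\<close> with two
  copies of \<open>inverse f\<close>, whose class is known one order lower. The same bootstrapping
  serves \<open>sqrt\<close>, through \<open>inverse (sqrt f)\<close>.\<close>

lemma Cn_inverse:
  assumes "open U" shows "Cn n f U \<Longrightarrow> (\<And>x. x \<in> U \<Longrightarrow> f x \<noteq> 0) \<Longrightarrow> Cn n (\<lambda>x. inverse (f x)) U"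
proof (induction n arbitrary: f)
  case (Suc n)
  from Cn_SucE[OF assms Suc.prems(1)] obtain f' where f': "\<And>x. x \<in> U \<Longrightarrow> (f has_derivative f' x) (at x)"
    "\<And>b. b \<in> Basis \<Longrightarrow> Cn n (\<lambda>x. f' x b) U" by blast
  have "Cn n (\<lambda>x. inverse (f x)) U"
    using Suc.IH Suc.prems Cn_Suc_imp[OF assms] by blast
  note i = this
  show ?case
  proof (rule Cn_SucI[OF assms])
    show "((\<lambda>x. inverse (f x)) has_derivative (\<lambda>v. - (inverse (f x) * f' x v * inverse (f x)))) (at x)"
      if "x \<in> U" for x
      by (rule Deriv.has_derivative_inverse[OF Suc.prems(2) f'(1)]) (fact that)+
    have "Cn n (\<lambda>x. (-1) * (inverse (f x) * f' x b * inverse (f x))) U" if "b \<in> Basis" for b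
      by (intro Cn_mult[OF assms] i f'(2) that Cn_const[OF assms])
    then show "Cn n (\<lambda>x. - (inverse (f x) * f' x b * inverse (f x))) U" if "b \<in> Basis" for b
      using that by simp
  qed
qed (simp add: continuous_on_inverse)

lemma Cn_sqrt:
  assumes "open U" shows "Cn n f U \<Longrightarrow> (\<And>x. x \<in> U \<Longrightarrow> f x > 0) \<Longrightarrow> Cn n (\<lambda>x. sqrt (f x)) U"
proof (induction n arbitrary: f)
  case (Suc n)
  from Cn_SucE[OF assms Suc.prems(1)] obtain f' where f': "\<And>x. x \<in> U \<Longrightarrow> (f has_derivative f' x) (at x)"
    "\<And>b. b \<in> Basis \<Longrightarrow> Cn n (\<lambda>x. f' x b) U" by blast
  have "Cn n (\<lambda>x. sqrt (f x)) U"
    using Suc.IH Suc.prems Cn_Suc_imp[OF assms] by blast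
  then have i: "Cn n (\<lambda>x. inverse (sqrt (f x))) U"
    by (rule Cn_inverse[OF assms]) (use Suc.prems(2) in force)
  have *: "Cn n (\<lambda>x. f' x b * (inverse (sqrt (f x)) * (1/2))) U" if "b \<in> Basis" for b
    by (intro Cn_mult[OF assms] i f'(2) that Cn_const[OF assms])
  have "((\<lambda>x. sqrt (f x)) has_derivative (\<lambda>v. f' x v * (inverse (sqrt (f x)) * (1/2)))) (at x)"
    if "x \<in> U" for x
    using has_derivative_real_sqrt[OF Suc.prems(2)[OF that] f'(1)[OF that]] by (simp add: field_simps)
  from Cn_SucI[OF assms this *] show ?case .
qed (simp add: continuous_on_real_sqrt)

text \<open>By the chain rule a partial derivative of the composite is a sum of products of partials
  of \<open>F\<close> with partials of \<open>h\<close> taken along \<open>F\<close>. The latter are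
  composites of the same kind, so the induction varies \<open>h\<close> and keeps
  \<open>F\<close>.\<close>

lemma Cn_compose:
  fixes F :: "'a::euclidean_space \<Rightarrow> 'b::euclidean_space"
  assumes "open U" "open V" "F ` U \<subseteq> V"
  shows "Cn n h V \<Longrightarrow> (\<And>i. i \<in> Basis \<Longrightarrow> Cn n (\<lambda>x. F x \<bullet> i) U) \<Longrightarrow> Cn n (\<lambda>x. h (F x)) U"
proof (induction n arbitrary: h)
  case 0
  then have "continuous_on U F" by (simp add: continuous_on_componentwise[of U F])
  from continuous_on_compose2[OF _ this assms(3)] 0 show ?case by simp
next
  case (Suc n)
  from Cn_SucE[OF assms(2) Suc.prems(1)] obtain h' where h': "\<And>x. x \<in> V \<Longrightarrow> (h has_derivative h' x) (at x)"
    "\<And>b. b \<in> Basis \<Longrightarrow> Cn n (\<lambda>x. h' x b) V" by blast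
  define F' where "F' i x = frechet_derivative (\<lambda>x. F x \<bullet> i) (at x)" for i x
  have F': "((\<lambda>x. F x \<bullet> i) has_derivative F' i x) (at x)" if "i \<in> Basis" "x \<in> U" for i x
    using Suc.prems(2)[OF that(1)] that(2) assms(1)
    by (simp add: F'_def frechet_derivative_works differentiable_on_eq_differentiable_at)
  have F'c: "Cn n (\<lambda>x. F' i x b) U" if "i \<in> Basis" "b \<in> Basis" for i b
    using Suc.prems(2)[OF that(1)] that(2) by (simp add: F'_def)
  have Fc: "Cn n (\<lambda>x. F x \<bullet> i) U" if "i \<in> Basis" for i
    by (rule Cn_Suc_imp[OF assms(1) Suc.prems(2)[OF that]])
  have h'F: "Cn n (\<lambda>x. h' (F x) i) U" if "i \<in> Basis" for i
    by (rule Suc.IH[of "\<lambda>y. h' y i"]) (fact h'(2)[OF that] Fc)+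
  have "Cn n (\<lambda>x. \<Sum>i\<in>Basis. F' i x b * h' (F x) i) U" if "b \<in> Basis" for b
    by (rule Cn_sum[OF assms(1) finite_Basis Cn_mult[OF assms(1) F'c h'F]]) (use that in auto)
  moreover have "((\<lambda>x. h (F x)) has_derivative (\<lambda>v. \<Sum>i\<in>Basis. F' i x v * h' (F x) i)) (at x)" if "x \<in> U" for x
  proof -
    let ?D = "\<lambda>v. \<Sum>i\<in>Basis. F' i x v *\<^sub>R i"
    have "(F has_derivative ?D) (at x)"
      using F'[OF _ that]
      by (subst has_derivative_componentwise_within) (simp add: inner_sum_left inner_Basis if_distrib cong: if_cong)
    moreover have H: "(h has_derivative h' (F x)) (at (F x))" using h'(1) that assms(3) by auto
    ultimately have "((\<lambda>x. h (F x)) has_derivative (\<lambda>v. h' (F x) (?D v))) (at x)"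
      by (rule has_derivative_compose)
    moreover have "h' (F x) (?D v) = (\<Sum>i\<in>Basis. F' i x v * h' (F x) i)" for v
      using has_derivative_linear[OF H] by (simp add: linear_sum linear_scale)
    ultimately show ?thesis by simp
  qed
  ultimately show ?case by (intro Cn_SucI[OF assms(1)])
qed

section \<open>Smooth maps between Euclidean spaces\<close>

definition smooth_on :: "'a::euclidean_space set \<Rightarrow> ('a \<Rightarrow> 'b::euclidean_space) \<Rightarrow> bool" where
  "smooth_on U f \<longleftrightarrow> open U \<and> (\<forall>b\<in>Basis. \<forall>n. Cn n (\<lambda>x. f x \<bullet> b) U)"

lemma smooth_on_real: "smooth_on U (f :: _ \<Rightarrow> real) \<longleftrightarrow> open U \<and> (\<forall>n. Cn n f U)"
  by (simp add: smooth_on_def)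

lemma smooth_on_subset: "smooth_on U f \<Longrightarrow> open V \<Longrightarrow> V \<subseteq> U \<Longrightarrow> smooth_on V f"
  by (auto simp: smooth_on_def intro: Cn_subset)

lemma smooth_on_compose:
  assumes "smooth_on V g" "smooth_on U f" "f ` U \<subseteq> V"
  shows "smooth_on U (\<lambda>x. g (f x))"
  using assms unfolding smooth_on_def by (auto intro!: Cn_compose[where V = V and F = f and h = "\<lambda>y. g y \<bullet> _"])

lemma smooth_on_linear:
  assumes "open U" "bounded_linear f"
  shows "smooth_on U f"
  using assms by (auto simp: smooth_on_def intro!: Cn_linear bounded_linear_compose[OF bounded_linear_inner_left])

lemma smooth_on_bounded_linear:
  "bounded_linear g \<Longrightarrow> smooth_on U f \<Longrightarrow> smooth_on U (\<lambda>x. g (f x))"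
  by (rule smooth_on_compose[where V = UNIV and g = g]) (auto intro: smooth_on_linear)

lemma smooth_on_const: "open U \<Longrightarrow> smooth_on U (\<lambda>x. c)"
  by (simp add: smooth_on_def Cn_const)

lemma smooth_on_id: "open U \<Longrightarrow> smooth_on U (\<lambda>x. x)"
  by (intro smooth_on_linear bounded_linear_ident)

text \<open>In coordinates this is a polynomial in the components of \<open>f\<close> and
  \<open>g\<close>. One rule thus covers scaling, inner and cross products, quaternion
  multiplication and the polarized Hopf map.\<close>

lemma smooth_on_bilinear:
  assumes "bounded_bilinear B" "smooth_on U f" "smooth_on U g"
  shows "smooth_on U (\<lambda>x. B (f x) (g x))"
proof -
  interpret bounded_bilinear B by fact
  have "B (f x) (g x) \<bullet> b = (\<Sum>i\<in>Basis. \<Sum>k\<in>Basis. (f x \<bullet> i) * (g x \<bullet> k) * (B i k \<bullet> b))" for x b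
  proof -
    have "B (f x) (g x) = B (\<Sum>i\<in>Basis. (f x \<bullet> i) *\<^sub>R i) (\<Sum>k\<in>Basis. (g x \<bullet> k) *\<^sub>R k)"
      by (simp only: euclidean_representation)
    also have "\<dots> = (\<Sum>i\<in>Basis. \<Sum>k\<in>Basis. (f x \<bullet> i) *\<^sub>R (g x \<bullet> k) *\<^sub>R B i k)"
      by (simp only: sum_left, simp only: sum_right scaleR_left scaleR_right)
        (simp only: scaleR_left_commute)
    finally show ?thesis by (simp add: inner_sum_left mult.assoc)
  qed
  moreover have "Cn n (\<lambda>x. \<Sum>i\<in>Basis. \<Sum>k\<in>Basis. (f x \<bullet> i) * (g x \<bullet> k) * (B i k \<bullet> b)) U" for b n
    by (intro Cn_sum Cn_mult Cn_const finite_Basis) (use assms(2,3) in \<open>auto simp: smooth_on_def\<close>)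
  ultimately show ?thesis
    using assms(2) by (simp add: smooth_on_def)
qed

lemma smooth_on_Pair:
  "smooth_on U f \<Longrightarrow> smooth_on U g \<Longrightarrow> smooth_on U (\<lambda>x. (f x, g x))"
  by (auto simp: smooth_on_def Basis_prod_def)

lemmas smooth_on_fst = smooth_on_bounded_linear[OF bounded_linear_fst]
lemmas smooth_on_snd = smooth_on_bounded_linear[OF bounded_linear_snd]
lemmas smooth_on_minus = smooth_on_bounded_linear[OF bounded_linear_minus[OF bounded_linear_ident]]
lemmas smooth_on_scaleR = smooth_on_bilinear[OF bounded_bilinear_scaleR]
lemmas smooth_on_mult = smooth_on_bilinear[OF bounded_bilinear_mult]
lemmas smooth_on_inner = smooth_on_bilinear[OF bounded_bilinear_inner]

lemma smooth_on_add: "smooth_on U f \<Longrightarrow> smooth_on U g \<Longrightarrow> smooth_on U (\<lambda>x. f x + g x)"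
  by (auto simp: smooth_on_def inner_add_left intro: Cn_add)

lemma smooth_on_diff: "smooth_on U f \<Longrightarrow> smooth_on U g \<Longrightarrow> smooth_on U (\<lambda>x. f x - g x)"
  using smooth_on_add[of U f "\<lambda>x. - g x"] smooth_on_minus[of U g] by simp

lemma smooth_on_inverse:
  "smooth_on U f \<Longrightarrow> (\<And>x. x \<in> U \<Longrightarrow> f x \<noteq> 0) \<Longrightarrow> smooth_on U (\<lambda>x. inverse (f x :: real))"
  by (auto simp: smooth_on_real intro: Cn_inverse)

lemma smooth_on_divide:
  "smooth_on U f \<Longrightarrow> smooth_on U g \<Longrightarrow> (\<And>x. x \<in> U \<Longrightarrow> g x \<noteq> 0) \<Longrightarrow> smooth_on U (\<lambda>x. f x / g x :: real)"
  unfolding divide_inverse by (intro smooth_on_mult smooth_on_inverse)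

lemma smooth_on_sqrt:
  "smooth_on U f \<Longrightarrow> (\<And>x. x \<in> U \<Longrightarrow> f x > 0) \<Longrightarrow> smooth_on U (\<lambda>x. sqrt (f x))"
  by (auto simp: smooth_on_real intro: Cn_sqrt)

lemma smooth_on_norm:
  "smooth_on U f \<Longrightarrow> (\<And>x. x \<in> U \<Longrightarrow> f x \<noteq> 0) \<Longrightarrow> smooth_on U (\<lambda>x. norm (f x))"
  unfolding norm_eq_sqrt_inner by (intro smooth_on_sqrt smooth_on_inner) auto

lemma smooth_on_differentiable:
  assumes "smooth_on U f" "x \<in> U" shows "f differentiable (at x)"
proof (subst differentiable_componentwise_within, rule ballI)
  fix b :: 'b assume "b \<in> Basis"
  with assms have "open U" "Cn (Suc 0) (\<lambda>x. f x \<bullet> b) U" by (auto simp only: smooth_on_def)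
  then show "(\<lambda>x. f x \<bullet> b) differentiable (at x)"
    using assms(2) by (simp add: differentiable_on_eq_differentiable_at)
qed

lemma smooth_on_continuous: "smooth_on U f \<Longrightarrow> continuous_on U f"
  by (meson continuous_at_imp_continuous_on differentiable_imp_continuous_within smooth_on_differentiable)

lemma smooth_on_vector_derivative:
  assumes "smooth_on U f" "(c has_vector_derivative v) (at t)" "c t \<in> U"
  obtains u where "((\<lambda>s. f (c s)) has_vector_derivative u) (at t)"
proof -
  obtain f' where "(f has_derivative f') (at (c t))"
    using smooth_on_differentiable[OF assms(1,3)] by (auto simp: differentiable_def)
  from vector_derivative_diff_chain_within[OF assms(2), of f f'] this that show ?thesis
    by (auto simp: o_def intro: has_derivative_at_withinI)
qed

section \<open>Reduced systems over a common base\<close>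

text \<open>Substitute for a tangent vector and its image under the differential of
  \<open>p\<close>, meaningful for any set \<open>X\<close> and for a map \<open>p\<close> of which
  only the values on \<open>X\<close> count.\<close>

definition curve_vel ::
  "'a::euclidean_space set \<Rightarrow> ('a \<Rightarrow> 'b::euclidean_space) \<Rightarrow> 'a \<Rightarrow> 'a \<Rightarrow> 'b \<Rightarrow> bool" where
  "curve_vel X p x u v \<longleftrightarrow> (\<exists>y. range y \<subseteq> X \<and> y 0 = x \<and> (y has_vector_derivative u) (at (0::real)) \<and>
     ((\<lambda>s. p (y s)) has_vector_derivative v) (at 0))"

text \<open>The clauses are surjectivity, local smooth extendability of \<open>p\<close> off
  \<open>X\<close>, a smooth local section through every point of \<open>X\<close>, and
  \<open>\<Omega>\<close> being the pull-back of \<open>\<omega>\<close>. A section is smooth on an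
  open set but has to land in \<open>X\<close> only over points of \<open>B\<close>.\<close>

definition submersion_onto ::
  "'a::euclidean_space set \<Rightarrow> ('a \<Rightarrow> 'b::euclidean_space) \<Rightarrow> 'b set \<Rightarrow> ('a \<Rightarrow> 'a \<Rightarrow> real) \<Rightarrow>
    ('b \<Rightarrow> 'b \<Rightarrow> 'b \<Rightarrow> real) \<Rightarrow> bool" where
  "submersion_onto X p B \<Omega> \<omega> \<longleftrightarrow> p ` X = B \<and>
     (\<forall>x\<in>X. \<exists>U P. x \<in> U \<and> smooth_on U P \<and> (\<forall>y\<in>U \<inter> X. P y = p y)) \<and>
     (\<forall>x\<in>X. \<exists>V \<sigma>. p x \<in> V \<and> smooth_on V \<sigma> \<and> \<sigma> (p x) = x \<and> (\<forall>b\<in>V \<inter> B. \<sigma> b \<in> X \<and> p (\<sigma> b) = b)) \<and>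
     (\<forall>x u v u' v'. curve_vel X p x u v \<and> curve_vel X p x u' v' \<longrightarrow> \<Omega> u u' = \<omega> (p x) v v')"

lemma smooth_on_open: "smooth_on U f \<Longrightarrow> open U"
  by (simp add: smooth_on_def)

text \<open>\<open>p\<close> may be arbitrary off \<open>X\<close>; the velocity is that of a smooth
  extension \<open>P\<close>, which agrees with \<open>p\<close> along the curve near
  \<open>t\<close>.\<close>

lemma submersion_vel:
  assumes "submersion_onto X p B \<Omega> \<omega>" "open J" "t \<in> J" "\<And>s. s \<in> J \<Longrightarrow> y s \<in> X"
    "(y has_vector_derivative u) (at t)"
  obtains v where "((\<lambda>s. p (y s)) has_vector_derivative v) (at t)"
proof -
  obtain U P where U: "y t \<in> U" "smooth_on U P" "\<forall>z\<in>U \<inter> X. P z = p z"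
    using assms unfolding submersion_onto_def by meson
  obtain v where v: "((\<lambda>s. P (y s)) has_vector_derivative v) (at t)"
    using smooth_on_vector_derivative[OF U(2) assms(5) U(1)] .
  have "\<forall>\<^sub>F s in at t. y s \<in> U"
    using has_vector_derivative_continuous[OF assms(5)] smooth_on_open[OF U(2)] U(1)
    by (auto simp: continuous_within intro: topological_tendstoD)
  moreover have "\<forall>\<^sub>F s in at t. s \<in> J"
    using assms(2,3) by (rule eventually_at_in_open')
  ultimately have "\<forall>\<^sub>F s in at t. P (y s) = p (y s)"
    by eventually_elim (use U(3) assms(4) in auto)
  then have "((\<lambda>s. p (y s)) has_vector_derivative v) (at t)"
    using v U assms(3,4)
    by (subst has_vector_derivative_cong_ev[where g = "\<lambda>s. P (y s)"])
      (auto simp: eventually_at_filter eq_commute elim: eventually_mono)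
  then show ?thesis by (rule that)
qed

lemma curve_velI:
  assumes "open J" "t \<in> J" "\<And>s. s \<in> J \<Longrightarrow> y s \<in> X"
    "(y has_vector_derivative u) (at t)" "((\<lambda>s. p (y s)) has_vector_derivative v) (at t)"
  shows "curve_vel X p (y t) u v"
proof -
  \<comment> \<open>\<open>curve_vel\<close> asks for a curve that stays in \<open>X\<close> at all
    times; the constant value outside \<open>J\<close> provides one with the same germ.\<close>
  define z where "z s = (if s + t \<in> J then y (s + t) else y t)" for s
  have shift: "((\<lambda>s. f (s + t)) has_vector_derivative w) (at 0)" if "(f has_vector_derivative w) (at t)"
    for f :: "real \<Rightarrow> 'c::real_normed_vector" and w
  proof -
    have "((\<lambda>s. s + t) has_vector_derivative 1) (at 0)"
      by (auto intro!: derivative_eq_intros simp: has_real_derivative_iff_has_vector_derivative[symmetric])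
    from vector_diff_chain_at[OF this] that show ?thesis by (simp add: o_def)
  qed
  have op: "open ((\<lambda>s. s + t) -` J)"
    by (intro open_vimage assms(1) continuous_intros)
  have "(z has_vector_derivative u) (at 0)"
    by (rule has_vector_derivative_transform_within_open[OF shift[OF assms(4)] op])
      (use assms(2) in \<open>auto simp: z_def\<close>)
  moreover have "((\<lambda>s. p (z s)) has_vector_derivative v) (at 0)"
    by (rule has_vector_derivative_transform_within_open[OF shift[OF assms(5)] op])
      (use assms(2) in \<open>auto simp: z_def\<close>)
  moreover have "range z \<subseteq> X" "z 0 = y t"
    using assms(2,3) by (auto simp: z_def)
  ultimately show ?thesis unfolding curve_vel_def by blast
qed

text \<open>\<open>K\<close> is the ratio of the Hamiltonians. Conjugation sends time
  \<open>t\<close> to \<open>\<kappa> t\<close>, so a base velocity \<open>v'\<close> in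
  \<open>S\<close> becomes \<open>(1 / \<kappa>) v'\<close> in \<open>T\<close>; the last assumption
  is the compatibility of Hamilton's equations with both scalings.\<close>

locale common_base =
  fixes S :: "('a::euclidean_space) hsys" and T :: "('b::euclidean_space) hsys"
    and p :: "'a \<Rightarrow> 'c::euclidean_space" and q :: "'b \<Rightarrow> 'c" and B :: "'c set"
    and eqv :: "'c \<Rightarrow> 'c \<Rightarrow> bool" and \<omega>S \<omega>T :: "'c \<Rightarrow> 'c \<Rightarrow> 'c \<Rightarrow> real" and K \<kappa> :: real
  assumes S: "submersion_onto (level S) p B (form S) \<omega>S"
    and T: "submersion_onto (level T) q B (form T) \<omega>T"
    and eqv: "equivp eqv"
    and sameS: "\<And>x y. x \<in> level S \<Longrightarrow> y \<in> level S \<Longrightarrow> same S x y \<longleftrightarrow> eqv (p x) (p y)"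
    and sameT: "\<And>x y. x \<in> level T \<Longrightarrow> y \<in> level T \<Longrightarrow> same T x y \<longleftrightarrow> eqv (q x) (q y)"
    and ham: "\<And>x y. x \<in> level S \<Longrightarrow> y \<in> level T \<Longrightarrow> eqv (p x) (q y) \<Longrightarrow> ham S x = K * ham T y"
    and K: "K > 0" and \<kappa>: "\<kappa> > 0"
    and \<omega>: "\<And>b v v'. K * \<omega>T b v ((1 / \<kappa>) *\<^sub>R v') = \<omega>S b v v'"
begin

definition corr :: "'a set \<Rightarrow> 'b set" where
  "corr c = {y \<in> level T. \<exists>x\<in>c. eqv (p x) (q y)}"

text \<open>The assumptions are symmetric in the two systems, with inverse ratios. Each transport
  statement below is proved in one direction and used in both.\<close>

lemma flip: "common_base T S q p B eqv \<omega>T \<omega>S (1 / K) (1 / \<kappa>)"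
proof
  show "1 / K * \<omega>S b v ((1 / (1 / \<kappa>)) *\<^sub>R v') = \<omega>T b v v'" for b v v'
    using K \<kappa> by (simp flip: \<omega>)
  show "ham T x = 1 / K * ham S y" if "x \<in> level T" "y \<in> level S" "eqv (q x) (p y)" for x y
    using ham[OF that(2,1)] that(3) eqv K by (simp add: equivp_symp)
qed (use S T eqv sameS sameT K \<kappa> in auto)

lemma corr_proj:
  assumes "x \<in> level S" "y \<in> level T" "eqv (p x) (q y)"
  shows "corr (proj S x) = proj T y"
  using assms sameS sameT eqv unfolding corr_def proj_def
  by (auto intro: equivp_transp[OF eqv] equivp_symp[OF eqv] equivp_reflp[OF eqv])
    (metis equivp_def)+

lemma corr_projD:
  assumes "x \<in> level S" "y \<in> level T" "corr (proj S x) = proj T y"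
  shows "eqv (p x) (q y)"
proof -
  have "y \<in> corr (proj S x)"
    using assms sameT equivp_reflp[OF eqv] by (simp add: proj_def)
  then show ?thesis
    using assms sameS by (auto simp: corr_def proj_def intro: equivp_transp[OF eqv])
qed

lemma lift_point:
  assumes "x \<in> level S" obtains y where "y \<in> level T" "q y = p x"
  using assms S T unfolding submersion_onto_def by (metis imageE imageI)

lemma corr_rspace:
  assumes "c \<in> rspace S"
  shows "corr c \<in> rspace T" "common_base.corr S q p eqv (corr c) = c"
proof -
  interpret F: common_base T S q p B eqv \<omega>T \<omega>S "1 / K" "1 / \<kappa>" by (rule flip)
  obtain x where x: "x \<in> level S" "c = proj S x" using assms by (auto simp: rspace_def)
  obtain y where y: "y \<in> level T" "q y = p x" using lift_point[OF x(1)] .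
  have c: "corr c = proj T y"
    unfolding x(2) by (rule corr_proj) (use x y equivp_reflp[OF eqv] in auto)
  then show "corr c \<in> rspace T" using y by (auto simp: rspace_def)
  show "F.corr (corr c) = c"
    unfolding c using F.corr_proj[OF y(1) x(1)] x(2) y(2) equivp_reflp[OF eqv] by simp
qed

lemma corr_bij: "bij_betw corr (rspace S) (rspace T)"
proof -
  interpret F: common_base T S q p B eqv \<omega>T \<omega>S "1 / K" "1 / \<kappa>" by (rule flip)
  show ?thesis
    by (rule bij_betw_byWitness[where f' = F.corr]) (use corr_rspace F.corr_rspace in auto)
qed

text \<open>Near \<open>x\<close> the pulled-back function is \<open>h\<close> after
  \<open>\<sigma>\<close> after \<open>P\<close>: project by an extension of \<open>p\<close>, lift
  by a section of \<open>q\<close> through a point over \<open>p x\<close>, and evaluate the local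
  representative of \<open>g\<close> there.\<close>

lemma corr_smooth:
  assumes "rsmooth T g" shows "rsmooth S (g \<circ> corr)"
  unfolding rsmooth_def
proof
  fix x assume x: "x \<in> level S"
  obtain y where y: "y \<in> level T" "q y = p x" using lift_point[OF x] .
  obtain U P where U: "x \<in> U" "smooth_on U P" "\<And>z. z \<in> U \<inter> level S \<Longrightarrow> P z = p z"
    using S x unfolding submersion_onto_def by meson
  obtain V \<sigma> where V: "q y \<in> V" "smooth_on V \<sigma>" "\<sigma> (q y) = y"
      "\<And>b. b \<in> V \<inter> B \<Longrightarrow> \<sigma> b \<in> level T \<and> q (\<sigma> b) = b"
    using T y unfolding submersion_onto_def by meson
  obtain W h where W: "open W" "y \<in> W" "\<And>n. Cn n h W" "\<And>z. z \<in> W \<inter> level T \<Longrightarrow> g (proj T z) = h z"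
    using assms y(1) unfolding rsmooth_def by meson
  define V' where "V' = V \<inter> \<sigma> -` W"
  define U' where "U' = U \<inter> P -` V'"
  have oV: "open V'" unfolding V'_def
    by (rule continuous_open_preimage[OF smooth_on_continuous smooth_on_open]) (use V W in auto)
  have oU: "open U'" unfolding U'_def
    by (rule continuous_open_preimage[OF smooth_on_continuous smooth_on_open oV]) (use U in auto)
  have h: "smooth_on W h" using W by (simp add: smooth_on_real)
  have \<sigma>: "smooth_on V' \<sigma>" by (rule smooth_on_subset[OF V(2) oV]) (auto simp: V'_def)
  have P: "smooth_on U' P" by (rule smooth_on_subset[OF U(2) oU]) (auto simp: U'_def)
  have "smooth_on U' (\<lambda>z. h (\<sigma> (P z)))"
    by (rule smooth_on_compose[OF smooth_on_compose[OF h \<sigma>] P]) (auto simp: U'_def V'_def)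
  then have "\<forall>n. Cn n (\<lambda>z. h (\<sigma> (P z))) U'" by (simp add: smooth_on_real)
  moreover have "x \<in> U'" using U V W x y by (simp add: U'_def V'_def)
  moreover have "(g \<circ> corr) (proj S z) = h (\<sigma> (P z))" if z: "z \<in> U' \<inter> level S" for z
  proof -
    have Pz: "P z = p z" using z U(3) by (simp add: U'_def)
    have "p z \<in> B" using S z by (auto simp: submersion_onto_def)
    then have *: "\<sigma> (p z) \<in> level T" "q (\<sigma> (p z)) = p z" "\<sigma> (p z) \<in> W"
      using z V(4) Pz by (auto simp: U'_def V'_def)
    have "corr (proj S z) = proj T (\<sigma> (p z))"
      by (rule corr_proj) (use z * equivp_reflp[OF eqv] in auto)
    then show ?thesis using * W(4) Pz by simp
  qed
  ultimately show "\<exists>U h. open U \<and> x \<in> U \<and> (\<forall>n. Cn n h U) \<and> (\<forall>y\<in>U \<inter> level S. (g \<circ> corr) (proj S y) = h y)"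
    using oU by blast
qed

text \<open>A test curve \<open>z\<close> in \<open>T\<close> goes down by \<open>q\<close> and is
  lifted through a section of \<open>p\<close> to a test curve in \<open>S\<close> with the same
  base velocity. There the equation is known, and both symplectic forms are read off on the
  base.\<close>

lemma hamilton_transfer:
  assumes x: "hamilton_curve S J x" "open J" and y: "\<And>s. s \<in> J \<Longrightarrow> y (\<kappa> * s) = \<sigma> (p (x s))"
    and \<sigma>: "smooth_on V \<sigma>" "\<And>s. s \<in> J \<Longrightarrow> p (x s) \<in> V" "\<And>b. b \<in> V \<inter> B \<Longrightarrow> \<sigma> b \<in> level T \<and> q (\<sigma> b) = b"
  shows "hamilton_curve T ((*) \<kappa> ` J) y"
  unfolding hamilton_curve_def
proof (intro ballI)
  fix s assume "s \<in> (*) \<kappa> ` J"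
  then obtain r where r: "r \<in> J" "s = \<kappa> * r" by auto
  have xJ: "x s \<in> level S" if "s \<in> J" for s using x that by (simp add: hamilton_curve_def)
  have pB: "p z \<in> B" if "z \<in> level S" for z using S that by (auto simp: submersion_onto_def)
  have qB: "q z \<in> B" if "z \<in> level T" for z using T that by (auto simp: submersion_onto_def)
  obtain vx where vx: "(x has_vector_derivative vx) (at r)"
    "\<And>z u. range z \<subseteq> level S \<Longrightarrow> z 0 = x r \<Longrightarrow> (z has_vector_derivative u) (at (0::real)) \<Longrightarrow>
       ((\<lambda>s. ham S (z s)) has_real_derivative form S u vx) (at 0)"
    using x(1) r unfolding hamilton_curve_def by meson
  obtain vb where vb: "((\<lambda>s. p (x s)) has_vector_derivative vb) (at r)"
    using submersion_vel[OF S x(2) r(1) xJ vx(1)] .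
  have velx: "curve_vel (level S) p (x r) vx vb"
    by (rule curve_velI[OF x(2) r(1) xJ vx(1) vb])
  define J' where "J' = (*) \<kappa> ` J"
  have oJ: "open J'"
    unfolding J'_def using open_scaling[OF _ x(2), of \<kappa>] \<kappa> by simp
  have sJ: "s \<in> J'" using r by (auto simp: J'_def)
  have J'D: "t / \<kappa> \<in> J" "y t = \<sigma> (p (x (t / \<kappa>)))" if "t \<in> J'" for t
    using that y \<kappa> by (auto simp: J'_def)
  have yl: "y t \<in> level T" "q (y t) = p (x (t / \<kappa>))" if "t \<in> J'" for t
    using J'D[OF that] \<sigma>(2,3) pB[OF xJ] by auto
  have rs: "s / \<kappa> = r" using r \<kappa> by simp
  have b: "((\<lambda>t. p (x (t / \<kappa>))) has_vector_derivative (1 / \<kappa>) *\<^sub>R vb) (at s)"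
  proof -
    have "((\<lambda>t. t / \<kappa>) has_vector_derivative 1 / \<kappa>) (at s)"
      using \<kappa> by (auto intro!: derivative_eq_intros simp: has_real_derivative_iff_has_vector_derivative[symmetric])
    from vector_diff_chain_at[OF this] vb show ?thesis by (auto simp: o_def rs)
  qed
  obtain vy where vy0: "((\<lambda>t. \<sigma> (p (x (t / \<kappa>)))) has_vector_derivative vy) (at s)"
    using smooth_on_vector_derivative[OF \<sigma>(1) b] \<sigma>(2)[OF r(1)] rs by auto
  have vy: "(y has_vector_derivative vy) (at s)"
    by (rule has_vector_derivative_transform_within_open[OF vy0 oJ sJ]) (simp add: J'D)
  have qy: "((\<lambda>t. q (y t)) has_vector_derivative (1 / \<kappa>) *\<^sub>R vb) (at s)"
    by (rule has_vector_derivative_transform_within_open[OF b oJ sJ]) (simp add: yl)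
  have vely: "curve_vel (level T) q (y s) vy ((1 / \<kappa>) *\<^sub>R vb)"
    by (rule curve_velI[OF oJ sJ yl(1) vy qy])
  have "((\<lambda>s. ham T (z s)) has_real_derivative form T u vy) (at 0)"
    if z: "range z \<subseteq> level T" "z 0 = y s" "(z has_vector_derivative u) (at (0::real))" for z u
  proof -
    have zl: "z t \<in> level T" for t using z by auto
    obtain w where w: "((\<lambda>t. q (z t)) has_vector_derivative w) (at 0)"
      using submersion_vel[OF T open_UNIV UNIV_I zl z(3)] .
    have velz: "curve_vel (level T) q (y s) u w"
      using curve_velI[OF open_UNIV UNIV_I zl z(3) w] z(2) by simp
    have q0: "q (z 0) = p (x r)" using yl(2)[OF sJ] z(2) rs by simp
    obtain V2 \<tau> where V2: "p (x r) \<in> V2" "smooth_on V2 \<tau>" "\<tau> (p (x r)) = x r"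
      "\<And>b. b \<in> V2 \<inter> B \<Longrightarrow> \<tau> b \<in> level S \<and> p (\<tau> b) = b"
      using S xJ[OF r(1)] unfolding submersion_onto_def by meson
    \<comment> \<open>The section is good on \<open>V2\<close> only; elsewhere \<open>x r\<close> is
      a default that keeps the whole range in \<open>level S\<close>.\<close>
    define z2 where "z2 t = (if q (z t) \<in> V2 then \<tau> (q (z t)) else x r)" for t
    obtain N where N: "open N" "0 \<in> N" "\<And>t. t \<in> N \<Longrightarrow> q (z t) \<in> V2"
      using has_vector_derivative_continuous[OF w] smooth_on_open[OF V2(2)] V2(1) q0
      unfolding continuous_at_open by metis
    have z2l: "z2 t \<in> level S" for t
      using V2(4) qB[OF zl] xJ[OF r(1)] by (simp add: z2_def)
    have pz2: "p (z2 t) = q (z t)" if "t \<in> N" for t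
      using V2(4) qB[OF zl] N(3)[OF that] by (simp add: z2_def)
    obtain u20 where u20: "((\<lambda>t. \<tau> (q (z t))) has_vector_derivative u20) (at 0)"
      using smooth_on_vector_derivative[OF V2(2) w] V2(1) q0 by auto
    have u2: "(z2 has_vector_derivative u20) (at 0)"
      by (rule has_vector_derivative_transform_within_open[OF u20 N(1,2)]) (simp add: z2_def N(3))
    have w2: "((\<lambda>t. p (z2 t)) has_vector_derivative w) (at 0)"
      by (rule has_vector_derivative_transform_within_open[OF w N(1,2)]) (simp add: pz2)
    have z20: "z2 0 = x r" using V2 q0 by (simp add: z2_def)
    have velz2: "curve_vel (level S) p (x r) u20 w"
      using curve_velI[OF open_UNIV UNIV_I z2l u2 w2] z20 by simp
    have fS: "form S u20 vx = \<omega>S (p (x r)) w vb"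
      using S velz2 velx unfolding submersion_onto_def by blast
    have fT: "form T u vy = \<omega>T (p (x r)) w ((1 / \<kappa>) *\<^sub>R vb)"
      using T velz vely yl(2)[OF sJ] rs unfolding submersion_onto_def by metis
    have "((\<lambda>s. ham S (z2 s)) has_real_derivative form S u20 vx) (at 0)"
      by (rule vx(2)) (use z2l z20 u2 in auto)
    then have "((\<lambda>s. (1 / K) * ham S (z2 s)) has_real_derivative (1 / K) * form S u20 vx) (at 0)"
      by (rule DERIV_cmult)
    then have "((\<lambda>s. ham T (z s)) has_real_derivative (1 / K) * form S u20 vx) (at 0)"
      by (rule has_field_derivative_transform_within_open[OF _ N(1,2)])
        (use ham[OF z2l zl] pz2 equivp_reflp[OF eqv] K in \<open>simp add: field_simps\<close>)
    then show ?thesis using K by (simp add: fS fT flip: \<omega>)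
  qed
  then show "y s \<in> level T \<and> (\<exists>v. (y has_vector_derivative v) (at s) \<and>
       (\<forall>ya u. range ya \<subseteq> level T \<and> ya 0 = y s \<and> (ya has_vector_derivative u) (at 0) \<longrightarrow>
          ((\<lambda>s. ham T (ya s)) has_real_derivative form T u v) (at 0)))"
    using yl(1)[OF sJ] vy by blast
qed

lemma corr_motion:
  assumes "rmotion S I c"
  shows "rmotion T ((*) \<kappa> ` I) (\<lambda>t. corr (c (t / \<kappa>)))"
  unfolding rmotion_def
proof
  fix t assume "t \<in> (*) \<kappa> ` I"
  then obtain r where r: "r \<in> I" "t = \<kappa> * r" by auto
  obtain J x where J: "open J" "r \<in> J" "J \<subseteq> I" "hamilton_curve S J x" "\<And>s. s \<in> J \<Longrightarrow> c s = proj S (x s)"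
    using assms r(1) unfolding rmotion_def by meson
  have xJ: "x s \<in> level S" if "s \<in> J" for s using J(4) that by (simp add: hamilton_curve_def)
  obtain y0 where y0: "y0 \<in> level T" "q y0 = p (x r)" using lift_point[OF xJ[OF J(2)]] .
  obtain V \<sigma> where V: "p (x r) \<in> V" "smooth_on V \<sigma>"
      "\<And>b. b \<in> V \<inter> B \<Longrightarrow> \<sigma> b \<in> level T \<and> q (\<sigma> b) = b"
    using T y0 unfolding submersion_onto_def by metis
  \<comment> \<open>Continuity makes the set of times at which \<open>p (x s)\<close> lies in the
    domain of the section open.\<close>
  have "isCont (\<lambda>s. p (x s)) s" if s: "s \<in> J" for s
  proof -
    obtain v where "(x has_vector_derivative v) (at s)" using J(4) s by (auto simp: hamilton_curve_def)
    from submersion_vel[OF S J(1) s xJ this] obtain w where "((\<lambda>s. p (x s)) has_vector_derivative w) (at s)" .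
    then show ?thesis by (rule has_vector_derivative_continuous)
  qed
  then have "continuous_on J (\<lambda>s. p (x s))" by (simp add: continuous_at_imp_continuous_on)
  then have oJ1: "open (J \<inter> (\<lambda>s. p (x s)) -` V)" (is "open ?J1")
    by (rule continuous_open_preimage[OF _ J(1) smooth_on_open[OF V(2)]])
  define y where "y s = \<sigma> (p (x (s / \<kappa>)))" for s
  have "hamilton_curve T ((*) \<kappa> ` ?J1) y"
  proof (rule hamilton_transfer[OF _ oJ1])
    show "hamilton_curve S ?J1 x" using J(4) by (simp add: hamilton_curve_def)
    show "smooth_on V \<sigma>" by fact
  qed (use V(3) \<kappa> in \<open>auto simp: y_def\<close>)
  moreover have "corr (c (s / \<kappa>)) = proj T (y s)" if "s \<in> (*) \<kappa> ` ?J1" for s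
  proof -
    have s: "s / \<kappa> \<in> J" "p (x (s / \<kappa>)) \<in> V" using that \<kappa> by auto
    have "p (x (s / \<kappa>)) \<in> B" using S xJ[OF s(1)] by (auto simp: submersion_onto_def)
    with s V(3) have "y s \<in> level T" "q (y s) = p (x (s / \<kappa>))" by (auto simp: y_def)
    then show ?thesis
      unfolding J(5)[OF s(1)] by (intro corr_proj xJ s) (simp_all add: equivp_reflp[OF eqv])
  qed
  moreover have "open ((*) \<kappa> ` ?J1)" using open_scaling[OF _ oJ1, of \<kappa>] \<kappa> by simp
  moreover have "t \<in> (*) \<kappa> ` ?J1" using r J(2) V(1) by auto
  moreover have "(*) \<kappa> ` ?J1 \<subseteq> (*) \<kappa> ` I" using J(3) by auto
  ultimately show "\<exists>J x. open J \<and> t \<in> J \<and> J \<subseteq> (*) \<kappa> ` I \<and> hamilton_curve T J x \<and>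
      (\<forall>s\<in>J. corr (c (s / \<kappa>)) = proj T (x s))"
    by blast
qed

lemma rconjugate: "rconjugate S T \<kappa> corr"
  unfolding rconjugate_def rdiffeo_def
proof (intro conjI allI impI)
  interpret F: common_base T S q p B eqv \<omega>T \<omega>S "1 / K" "1 / \<kappa>" by (rule flip)
  have inv: "F.corr (corr c) = c" if "c \<in> rspace S" for c using corr_rspace[OF that] by simp
  have inv': "corr (F.corr c) = c" if "c \<in> rspace T" for c using F.corr_rspace[OF that] by simp
  show "bij_betw corr (rspace S) (rspace T)" by (rule corr_bij)
  show "rsmooth T g \<longleftrightarrow> rsmooth S (g \<circ> corr)" for g
  proof
    assume "rsmooth S (g \<circ> corr)"
    then have "rsmooth T ((g \<circ> corr) \<circ> F.corr)" by (rule F.corr_smooth)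
    moreover have "((g \<circ> corr) \<circ> F.corr) (proj T y) = g (proj T y)" if "y \<in> level T" for y
      using inv'[of "proj T y"] that by (simp add: rspace_def)
    ultimately show "rsmooth T g" by (simp add: rsmooth_def)
  qed (rule corr_smooth)
  fix I :: "real set" and c assume "open I \<and> c ` I \<subseteq> rspace S"
  then have c: "c t \<in> rspace S" if "t \<in> I" for t using that by auto
  show "rmotion S I c \<longleftrightarrow> rmotion T ((\<lambda>t. \<kappa> * t) ` I) (\<lambda>t. corr (c (t / \<kappa>)))"
  proof
    assume "rmotion T ((\<lambda>t. \<kappa> * t) ` I) (\<lambda>t. corr (c (t / \<kappa>)))"
    from F.corr_motion[OF this] have "rmotion S I (\<lambda>t. F.corr (corr (c t)))"
      using \<kappa> by (simp add: image_image)
    moreover have "F.corr (corr (c t)) = c t" if "t \<in> I" for t using inv[OF c[OF that]] .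
    ultimately show "rmotion S I c"
      unfolding rmotion_def by (metis subsetD)
  qed (rule corr_motion)
qed

end

text \<open>\<open>rshape_of\<close> recomputes \<open>f1\<close> from each state, whereas the
  computations below hold it fixed; the two maps agree on the level set, and this suffices.\<close>

lemma submersion_cong:
  assumes "submersion_onto X p B \<Omega> \<omega>" "\<And>x. x \<in> X \<Longrightarrow> p' x = p x"
  shows "submersion_onto X p' B \<Omega> \<omega>"
proof -
  have "p' ` X = p ` X" using assms(2) by auto
  moreover have v: "curve_vel X p' x u v \<longleftrightarrow> curve_vel X p x u v" for x u v
    unfolding curve_vel_def using assms(2) by (intro arg_cong[where f = Ex] ext conj_cong refl) (simp add: subset_iff)
  moreover have "x \<in> X" if "curve_vel X p x u v" for x u v
    using that by (auto simp: curve_vel_def)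
  ultimately show ?thesis
    using assms unfolding submersion_onto_def by simp metis
qed

lemma curve_velE:
  assumes "curve_vel X p x u v"
  obtains y where "\<And>s. y s \<in> X" "y 0 = x" "(y has_vector_derivative u) (at (0::real))"
    "((\<lambda>s. p (y s)) has_vector_derivative v) (at 0)"
proof -
  from assms obtain y where y: "range y \<subseteq> X" "y 0 = x" "(y has_vector_derivative u) (at (0::real))"
    "((\<lambda>s. p (y s)) has_vector_derivative v) (at 0)" unfolding curve_vel_def by blast
  show ?thesis by (rule that[of y]) (use y in auto)
qed

lemma submersion_mem: "submersion_onto X p B \<Omega> \<omega> \<Longrightarrow> x \<in> X \<Longrightarrow> p x \<in> B"
  by (auto simp: submersion_onto_def)

lemma submersion_form:
  "submersion_onto X p B \<Omega> \<omega> \<Longrightarrow> curve_vel X p x u v \<Longrightarrow> curve_vel X p x u' v' \<Longrightarrow> \<Omega> u u' = \<omega> (p x) v v'"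
  unfolding submersion_onto_def by blast

lemma has_vector_derivative_fst: "(f has_vector_derivative u) F \<Longrightarrow> ((\<lambda>s. fst (f s)) has_vector_derivative fst u) F"
  and has_vector_derivative_snd: "(f has_vector_derivative u) F \<Longrightarrow> ((\<lambda>s. snd (f s)) has_vector_derivative snd u) F"
  by (auto intro: bounded_linear.has_vector_derivative bounded_linear_fst bounded_linear_snd)

text \<open>\<open>N\<close> carries the momentum constraint. Being a condition on the image, it
  cuts out a union of fibres, so that a product of sections, evaluated at a point of
  \<open>N\<close>, lands in the constrained set.\<close>

lemma submersion_prod:
  fixes p1 :: "'a::euclidean_space \<times> 'b::euclidean_space \<Rightarrow> 'd::euclidean_space \<times> 'e::euclidean_space"
    and p2 :: "'c::euclidean_space \<Rightarrow> 'f::euclidean_space"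
  assumes 1: "submersion_onto X1 p1 B1 \<Omega>1 \<omega>1" and 2: "submersion_onto X2 p2 B2 \<Omega>2 \<omega>2"
  defines "p \<equiv> \<lambda>(x, y, z). (fst (p1 (x, y)), snd (p1 (x, y)), p2 z)"
  shows "submersion_onto {(x, y, z). (x, y) \<in> X1 \<and> z \<in> X2 \<and> p (x, y, z) \<in> N} p
    {(d, e, f). (d, e) \<in> B1 \<and> f \<in> B2 \<and> (d, e, f) \<in> N}
    (\<lambda>(x, y, z) (x', y', z'). \<Omega>1 (x, y) (x', y') + \<Omega>2 z z')
    (\<lambda>(d, e, f) (d', e', f') (d'', e'', f''). \<omega>1 (d, e) (d', e') (d'', e'') + \<omega>2 f f' f'')"
    (is "submersion_onto ?X p ?B ?\<Omega> ?\<omega>")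
  unfolding submersion_onto_def
proof (intro conjI ballI allI impI)
  have im: "p1 ` X1 = B1" "p2 ` X2 = B2" using 1 2 by (auto simp: submersion_onto_def)
  show "p ` ?X = ?B"
  proof (intro equalityI subsetI)
    fix b assume "b \<in> ?B"
    then obtain d e f where b: "b = (d, e, f)" "(d, e) \<in> B1" "f \<in> B2" "b \<in> N" by auto
    from b(2,3) obtain v z where v: "v \<in> X1" "p1 v = (d, e)" "z \<in> X2" "p2 z = f"
      unfolding im[symmetric] by force
    obtain x y where "v = (x, y)" by (rule prod.exhaust)
    with v have "(x, y) \<in> X1" "p1 (x, y) = (d, e)" "z \<in> X2" "p2 z = f" by simp_all
    then show "b \<in> p ` ?X" using b by (intro image_eqI[of _ _ "(x, y, z)"]) (auto simp: p_def)
  qed (use im in \<open>auto simp: p_def\<close>)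
  fix x assume "x \<in> ?X"
  then obtain x1 x2 x3 where x: "x = (x1, x2, x3)" "(x1, x2) \<in> X1" "x3 \<in> X2" by auto
  define a1 where "a1 = (\<lambda>v :: 'a \<times> 'b \<times> 'c. (fst v, fst (snd v)))"
  define a2 where "a2 = (\<lambda>v :: 'a \<times> 'b \<times> 'c. snd (snd v))"
  have a: "smooth_on UNIV a1" "smooth_on UNIV a2"
    unfolding a1_def a2_def by (intro smooth_on_Pair smooth_on_fst smooth_on_snd smooth_on_id open_UNIV)+
  have px: "p v = (fst (p1 (a1 v)), snd (p1 (a1 v)), p2 (a2 v))" for v
    by (cases v) (simp add: p_def a1_def a2_def)
  define c1 where "c1 = (\<lambda>v :: 'd \<times> 'e \<times> 'f. (fst v, fst (snd v)))"
  define c2 where "c2 = (\<lambda>v :: 'd \<times> 'e \<times> 'f. snd (snd v))"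
  have c: "smooth_on UNIV c1" "smooth_on UNIV c2"
    unfolding c1_def c2_def by (intro smooth_on_Pair smooth_on_fst smooth_on_snd smooth_on_id open_UNIV)+
  have vimage_open: "open (f -` V)" if "smooth_on UNIV f" "open V"
    for f :: "'x::euclidean_space \<Rightarrow> 'y::euclidean_space" and V
    using smooth_on_continuous[OF that(1)] that(2) by (simp add: continuous_on_open_vimage)
  obtain U1 P1 where U1: "(x1, x2) \<in> U1" "smooth_on U1 P1" "\<And>y. y \<in> U1 \<inter> X1 \<Longrightarrow> P1 y = p1 y"
    using 1 x(2) unfolding submersion_onto_def by meson
  obtain U2 P2 where U2: "x3 \<in> U2" "smooth_on U2 P2" "\<And>y. y \<in> U2 \<inter> X2 \<Longrightarrow> P2 y = p2 y"
    using 2 x(3) unfolding submersion_onto_def by meson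
  define U where "U = a1 -` U1 \<inter> a2 -` U2"
  have oU: "open U" unfolding U_def
    by (intro open_Int vimage_open a smooth_on_open[OF U1(2)] smooth_on_open[OF U2(2)])
  have s1: "smooth_on U (\<lambda>v. P1 (a1 v))"
    by (rule smooth_on_compose[OF U1(2) smooth_on_subset[OF a(1) oU]]) (auto simp: U_def)
  have s1': "smooth_on U (\<lambda>v. P2 (a2 v))"
    by (rule smooth_on_compose[OF U2(2) smooth_on_subset[OF a(2) oU]]) (auto simp: U_def)
  have "smooth_on U (\<lambda>v. (fst (P1 (a1 v)), snd (P1 (a1 v)), P2 (a2 v)))"
    by (intro smooth_on_Pair smooth_on_fst smooth_on_snd s1 s1')
  moreover have "x \<in> U" using x U1 U2 by (simp add: U_def a1_def a2_def)
  moreover have "\<forall>v\<in>U \<inter> ?X. (fst (P1 (a1 v)), snd (P1 (a1 v)), P2 (a2 v)) = p v"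
    using U1(3) U2(3) by (auto simp: U_def px a1_def a2_def)
  ultimately show "\<exists>U P. x \<in> U \<and> smooth_on U P \<and> (\<forall>y\<in>U \<inter> ?X. P y = p y)"
    by (intro exI conjI)
  obtain V1 \<sigma>1 where V1: "p1 (x1, x2) \<in> V1" "smooth_on V1 \<sigma>1" "\<sigma>1 (p1 (x1, x2)) = (x1, x2)"
    "\<And>b. b \<in> V1 \<inter> B1 \<Longrightarrow> \<sigma>1 b \<in> X1 \<and> p1 (\<sigma>1 b) = b"
    using 1 x(2) unfolding submersion_onto_def by meson
  obtain V2 \<sigma>2 where V2: "p2 x3 \<in> V2" "smooth_on V2 \<sigma>2" "\<sigma>2 (p2 x3) = x3"
    "\<And>b. b \<in> V2 \<inter> B2 \<Longrightarrow> \<sigma>2 b \<in> X2 \<and> p2 (\<sigma>2 b) = b"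
    using 2 x(3) unfolding submersion_onto_def by meson
  define V where "V = c1 -` V1 \<inter> c2 -` V2"
  have oV: "open V" unfolding V_def
    by (intro open_Int vimage_open c smooth_on_open[OF V1(2)] smooth_on_open[OF V2(2)])
  have s2: "smooth_on V (\<lambda>v. \<sigma>1 (c1 v))"
    by (rule smooth_on_compose[OF V1(2) smooth_on_subset[OF c(1) oV]]) (auto simp: V_def)
  have s2': "smooth_on V (\<lambda>v. \<sigma>2 (c2 v))"
    by (rule smooth_on_compose[OF V2(2) smooth_on_subset[OF c(2) oV]]) (auto simp: V_def)
  define \<sigma> where "\<sigma> v = (fst (\<sigma>1 (c1 v)), snd (\<sigma>1 (c1 v)), \<sigma>2 (c2 v))" for v
  have "smooth_on V \<sigma>"
    unfolding \<sigma>_def by (intro smooth_on_Pair smooth_on_fst smooth_on_snd s2 s2')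
  moreover have "p x \<in> V" "\<sigma> (p x) = x"
    using x V1 V2 by (simp_all add: V_def \<sigma>_def p_def c1_def c2_def)
  moreover have "\<sigma> v \<in> ?X \<and> p (\<sigma> v) = v" if v: "v \<in> V \<inter> ?B" for v
  proof -
    have "c1 v \<in> V1 \<inter> B1" "c2 v \<in> V2 \<inter> B2" using v by (auto simp: V_def c1_def c2_def)
    then have *: "\<sigma>1 (c1 v) \<in> X1" "p1 (\<sigma>1 (c1 v)) = c1 v" "\<sigma>2 (c2 v) \<in> X2" "p2 (\<sigma>2 (c2 v)) = c2 v"
      using V1(4) V2(4) by auto
    then have "p (\<sigma> v) = v" by (simp add: p_def \<sigma>_def c1_def c2_def)
    then show ?thesis using * v by (auto simp: \<sigma>_def)
  qed
  ultimately show "\<exists>V \<sigma>. p x \<in> V \<and> smooth_on V \<sigma> \<and> \<sigma> (p x) = x \<and> (\<forall>b\<in>V \<inter> ?B. \<sigma> b \<in> ?X \<and> p (\<sigma> b) = b)"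
    by (intro exI[of _ V] exI[of _ \<sigma>] conjI ballI) simp_all
next
  fix x u v u' v' assume *: "curve_vel ?X p x u v \<and> curve_vel ?X p x u' v'"
  \<comment> \<open>The constraint only removes curves: the components of a remaining one are curves
    in the factors, to which the two given pull-back formulas apply.\<close>
  have split: "curve_vel X1 p1 (fst x, fst (snd x)) (fst u, fst (snd u)) (fst v, fst (snd v)) \<and>
      curve_vel X2 p2 (snd (snd x)) (snd (snd u)) (snd (snd v))" if cv: "curve_vel ?X p x u v" for u v
  proof -
    obtain y where y: "\<And>s. y s \<in> ?X" "y 0 = x" "(y has_vector_derivative u) (at (0::real))"
      "((\<lambda>s. p (y s)) has_vector_derivative v) (at 0)" using cv by (rule curve_velE) blast
    have y1: "(fst (y s), fst (snd (y s))) \<in> X1" "snd (snd (y s)) \<in> X2" for s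
      using y(1)[of s] by auto
    have p1: "p1 (fst (y s), fst (snd (y s))) = (fst (p (y s)), fst (snd (p (y s))))"
      "p2 (snd (snd (y s))) = snd (snd (p (y s)))" for s
      by (cases "y s"; simp add: p_def)+
    have "curve_vel X1 p1 (fst (y 0), fst (snd (y 0))) (fst u, fst (snd u)) (fst v, fst (snd v))"
    proof (rule curve_velI[OF open_UNIV UNIV_I y1(1)])
      show "((\<lambda>s. (fst (y s), fst (snd (y s)))) has_vector_derivative (fst u, fst (snd u))) (at 0)"
        by (rule has_vector_derivative_Pair[OF has_vector_derivative_fst[OF y(3)]
            has_vector_derivative_fst[OF has_vector_derivative_snd[OF y(3)]]])
      show "((\<lambda>s. p1 (fst (y s), fst (snd (y s)))) has_vector_derivative (fst v, fst (snd v))) (at 0)"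
        unfolding p1
        by (rule has_vector_derivative_Pair[OF has_vector_derivative_fst[OF y(4)]
            has_vector_derivative_fst[OF has_vector_derivative_snd[OF y(4)]]])
    qed
    moreover have "curve_vel X2 p2 (snd (snd (y 0))) (snd (snd u)) (snd (snd v))"
    proof (rule curve_velI[OF open_UNIV UNIV_I y1(2)])
      show "((\<lambda>s. snd (snd (y s))) has_vector_derivative snd (snd u)) (at 0)"
        by (rule has_vector_derivative_snd[OF has_vector_derivative_snd[OF y(3)]])
      show "((\<lambda>s. p2 (snd (snd (y s)))) has_vector_derivative snd (snd v)) (at 0)"
        unfolding p1 by (rule has_vector_derivative_snd[OF has_vector_derivative_snd[OF y(4)]])
    qed
    ultimately show ?thesis using y(2) by simp
  qed
  have p1: "p1 (fst x, fst (snd x)) = (fst (p x), fst (snd (p x)))" "p2 (snd (snd x)) = snd (snd (p x))"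
    by (cases x; simp add: p_def)+
  have "\<Omega>1 (fst u, fst (snd u)) (fst u', fst (snd u')) =
      \<omega>1 (fst (p x), fst (snd (p x))) (fst v, fst (snd v)) (fst v', fst (snd v'))"
    unfolding p1(1)[symmetric]
    by (rule submersion_form[OF 1 split[THEN conjunct1] split[THEN conjunct1]]) (use * in auto)
  moreover have "\<Omega>2 (snd (snd u)) (snd (snd u')) = \<omega>2 (snd (snd (p x))) (snd (snd v)) (snd (snd v'))"
    unfolding p1(2)[symmetric]
    by (rule submersion_form[OF 2 split[THEN conjunct2] split[THEN conjunct2]]) (use * in auto)
  ultimately show "?\<Omega> u u' = ?\<omega> (p x) v v'"
    by (simp add: split_beta)
qed

section \<open>The Hopf map\<close>

lemma bilinear_qmult: "bounded_bilinear (\<odot>)"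
  unfolding bilinear_conv_bounded_bilinear[symmetric] bilinear_def
  by (auto intro!: linearI simp: qmult_def algebra_simps inner_add_left inner_add_right
      cross_add_left cross_add_right cross_mult_left cross_mult_right)

lemma quat_eqI: "fst p = fst q \<Longrightarrow> snd p $ 1 = snd q $ 1 \<Longrightarrow> snd p $ 2 = snd q $ 2 \<Longrightarrow> snd p $ 3 = snd q $ 3 \<Longrightarrow> p = (q::quat)"
  by (simp add: prod_eq_iff vec_eq_iff forall_3)

lemmas quat_simps = qmult_def qcnj_def qi_def inner_vec_def sum_3 cross3_def axis_def inner_prod_def

lemma qmult_assoc: "(p \<odot> q) \<odot> r = p \<odot> (q \<odot> r)"
  by (rule quat_eqI) (simp_all add: quat_simps algebra_simps)

lemma qcnj_qmult: "qcnj (p \<odot> q) = qcnj q \<odot> qcnj p"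
  by (rule quat_eqI) (simp_all add: quat_simps algebra_simps)

text \<open>The symmetric bilinear map with diagonal \<open>ks_Q\<close>; the differential of
  \<open>ks_Q\<close> at \<open>p\<close> is twice \<open>ks_B p\<close>.\<close>

definition ks_B :: "quat \<Rightarrow> quat \<Rightarrow> vec" where
  "ks_B p q = snd (qcnj p \<odot> qi \<odot> q)"

lemma bilinear_ks_B: "bounded_bilinear ks_B"
  unfolding bilinear_conv_bounded_bilinear[symmetric] bilinear_def ks_B_def
  by (auto intro!: linearI simp: quat_simps vec_eq_iff forall_3 algebra_simps)

lemma hopf_cross:
  "cross3 (ks_B p p1) (ks_B p p2) = (p \<bullet> (qi \<odot> p1)) *\<^sub>R ks_B p p2 - (p \<bullet> (qi \<odot> p2)) *\<^sub>R ks_B p p1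
     - (p \<bullet> p) *\<^sub>R snd (qcnj p1 \<odot> p2)"
  unfolding ks_B_def
  by (cases p; cases p1; cases p2) (simp add: quat_simps vec_eq_iff forall_3 algebra_simps)

lemma hopf_inner: "ks_Q p \<bullet> ks_B p p1 = (p \<bullet> p) * (p \<bullet> p1)"
  unfolding ks_B_def ks_Q_def
  by (cases p; cases p1) (simp add: quat_simps algebra_simps)

lemma hopf_inner2:
  "ks_Q p \<bullet> snd (qcnj p1 \<odot> p2) = - (p \<bullet> p) * ((qi \<odot> p1) \<bullet> p2) +
     2 * ((p \<bullet> p1) * ((qi \<odot> p) \<bullet> p2) - (p \<bullet> p2) * ((qi \<odot> p) \<bullet> p1))"
  unfolding ks_Q_def
  by (cases p; cases p1; cases p2) (simp add: quat_simps algebra_simps)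

text \<open>For vectors tangent to a sphere around 0, the Hopf map pulls the area form back to a
  multiple of the form given by left multiplication with \<open>qi\<close>. Tangency kills every
  term of \<open>hopf_cross\<close> but the last, and the corrections in
  \<open>hopf_inner2\<close>.\<close>

lemma hopf_area:
  assumes "p \<bullet> p1 = 0" "p \<bullet> p2 = 0"
  shows "ks_Q p \<bullet> cross3 (ks_B p p1) (ks_B p p2) = (p \<bullet> p)\<^sup>2 * ((qi \<odot> p1) \<bullet> p2)"
  using assms
  by (simp add: hopf_cross inner_diff_right hopf_inner hopf_inner2 power2_eq_square)

lemma ks_Q_ks_B: "ks_Q z = ks_B z z"
  by (simp add: ks_Q_def ks_B_def)

lemma ks_B_commute: "ks_B p q = ks_B q p"
  unfolding ks_B_def by (simp add: quat_simps vec_eq_iff forall_3 algebra_simps)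

lemma ks_B_qi: "ks_B p (qi \<odot> q) = - snd (qcnj p \<odot> q)" "ks_B (qi \<odot> p) (qi \<odot> p) = ks_B p p"
  unfolding ks_B_def by (simp_all add: quat_simps vec_eq_iff forall_3 algebra_simps)

lemma qi_qi: "qi \<odot> (qi \<odot> p) = - p"
  by (rule quat_eqI) (simp_all add: quat_simps)

lemma inner_qi: "(qi \<odot> p) \<bullet> (qi \<odot> q) = p \<bullet> q"
  by (cases p; cases q) (simp add: quat_simps algebra_simps)

lemma fst_qi: "fst (qcnj z \<odot> qi \<odot> w) = z \<bullet> (qi \<odot> w)"
  by (cases z; cases w) (simp add: quat_simps algebra_simps)

interpretation qm: bounded_bilinear "(\<odot>)" by (rule bilinear_qmult)
interpretation kb: bounded_bilinear ks_B by (rule bilinear_ks_B)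

lemma ks_Q_scaleR: "ks_Q (c *\<^sub>R z) = c\<^sup>2 *\<^sub>R ks_Q z"
  by (simp add: ks_Q_ks_B kb.scaleR_left kb.scaleR_right power2_eq_square)

lemma ks_Q_zero_iff: "ks_Q z = 0 \<longleftrightarrow> z = 0"
  by (metis ks_norm norm_eq_zero zero_eq_power2)

text \<open>Polarization: the mixed term is the angular momentum, and \<open>qi \<odot> w\<close>
  has the same Hopf image as \<open>w\<close>. Opposite signs of \<open>b\<close> therefore separate
  the angular momentum from the vector that gives the eccentricity.\<close>

lemma ks_Q_add:
  "ks_Q (z + b *\<^sub>R (qi \<odot> w)) = ks_Q z + b\<^sup>2 *\<^sub>R ks_Q w + (4 * b) *\<^sub>R ks_G z w"
proof -
  have "ks_Q (z + b *\<^sub>R (qi \<odot> w)) = ks_B z z + b *\<^sub>R (2 *\<^sub>R ks_B z (qi \<odot> w)) + b\<^sup>2 *\<^sub>R ks_B (qi \<odot> w) (qi \<odot> w)"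
    unfolding ks_Q_ks_B kb.add_left kb.add_right kb.scaleR_left kb.scaleR_right ks_B_commute[of "qi \<odot> w" z]
    by (simp add: scaleR_2 power2_eq_square algebra_simps)
  then show ?thesis unfolding ks_B_qi(2) ks_Q_ks_B ks_G_def by (simp add: ks_B_qi(1))
qed

text \<open>The mixed term is the constraint of the Kustaanheimo-Stiefel space; where it vanishes,
  both signs of \<open>b\<close> give the same norm.\<close>

lemma norm_ks_add:
  "(norm (z + b *\<^sub>R (qi \<odot> w)))\<^sup>2 = (norm z)\<^sup>2 + b\<^sup>2 * (norm w)\<^sup>2 + 2 * b * fst (qcnj z \<odot> qi \<odot> w)"
proof -
  have "(norm (z + b *\<^sub>R (qi \<odot> w)))\<^sup>2 = z \<bullet> z + b\<^sup>2 * ((qi \<odot> w) \<bullet> (qi \<odot> w)) + 2 * b * (z \<bullet> (qi \<odot> w))"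
    unfolding power2_norm_eq_inner inner_add_left inner_add_right inner_scaleR_left inner_scaleR_right
      inner_commute[of "qi \<odot> w" z]
    by (simp add: power2_eq_square algebra_simps)
  then show ?thesis unfolding fst_qi inner_qi power2_norm_eq_inner .
qed

subsection \<open>Local sections\<close>

text \<open>Right multiplication of \<open>z\<close> rotates and scales the Hopf image, so sections
  can be had from rotation quaternions.\<close>

lemma ks_Q_qmult: "ks_Q (z \<odot> r) = snd (qcnj r \<odot> (0, ks_Q z) \<odot> r)"
proof -
  have "qcnj z \<odot> qi \<odot> z = (0, ks_Q z)"
    by (rule quat_eqI) (simp_all add: quat_simps ks_Q_def algebra_simps)
  then show ?thesis by (simp add: ks_Q_def qcnj_qmult flip: qmult_assoc)
qed

lemma rotation_formula:
  "snd (qcnj (s, v) \<odot> (0, h) \<odot> (s, v)) = (s\<^sup>2 - v \<bullet> v) *\<^sub>R h + (2 * (v \<bullet> h)) *\<^sub>R v + (2 * s) *\<^sub>R cross3 h v"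
  by (simp add: quat_simps vec_eq_iff forall_3 power2_eq_square algebra_simps)

text \<open>Up to a factor, the quaternion \<open>1 - n0 n\<close> rotates the unit vector \<open>n0\<close> to \<open>n\<close>.\<close>

definition hopf_section :: "quat \<Rightarrow> vec \<Rightarrow> quat" where
  "hopf_section z h = (let h0 = ks_Q z; s = norm h0 * norm h + h0 \<bullet> h
     in (1 / (norm h0 * sqrt (2 * s))) *\<^sub>R (z \<odot> (s, - cross3 h0 h)))"

text \<open>Only 0 and the ray opposite to \<open>ks_Q z\<close> are left out; on that ray the
  shortest rotation is not unique.\<close>

definition hopf_dom :: "quat \<Rightarrow> vec set" where
  "hopf_dom z = {h. h \<noteq> 0 \<and> norm (ks_Q z) * norm h + ks_Q z \<bullet> h > 0}"

text \<open>Lagrange's formula turns the double cross product into a combination of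
  \<open>h0\<close> and \<open>h\<close>, and the multiples of \<open>h0\<close> cancel, leaving
  \<open>2 s |h0|^2 h\<close>. As \<open>ks_Q\<close> is quadratic, the prefactor of the section is
  the inverse square root of this coefficient.\<close>

lemma ks_Q_hopf_section:
  assumes "z \<noteq> 0" "h \<in> hopf_dom z"
  shows "ks_Q (hopf_section z h) = h"
proof -
  define h0 where "h0 = ks_Q z"
  define s where "s = norm h0 * norm h + h0 \<bullet> h"
  have h0: "h0 \<noteq> 0" using assms by (simp add: h0_def ks_Q_zero_iff)
  have s: "s > 0" using assms by (simp add: hopf_dom_def s_def h0_def)
  have v2: "cross3 h0 h \<bullet> cross3 h0 h = (norm h0 * norm h)\<^sup>2 - (h0 \<bullet> h)\<^sup>2"
    unfolding power_mult_distrib power2_norm_eq_inner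
    by (simp add: dot_cross power2_eq_square inner_commute)
  have "ks_Q (z \<odot> (s, - cross3 h0 h)) = (s\<^sup>2 - cross3 h0 h \<bullet> cross3 h0 h) *\<^sub>R h0 - (2 * s) *\<^sub>R cross3 h0 (cross3 h0 h)"
    unfolding ks_Q_qmult rotation_formula h0_def[symmetric]
    by (simp add: dot_cross_self inner_commute[of _ h0] cross_minus_right)
  also have "s\<^sup>2 - cross3 h0 h \<bullet> cross3 h0 h = 2 * s * (h0 \<bullet> h)"
    unfolding v2 s_def by (simp add: power2_eq_square algebra_simps)
  also have "cross3 h0 (cross3 h0 h) = (h0 \<bullet> h) *\<^sub>R h0 - (norm h0)\<^sup>2 *\<^sub>R h"
    by (simp add: Lagrange power2_norm_eq_inner)
  also have "(2 * s * (h0 \<bullet> h)) *\<^sub>R h0 - (2 * s) *\<^sub>R ((h0 \<bullet> h) *\<^sub>R h0 - (norm h0)\<^sup>2 *\<^sub>R h) = ((norm h0)\<^sup>2 * (2 * s)) *\<^sub>R h"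
    by (simp add: algebra_simps)
  finally have *: "ks_Q (z \<odot> (s, - cross3 h0 h)) = ((norm h0)\<^sup>2 * (2 * s)) *\<^sub>R h" .
  have "hopf_section z h = (1 / (norm h0 * sqrt (2 * s))) *\<^sub>R (z \<odot> (s, - cross3 h0 h))"
    by (simp add: hopf_section_def Let_def h0_def s_def)
  then show ?thesis
    using s h0 by (simp add: ks_Q_scaleR * power_divide power_mult_distrib)
qed

lemma hopf_section_self:
  assumes "z \<noteq> 0"
  shows "hopf_section z (ks_Q z) = z" "ks_Q z \<in> hopf_dom z"
proof -
  define h0 where "h0 = ks_Q z"
  have h0: "norm h0 > 0" using assms by (simp add: h0_def ks_Q_zero_iff)
  have "norm h0 * norm h0 + h0 \<bullet> h0 = 2 * (norm h0)\<^sup>2" by (simp add: power2_norm_eq_inner[symmetric] power2_eq_square)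
  moreover have "sqrt (2 * (2 * (norm h0)\<^sup>2)) = 2 * norm h0"
    using h0 by (simp add: real_sqrt_mult)
  moreover have "z \<odot> (c, 0) = c *\<^sub>R z" for c by (rule quat_eqI) (simp_all add: quat_simps)
  ultimately show "hopf_section z (ks_Q z) = z"
    using h0 by (simp add: hopf_section_def Let_def h0_def[symmetric] power2_eq_square)
  show "ks_Q z \<in> hopf_dom z"
    using h0 by (simp add: hopf_dom_def h0_def[symmetric] power2_norm_eq_inner[symmetric] add_pos_pos)
qed

lemma open_hopf_dom: "open (hopf_dom z)"
  unfolding hopf_dom_def
  by (intro open_Collect_conj open_Collect_neq open_Collect_less continuous_intros)

lemma bilinear_cross3: "bounded_bilinear cross3"
  unfolding bilinear_conv_bounded_bilinear[symmetric] by (rule bilinear_cross)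

lemma smooth_hopf_section:
  assumes "z \<noteq> 0" shows "smooth_on (hopf_dom z) (hopf_section z)"
proof -
  have "ks_Q z \<noteq> 0" using assms by (simp add: ks_Q_zero_iff)
  moreover have "smooth_on (hopf_dom z) (\<lambda>h. norm (ks_Q z) * norm h + ks_Q z \<bullet> h)"
    by (intro smooth_on_add smooth_on_mult smooth_on_inner smooth_on_const smooth_on_id open_hopf_dom smooth_on_norm)
      (simp add: hopf_dom_def)
  ultimately show ?thesis
    unfolding hopf_section_def Let_def
    by (intro smooth_on_scaleR smooth_on_divide smooth_on_mult smooth_on_sqrt smooth_on_bilinear[OF bilinear_qmult]
        smooth_on_Pair smooth_on_minus smooth_on_bilinear[OF bilinear_cross3] smooth_on_const smooth_on_id open_hopf_dom)
      (auto simp: hopf_dom_def)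
qed

lemma hopf_surj: obtains z where "ks_Q z = h"
proof (cases "h = 0")
  case True
  then show ?thesis using that[of 0] by (simp add: ks_Q_zero_iff)
next
  case False
  \<comment> \<open>The sections through 1 and \<open>k\<close> lie over opposite unit vectors, so
    their domains together contain every nonzero \<open>h\<close>.\<close>
  define k :: quat where "k = (0, axis 2 1)"
  have 1: "ks_Q (1, 0) = axis 1 1" "ks_Q k = - axis 1 1"
    unfolding k_def by (simp_all add: ks_Q_def quat_simps vec_eq_iff forall_3)
  have n: "norm (axis 1 1 :: vec) = 1" by (simp add: norm_axis_1)
  have "\<exists>z. z \<noteq> 0 \<and> h \<in> hopf_dom z"
  proof (cases "axis 1 1 \<bullet> h \<ge> 0")
    case True
    then show ?thesis using False 1(1) n by (intro exI[of _ "(1, 0)"]) (auto simp: hopf_dom_def zero_prod_def add_pos_nonneg)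
  next
    case neg: False
    then have "norm h + - (axis 1 1 \<bullet> h) > 0" using False zero_less_norm_iff[of h] by linarith
    then show ?thesis using False 1(2) n
      by (intro exI[of _ k]) (auto simp: hopf_dom_def zero_prod_def k_def axis_eq_0_iff)
  qed
  then show ?thesis using ks_Q_hopf_section that by blast
qed

section \<open>The inner ellipse\<close>

definition ellipses :: "(vec \<times> vec) set" where
  "ellipses = {(e, j). e \<bullet> j = 0 \<and> (norm e)\<^sup>2 + (norm j)\<^sup>2 = 1}"

text \<open>The ellipses \<open>(e, j)\<close> of given semi major axis form a product of two spheres, with
  coordinates \<open>j + e\<close> and \<open>j - e\<close>; this is the sum of the two area forms.\<close>

definition ell_area :: "vec \<times> vec \<Rightarrow> vec \<times> vec \<Rightarrow> vec \<times> vec \<Rightarrow> real" where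
  "ell_area \<equiv> \<lambda>(e, j) (e1, j1) (e2, j2).
     (j + e) \<bullet> cross3 (j1 + e1) (j2 + e2) + (j - e) \<bullet> cross3 (j1 - e1) (j2 - e2)"

text \<open>Sum and difference of the squared lengths of \<open>j + e\<close> and
  \<open>j - e\<close>.\<close>

lemma ellipses_iff: "(e, j) \<in> ellipses \<longleftrightarrow> norm (j + e) = 1 \<and> norm (j - e) = 1"
proof -
  have *: "norm v = 1 \<longleftrightarrow> v \<bullet> v = 1" for v :: vec by (simp add: norm_eq_1)
  show ?thesis unfolding ellipses_def * power2_norm_eq_inner
    by (auto simp: inner_add_left inner_add_right inner_diff_left inner_diff_right inner_commute)
qed

text \<open>\<open>\<phi>\<close> is a constant here: in the full system it depends on the outer
  semi major axis alone, which the level set fixes.\<close>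

definition ks_level :: "real \<Rightarrow> real \<Rightarrow> real \<Rightarrow> (quat \<times> quat) set" where
  "ks_level \<mu> \<phi> a = {(z, w). fst (qcnj z \<odot> qi \<odot> w) = 0 \<and> ks_axis \<mu> \<phi> z w = a}"

definition ks_shape :: "real \<Rightarrow> real \<Rightarrow> real \<Rightarrow> quat \<times> quat \<Rightarrow> vec \<times> vec" where
  "ks_shape \<mu> M \<phi> = (\<lambda>(z, w). (ks_ecc \<mu> \<phi> z w, ks_ang \<mu> M \<phi> z w))"

locale ks =
  fixes \<mu> M \<phi> a :: real
  assumes \<mu>: "\<mu> > 0" and M: "M > 0" and \<phi>: "\<phi> > 0" and a: "a > 0"
begin

text \<open>The scale that turns the flow into a rotation of the pair \<open>(z, b w)\<close>; on
  the level set \<open>|z|^2 + b^2 |w|^2 = 2 a\<close>.\<close>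

definition b where "b = sqrt (1 / (8 * \<mu> * \<phi>))"

lemma b: "b > 0" "b\<^sup>2 = 1 / (8 * \<mu> * \<phi>)"
  using \<mu> \<phi> by (simp_all add: b_def)

text \<open>\<open>M\<close> cancels and leaves \<open>a sqrt (2 \<mu> \<phi>)\<close>. In this form
  it turns up as the weight of the area forms in \<open>ks_form\<close>.\<close>

lemma calL1_eq: "calL1 \<mu> M \<phi> a = a / (2 * b)"
proof -
  have p: "\<mu> powr (3/2) = \<mu> * sqrt \<mu>"
    using \<mu> powr_add[of \<mu> 1 "1/2"] by (simp add: powr_half_sqrt)
  have "8 * \<mu> * \<phi> = 2\<^sup>2 * (\<mu> * (2 * \<phi>))" by simp
  then have "1 / (2 * b) = sqrt \<mu> * sqrt (2 * \<phi>)"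
    unfolding b_def by (simp only: real_sqrt_divide real_sqrt_mult real_sqrt_abs) simp
  moreover have "calL1 \<mu> M \<phi> a = a * (sqrt \<mu> * sqrt (2 * \<phi>))"
    using \<mu> M a unfolding calL1_def circ_L_def p power_mult_distrib
    by (simp add: power2_eq_square field_simps)
  moreover have "a / (2 * b) = a * (1 / (2 * b))" by simp
  ultimately show ?thesis by simp
qed

lemma calL1_pos: "calL1 \<mu> M \<phi> a > 0"
  using a b by (simp add: calL1_eq)

lemma resc_eq: "resc \<mu> M \<phi> a / circ_L \<mu> M a = 2 * b / a"
proof -
  have "(resc \<mu> M \<phi> a)\<^sup>2 = \<mu> * M / (2 * \<phi> * a)" "(circ_L \<mu> M a)\<^sup>2 = \<mu>\<^sup>2 * (M * a)"
    using \<mu> M \<phi> a by (simp_all add: resc_def circ_L_def power_mult_distrib)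
  then have "(resc \<mu> M \<phi> a / circ_L \<mu> M a)\<^sup>2 = (2 * b / a)\<^sup>2"
    using \<mu> M \<phi> a by (simp add: power_divide power_mult_distrib b) (simp add: field_simps power2_eq_square)
  moreover have "resc \<mu> M \<phi> a / circ_L \<mu> M a \<ge> 0" "2 * b / a \<ge> 0"
    using \<mu> M \<phi> a b by (simp_all add: resc_def circ_L_def)
  ultimately show ?thesis by (simp add: power2_eq_iff_nonneg)
qed

text \<open>Fixing the semi major axis makes the shape quadratic in \<open>(z, w)\<close>, hence
  regular at collisions as well.\<close>

lemma level_shape:
  assumes "ks_axis \<mu> \<phi> z w = a"
  shows "ks_shape \<mu> M \<phi> (z, w) = ((- 1 / (2 * a)) *\<^sub>R (ks_Q z + b\<^sup>2 *\<^sub>R ks_Q w), (2 * b / a) *\<^sub>R ks_G z w)"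
  using assms resc_eq by (simp add: ks_shape_def ks_ecc_def ks_ang_def b Let_def)

text \<open>On the level set, the flow rotates \<open>z + b i w\<close> and \<open>z - b i w\<close> in opposite directions, and
  their images under the Hopf map are the two spherical coordinates of the ellipse.\<close>

lemma hopf_coordinates:
  assumes "ks_shape \<mu> M \<phi> (z, w) = (e, j)" "ks_axis \<mu> \<phi> z w = a"
  shows "ks_Q (z + b *\<^sub>R (qi \<odot> w)) = (2 * a) *\<^sub>R (j - e)" "ks_Q (z - b *\<^sub>R (qi \<odot> w)) = (2 * a) *\<^sub>R (- j - e)"
proof -
  have "(2 * a) *\<^sub>R e = - (ks_Q z + b\<^sup>2 *\<^sub>R ks_Q w)" "(2 * a) *\<^sub>R j = (4 * b) *\<^sub>R ks_G z w"
    using assms(1) level_shape[OF assms(2)] a by auto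
  then show "ks_Q (z + b *\<^sub>R (qi \<odot> w)) = (2 * a) *\<^sub>R (j - e)" "ks_Q (z - b *\<^sub>R (qi \<odot> w)) = (2 * a) *\<^sub>R (- j - e)"
    using ks_Q_add[of z b w] ks_Q_add[of z "- b" w] by (simp_all add: scaleR_diff_right)
qed

lemma level_norm:
  assumes "(z, w) \<in> ks_level \<mu> \<phi> a"
  shows "(norm (z + b *\<^sub>R (qi \<odot> w)))\<^sup>2 = 2 * a" "(norm (z - b *\<^sub>R (qi \<odot> w)))\<^sup>2 = 2 * a"
  using assms norm_ks_add[of z b w] norm_ks_add[of z "- b" w] \<mu> \<phi>
  by (auto simp: ks_level_def ks_axis_def b)

text \<open>The formulas for \<open>z\<close> and \<open>w\<close> invert
  \<open>p = z + b i w\<close>, \<open>q = z - b i w\<close>, because multiplying twice by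
  \<open>qi\<close> is \<open>-1\<close>. The squared norms of \<open>p\<close> and \<open>q\<close>
  are both \<open>2 a\<close>: their sum gives the axis condition, their difference the
  Kustaanheimo-Stiefel constraint.\<close>

lemma from_hopf:
  assumes "(e, j) \<in> ellipses" "ks_Q p = (2 * a) *\<^sub>R (j - e)" "ks_Q q = (2 * a) *\<^sub>R (- j - e)"
    and "z = (1 / 2) *\<^sub>R (p + q)" "w = (- 1 / (2 * b)) *\<^sub>R (qi \<odot> (p - q))"
  shows "(z, w) \<in> ks_level \<mu> \<phi> a" "ks_shape \<mu> M \<phi> (z, w) = (e, j)"
proof -
  have "b *\<^sub>R (qi \<odot> w) = (1 / 2) *\<^sub>R (p - q)"
    using b(1) unfolding assms(5) qm.scaleR_right by (simp add: qi_qi algebra_simps)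
  then have z: "z + b *\<^sub>R (qi \<odot> w) = (1 / 2) *\<^sub>R ((p + q) + (p - q))"
      "z + (- b) *\<^sub>R (qi \<odot> w) = (1 / 2) *\<^sub>R ((p + q) - (p - q))"
    unfolding assms(4) by (simp_all add: scaleR_add_right scaleR_diff_right)
  have p: "p = z + b *\<^sub>R (qi \<odot> w)" and q: "q = z + (- b) *\<^sub>R (qi \<odot> w)"
    unfolding z by (simp_all add: scaleR_2[symmetric])
  have "(norm p)\<^sup>2 = 2 * a" "(norm q)\<^sup>2 = 2 * a"
    using assms(1-3) a unfolding ellipses_iff ks_norm[symmetric]
    by (simp_all add: norm_minus_commute[of "- j"]) (metis add.commute norm_minus_cancel minus_add_distrib uminus_add_conv_diff diff_conv_add_uminus)
  then have s: "(norm z)\<^sup>2 + b\<^sup>2 * (norm w)\<^sup>2 = 2 * a" and f: "fst (qcnj z \<odot> qi \<odot> w) = 0"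
    using norm_ks_add[of z b w] norm_ks_add[of z "- b" w] b(1) unfolding p q by auto
  then have ax: "ks_axis \<mu> \<phi> z w = a" by (simp add: ks_axis_def b)
  then show "(z, w) \<in> ks_level \<mu> \<phi> a" using f by (simp add: ks_level_def)
  have 1: "ks_Q z + b\<^sup>2 *\<^sub>R ks_Q w = (- 2 * a) *\<^sub>R e"
  proof -
    have "2 *\<^sub>R (ks_Q z + b\<^sup>2 *\<^sub>R ks_Q w) = ks_Q p + ks_Q q"
      unfolding p q ks_Q_add by (simp add: scaleR_2)
    also have "\<dots> = 2 *\<^sub>R ((- 2 * a) *\<^sub>R e)"
      unfolding assms(2,3) by (simp add: vec_eq_iff algebra_simps)
    finally show ?thesis by (simp only: scaleR_cancel_left) simp
  qed
  have 2: "(4 * b) *\<^sub>R ks_G z w = (2 * a) *\<^sub>R j"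
  proof -
    have "2 *\<^sub>R ((4 * b) *\<^sub>R ks_G z w) = ks_Q p - ks_Q q"
      unfolding p q ks_Q_add by (simp add: algebra_simps flip: scaleR_add_left)
    also have "\<dots> = 2 *\<^sub>R ((2 * a) *\<^sub>R j)"
      unfolding assms(2,3) by (simp add: algebra_simps flip: scaleR_add_left)
    finally show ?thesis by (simp only: scaleR_cancel_left) simp
  qed
  have "(2 * b / a) *\<^sub>R ks_G z w = (1 / (2 * a)) *\<^sub>R ((4 * b) *\<^sub>R ks_G z w)" by simp
  also have "\<dots> = j" unfolding 2 using a by simp
  finally show "ks_shape \<mu> M \<phi> (z, w) = (e, j)"
    unfolding level_shape[OF ax] 1 using a by simp
qed

text \<open>Two Hopf sections, through \<open>p\<close> and through \<open>q\<close>, followed by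
  the linear map of \<open>from_hopf\<close>. Collisions do no harm: \<open>p\<close> and
  \<open>q\<close> have length \<open>sqrt (2 a)\<close> even where \<open>z\<close>
  vanishes.\<close>

lemma ks_section:
  assumes x: "(z0, w0) \<in> ks_level \<mu> \<phi> a"
  shows "\<exists>V \<sigma>. ks_shape \<mu> M \<phi> (z0, w0) \<in> V \<and> smooth_on V \<sigma> \<and> \<sigma> (ks_shape \<mu> M \<phi> (z0, w0)) = (z0, w0) \<and>
    (\<forall>x\<in>V \<inter> ellipses. \<sigma> x \<in> ks_level \<mu> \<phi> a \<and> ks_shape \<mu> M \<phi> (\<sigma> x) = x)"
proof -
  define p where "p = z0 + b *\<^sub>R (qi \<odot> w0)"
  define q where "q = z0 - b *\<^sub>R (qi \<odot> w0)"
  have pq: "p \<noteq> 0" "q \<noteq> 0" using level_norm[OF x] a by (auto simp: p_def q_def)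
  define A where "A x = (2 * a) *\<^sub>R (snd x - fst x)" for x :: "vec \<times> vec"
  define A' where "A' x = (2 * a) *\<^sub>R (- snd x - fst x)" for x :: "vec \<times> vec"
  define V where "V = A -` hopf_dom p \<inter> A' -` hopf_dom q"
  have sA: "smooth_on UNIV A" "smooth_on UNIV A'"
    unfolding A_def A'_def
    by (intro smooth_on_scaleR smooth_on_const smooth_on_diff smooth_on_minus smooth_on_fst smooth_on_snd smooth_on_id open_UNIV)+
  have oV: "open V"
    unfolding V_def using smooth_on_continuous[OF sA(1)] smooth_on_continuous[OF sA(2)] open_hopf_dom
    by (simp add: continuous_on_open_vimage open_Int)
  have sp: "smooth_on V (\<lambda>x. hopf_section p (A x))"
    by (rule smooth_on_compose[OF smooth_hopf_section[OF pq(1)] smooth_on_subset[OF sA(1) oV]]) (auto simp: V_def)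
  have sq: "smooth_on V (\<lambda>x. hopf_section q (A' x))"
    by (rule smooth_on_compose[OF smooth_hopf_section[OF pq(2)] smooth_on_subset[OF sA(2) oV]]) (auto simp: V_def)
  define \<sigma> where "\<sigma> x = ((1 / 2) *\<^sub>R (hopf_section p (A x) + hopf_section q (A' x)),
     (- 1 / (2 * b)) *\<^sub>R (qi \<odot> (hopf_section p (A x) - hopf_section q (A' x))))" for x
  have "smooth_on V \<sigma>"
    unfolding \<sigma>_def
    by (intro smooth_on_Pair smooth_on_scaleR smooth_on_const smooth_on_bilinear[OF bilinear_qmult]
        smooth_on_add smooth_on_diff sp sq oV)
  moreover
  obtain e j where ej: "ks_shape \<mu> M \<phi> (z0, w0) = (e, j)" by (rule prod.exhaust)
  have ax: "ks_axis \<mu> \<phi> z0 w0 = a" using x by (simp add: ks_level_def)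
  have A0: "A (e, j) = ks_Q p" "A' (e, j) = ks_Q q"
    using hopf_coordinates[OF ej ax] by (simp_all add: A_def A'_def p_def q_def)
  have "ks_shape \<mu> M \<phi> (z0, w0) \<in> V" unfolding ej V_def using A0 hopf_section_self pq by auto
  moreover have "p + q = 2 *\<^sub>R z0" "p - q = (2 * b) *\<^sub>R (qi \<odot> w0)"
    by (simp_all add: p_def q_def scaleR_2 algebra_simps flip: scaleR_add_left)
  then have "\<sigma> (ks_shape \<mu> M \<phi> (z0, w0)) = (z0, w0)"
    using b(1) unfolding ej \<sigma>_def A0 hopf_section_self(1)[OF pq(1)] hopf_section_self(1)[OF pq(2)]
    by (simp add: qm.scaleR_right qi_qi)
  moreover have "\<sigma> x \<in> ks_level \<mu> \<phi> a \<and> ks_shape \<mu> M \<phi> (\<sigma> x) = x" if "x \<in> V \<inter> ellipses" for x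
  proof -
    obtain e j where x: "x = (e, j)" by (rule prod.exhaust)
    have "ks_Q (hopf_section p (A x)) = (2 * a) *\<^sub>R (j - e)" "ks_Q (hopf_section q (A' x)) = (2 * a) *\<^sub>R (- j - e)"
      using that ks_Q_hopf_section pq by (auto simp: V_def x A_def A'_def)
    from from_hopf[OF _ this refl refl] that show ?thesis by (simp add: x \<sigma>_def)
  qed
  ultimately show ?thesis by blast
qed

lemma ks_level_onto:
  assumes "(e, j) \<in> ellipses"
  obtains z w where "(z, w) \<in> ks_level \<mu> \<phi> a" "ks_shape \<mu> M \<phi> (z, w) = (e, j)" "z \<noteq> 0"
proof -
  obtain p where p: "ks_Q p = (2 * a) *\<^sub>R (j - e)" by (rule hopf_surj)
  obtain q where q: "ks_Q q = (2 * a) *\<^sub>R (- j - e)" by (rule hopf_surj)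
  \<comment> \<open>The Hopf fibre of \<open>q\<close> also contains \<open>- q\<close>. If
    \<open>p + q = 0\<close>, this replacement gives \<open>z = p\<close>, so a point outside the
    collisions always exists; the Kepler case relies on it.\<close>
  have q': "ks_Q (- q) = (2 * a) *\<^sub>R (- j - e)"
    using q ks_Q_scaleR[of "-1" q] by simp
  have "p \<noteq> 0"
    using p a assms ellipses_iff[of e j] by (auto simp: ks_Q_ks_B kb.zero_left)
  show ?thesis
  proof (cases "p + q = 0")
    case True
    then have "p - (- q) = 0" "p + (- q) = 2 *\<^sub>R p" by (simp_all add: scaleR_2 eq_neg_iff_add_eq_0[symmetric])
    then show ?thesis using \<open>p \<noteq> 0\<close> by (intro that[OF from_hopf[OF assms p q' refl refl]]) simp
  next
    case False
    then show ?thesis by (intro that[OF from_hopf[OF assms p q refl refl]]) simp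
  qed
qed

text \<open>Two relations are differentiated along a curve in the level set: the constant norm of
  \<open>z + c b i w\<close>, and its Hopf image as a linear function of the shape. The sign
  \<open>c\<close> treats \<open>p\<close> and \<open>q\<close> together.\<close>

lemma ks_vel:
  assumes "curve_vel (ks_level \<mu> \<phi> a) (ks_shape \<mu> M \<phi>) (z, w) (z1, w1) (e1, j1)"
  defines "p \<equiv> z + b *\<^sub>R (qi \<odot> w)" and "p1 \<equiv> z1 + b *\<^sub>R (qi \<odot> w1)"
    and "q \<equiv> z - b *\<^sub>R (qi \<odot> w)" and "q1 \<equiv> z1 - b *\<^sub>R (qi \<odot> w1)"
  shows "p \<bullet> p1 = 0" "q \<bullet> q1 = 0" "ks_B p p1 = a *\<^sub>R (j1 - e1)" "ks_B q q1 = a *\<^sub>R (- j1 - e1)"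
proof -
  obtain y where y: "\<And>s. y s \<in> ks_level \<mu> \<phi> a" "y 0 = (z, w)" "(y has_vector_derivative (z1, w1)) (at 0)"
    "((\<lambda>s. ks_shape \<mu> M \<phi> (y s)) has_vector_derivative (e1, j1)) (at 0)"
    using assms(1) by (rule curve_velE) blast
  have zw: "((\<lambda>s. fst (y s)) has_vector_derivative z1) (at 0)" "((\<lambda>s. snd (y s)) has_vector_derivative w1) (at 0)"
    using has_vector_derivative_fst[OF y(3)] has_vector_derivative_snd[OF y(3)] by simp_all
  have ej: "((\<lambda>s. fst (ks_shape \<mu> M \<phi> (y s))) has_vector_derivative e1) (at 0)"
    "((\<lambda>s. snd (ks_shape \<mu> M \<phi> (y s))) has_vector_derivative j1) (at 0)"
    using has_vector_derivative_fst[OF y(4)] has_vector_derivative_snd[OF y(4)] by simp_all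
  have gen: "r0 \<bullet> r1 = 0 \<and> ks_B r0 r1 = a *\<^sub>R (c *\<^sub>R j1 - e1)"
    if r0: "r0 = z + (c * b) *\<^sub>R (qi \<odot> w)" and r1: "r1 = z1 + (c * b) *\<^sub>R (qi \<odot> w1)" and c: "c = 1 \<or> c = -1" for r0 r1 c
  proof -
    define r where "r s = fst (y s) + (c * b) *\<^sub>R (qi \<odot> snd (y s))" for s
    have r: "(r has_vector_derivative r1) (at 0)"
      unfolding r_def r1
      by (intro has_vector_derivative_add zw bounded_linear.has_vector_derivative[OF bounded_linear_scaleR_right]
          bounded_linear.has_vector_derivative[OF qm.bounded_linear_right])
    have rr: "r 0 = r0" by (simp add: r_def r0 y(2))
    have yl: "(fst (y s), snd (y s)) \<in> ks_level \<mu> \<phi> a" for s using y(1) by simp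
    have ax: "ks_axis \<mu> \<phi> (fst (y s)) (snd (y s)) = a" for s
      using yl[of s] unfolding ks_level_def by blast
    have "r s \<bullet> r s = 2 * a" for s
      using level_norm[OF yl[of s]] c by (auto simp: r_def simp flip: power2_norm_eq_inner)
    moreover have "((\<lambda>s. r s \<bullet> r s) has_vector_derivative r 0 \<bullet> r1 + r1 \<bullet> r 0) (at 0)"
      by (rule bounded_bilinear.has_vector_derivative[OF bounded_bilinear_inner r r])
    ultimately have "((\<lambda>s. 2 * a) has_vector_derivative r 0 \<bullet> r1 + r1 \<bullet> r 0) (at (0::real))" by simp
    from vector_derivative_unique_at[OF this has_vector_derivative_const]
    have 1: "r0 \<bullet> r1 = 0" by (simp add: rr inner_commute[of r1])
    have "ks_Q (r s) = (2 * a) *\<^sub>R (c *\<^sub>R snd (ks_shape \<mu> M \<phi> (y s)) - fst (ks_shape \<mu> M \<phi> (y s)))" for s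
      using hopf_coordinates[of "fst (y s)" "snd (y s)" "fst (ks_shape \<mu> M \<phi> (y s))" "snd (ks_shape \<mu> M \<phi> (y s))"]
        ax[of s] c by (auto simp: r_def)
    moreover have "((\<lambda>s. (2 * a) *\<^sub>R (c *\<^sub>R snd (ks_shape \<mu> M \<phi> (y s)) - fst (ks_shape \<mu> M \<phi> (y s))))
        has_vector_derivative (2 * a) *\<^sub>R (c *\<^sub>R j1 - e1)) (at 0)"
      by (intro has_vector_derivative_diff ej bounded_linear.has_vector_derivative[OF bounded_linear_scaleR_right])
    ultimately have "((\<lambda>s. ks_Q (r s)) has_vector_derivative (2 * a) *\<^sub>R (c *\<^sub>R j1 - e1)) (at 0)" by simp
    moreover have "((\<lambda>s. ks_Q (r s)) has_vector_derivative ks_B (r 0) r1 + ks_B r1 (r 0)) (at 0)"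
      unfolding ks_Q_ks_B by (rule kb.has_vector_derivative[OF r r])
    ultimately have "ks_B (r 0) r1 + ks_B r1 (r 0) = (2 * a) *\<^sub>R (c *\<^sub>R j1 - e1)"
      by (rule vector_derivative_unique_at[symmetric])
    then have "2 *\<^sub>R ks_B r0 r1 = 2 *\<^sub>R (a *\<^sub>R (c *\<^sub>R j1 - e1))"
      by (simp add: rr ks_B_commute[of r1] scaleR_2)
    then have "ks_B r0 r1 = a *\<^sub>R (c *\<^sub>R j1 - e1)" by (simp only: scaleR_cancel_left) simp
    with 1 show ?thesis by simp
  qed
  from gen[of p 1 p1] gen[of q "-1" q1]
  show "p \<bullet> p1 = 0" "q \<bullet> q1 = 0" "ks_B p p1 = a *\<^sub>R (j1 - e1)" "ks_B q q1 = a *\<^sub>R (- j1 - e1)"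
    by (simp_all add: p_def q_def p1_def q1_def)
qed

text \<open>In the variables \<open>p\<close> and \<open>q\<close> the canonical form is a
  difference of two forms to which \<open>hopf_area\<close> applies. The Hopf image of
  \<open>q\<close> points to the antipode of \<open>j + e\<close>, under which the trilinear area
  expression is odd; this turns the difference into the sum in \<open>ell_area\<close>.\<close>

lemma ks_form:
  assumes v1: "curve_vel (ks_level \<mu> \<phi> a) (ks_shape \<mu> M \<phi>) (z, w) (z1, w1) (e1, j1)"
    and v2: "curve_vel (ks_level \<mu> \<phi> a) (ks_shape \<mu> M \<phi>) (z, w) (z2, w2) (e2, j2)"
  shows "w1 \<bullet> z2 - z1 \<bullet> w2 = - calL1 \<mu> M \<phi> a / 2 * ell_area (ks_shape \<mu> M \<phi> (z, w)) (e1, j1) (e2, j2)"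
proof -
  obtain e j where ej: "ks_shape \<mu> M \<phi> (z, w) = (e, j)" by (rule prod.exhaust)
  have x: "(z, w) \<in> ks_level \<mu> \<phi> a" using v1 unfolding curve_vel_def by (metis rangeI subsetD)
  have ax: "ks_axis \<mu> \<phi> z w = a" using x by (simp add: ks_level_def)
  note n = level_norm[OF x] and h = hopf_coordinates[OF ej ax]
  have P: "(2 * a)\<^sup>2 * ((qi \<odot> (z1 + b *\<^sub>R (qi \<odot> w1))) \<bullet> (z2 + b *\<^sub>R (qi \<odot> w2))) =
      ((2 * a) *\<^sub>R (j - e)) \<bullet> cross3 (a *\<^sub>R (j1 - e1)) (a *\<^sub>R (j2 - e2))"
    using hopf_area[OF ks_vel(1)[OF v1] ks_vel(1)[OF v2]]
    unfolding ks_vel(3)[OF v1] ks_vel(3)[OF v2] h power2_norm_eq_inner[symmetric] n by simp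
  have Q: "(2 * a)\<^sup>2 * ((qi \<odot> (z1 - b *\<^sub>R (qi \<odot> w1))) \<bullet> (z2 - b *\<^sub>R (qi \<odot> w2))) =
      ((2 * a) *\<^sub>R (- j - e)) \<bullet> cross3 (a *\<^sub>R (- j1 - e1)) (a *\<^sub>R (- j2 - e2))"
    using hopf_area[OF ks_vel(2)[OF v1] ks_vel(2)[OF v2]]
    unfolding ks_vel(4)[OF v1] ks_vel(4)[OF v2] h power2_norm_eq_inner[symmetric] n by simp
  have neg: "- x - y = - (x + y)" for x y :: vec by simp
  have "2 * b * (w1 \<bullet> z2 - z1 \<bullet> w2) = (qi \<odot> (z1 - b *\<^sub>R (qi \<odot> w1))) \<bullet> (z2 - b *\<^sub>R (qi \<odot> w2))
      - (qi \<odot> (z1 + b *\<^sub>R (qi \<odot> w1))) \<bullet> (z2 + b *\<^sub>R (qi \<odot> w2))"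
    unfolding qm.add_right qm.diff_right qm.scaleR_right qi_qi scaleR_minus_right
      inner_add_left inner_add_right inner_diff_left inner_diff_right inner_minus_left inner_scaleR_left inner_scaleR_right inner_qi
    by (simp add: algebra_simps)
  then have "(2 * a)\<^sup>2 * (2 * b * (w1 \<bullet> z2 - z1 \<bullet> w2)) =
      (2 * a)\<^sup>2 * ((qi \<odot> (z1 - b *\<^sub>R (qi \<odot> w1))) \<bullet> (z2 - b *\<^sub>R (qi \<odot> w2)))
      - (2 * a)\<^sup>2 * ((qi \<odot> (z1 + b *\<^sub>R (qi \<odot> w1))) \<bullet> (z2 + b *\<^sub>R (qi \<odot> w2)))"
    by (simp only: right_diff_distrib)
  also have "\<dots> = - (2 * a * a * a) * ell_area (e, j) (e1, j1) (e2, j2)"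
    unfolding P Q neg cross_mult_left cross_mult_right scaleR_minus_right cross_minus_left cross_minus_right
      inner_scaleR_left inner_scaleR_right inner_minus_left inner_minus_right
    by (simp add: ell_area_def algebra_simps)
  finally have *: "(2 * a)\<^sup>2 * (2 * b * (w1 \<bullet> z2 - z1 \<bullet> w2)) = - (2 * a * a * a) * ell_area (e, j) (e1, j1) (e2, j2)" .
  have "X = - (a / (4 * b)) * E" if "(2 * a)\<^sup>2 * (2 * b * X) = - (2 * a * a * a) * E" for X E
  proof -
    from that have "(2 * a * a) * (4 * b * X + a * E) = 0" by (simp add: power2_eq_square algebra_simps)
    then have "4 * b * X + a * E = 0" using a by simp
    then show "X = - (a / (4 * b)) * E" using b(1) by (simp add: field_simps)
  qed
  from this[OF *] show ?thesis unfolding ej calL1_eq by simp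
qed

lemma ks_submersion:
  "submersion_onto (ks_level \<mu> \<phi> a) (ks_shape \<mu> M \<phi>) ellipses (\<lambda>(z, w) (z', w'). w \<bullet> z' - z \<bullet> w')
     (\<lambda>x v v'. - calL1 \<mu> M \<phi> a / 2 * ell_area x v v')"
  unfolding submersion_onto_def
proof (intro conjI ballI allI impI)
  have "ks_shape \<mu> M \<phi> x \<in> ellipses" if x: "x \<in> ks_level \<mu> \<phi> a" for x
  proof -
    obtain z w e j where *: "x = (z, w)" "ks_shape \<mu> M \<phi> (z, w) = (e, j)" by (metis surj_pair)
    have ax: "ks_axis \<mu> \<phi> z w = a" using x * by (simp add: ks_level_def)
    have "2 * a * norm (j - e) = 2 * a" "2 * a * norm (- j - e) = 2 * a"
      using x ks_norm[of "z + b *\<^sub>R (qi \<odot> w)"] ks_norm[of "z - b *\<^sub>R (qi \<odot> w)"] a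
      unfolding * hopf_coordinates[OF *(2) ax] by (simp_all add: level_norm)
    moreover have "norm (- j - e) = norm (j + e)" by (metis minus_add_distrib norm_minus_cancel uminus_add_conv_diff add.commute diff_conv_add_uminus)
    ultimately show ?thesis using a * by (simp add: ellipses_iff)
  qed
  moreover have "x \<in> ks_shape \<mu> M \<phi> ` ks_level \<mu> \<phi> a" if "x \<in> ellipses" for x
    using that ks_level_onto by (metis image_eqI surj_pair)
  ultimately show "ks_shape \<mu> M \<phi> ` ks_level \<mu> \<phi> a = ellipses" by blast
next
  fix x assume x: "x \<in> ks_level \<mu> \<phi> a"
  \<comment> \<open>By \<open>level_shape\<close> this globally defined polynomial restricts to the
    shape map; \<open>ks_B_qi\<close> expresses \<open>ks_G\<close> through
    \<open>ks_B\<close>.\<close>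
  let ?P = "\<lambda>x. ((- 1 / (2 * a)) *\<^sub>R (ks_B (fst x) (fst x) + b\<^sup>2 *\<^sub>R ks_B (snd x) (snd x)),
      (2 * b / a) *\<^sub>R (1 / 2) *\<^sub>R ks_B (fst x) (qi \<odot> snd x))"
  have "smooth_on UNIV ?P"
    by (intro smooth_on_Pair smooth_on_scaleR smooth_on_add smooth_on_const smooth_on_bilinear[OF bilinear_ks_B]
        smooth_on_bilinear[OF bilinear_qmult] smooth_on_fst smooth_on_snd smooth_on_id open_UNIV)
  moreover have "?P y = ks_shape \<mu> M \<phi> y" if "y \<in> ks_level \<mu> \<phi> a" for y
    using that level_shape[of "fst y" "snd y"]
    by (cases y) (simp add: ks_level_def ks_Q_ks_B ks_B_qi ks_G_def)
  ultimately show "\<exists>U P. x \<in> U \<and> smooth_on U P \<and> (\<forall>y\<in>U \<inter> ks_level \<mu> \<phi> a. P y = ks_shape \<mu> M \<phi> y)"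
    by (intro exI[of _ UNIV] exI[of _ ?P]) simp
  show "\<exists>V \<sigma>. ks_shape \<mu> M \<phi> x \<in> V \<and> smooth_on V \<sigma> \<and> \<sigma> (ks_shape \<mu> M \<phi> x) = x \<and>
    (\<forall>b\<in>V \<inter> ellipses. \<sigma> b \<in> ks_level \<mu> \<phi> a \<and> ks_shape \<mu> M \<phi> (\<sigma> b) = b)"
    using ks_section[of "fst x" "snd x"] x by simp
next
  fix x u v u' v'
  assume "curve_vel (ks_level \<mu> \<phi> a) (ks_shape \<mu> M \<phi>) x u v \<and> curve_vel (ks_level \<mu> \<phi> a) (ks_shape \<mu> M \<phi>) x u' v'"
  then show "(case u of (z, w) \<Rightarrow> \<lambda>(z', w'). w \<bullet> z' - z \<bullet> w') u' =
      - calL1 \<mu> M \<phi> a / 2 * ell_area (ks_shape \<mu> M \<phi> x) v v'"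
    using ks_form[of "fst x" "snd x" "fst u" "snd u" "fst v" "snd v" "fst u'" "snd u'" "fst v'" "snd v'"]
    by (simp add: split_beta)
qed

end

section \<open>Kepler ellipses\<close>

definition kep_level :: "real \<Rightarrow> real \<Rightarrow> real \<Rightarrow> (vec \<times> vec) set" where
  "kep_level \<mu> M a = {(P, Q). Q \<noteq> 0 \<and> kep_axis \<mu> M P Q = a}"

definition kep_shape :: "real \<Rightarrow> real \<Rightarrow> vec \<times> vec \<Rightarrow> vec \<times> vec" where
  "kep_shape \<mu> M = (\<lambda>(P, Q). (kep_ecc \<mu> M P Q, kep_ang \<mu> M P Q))"

text \<open>Inverts \<open>ks_P\<close> at fixed \<open>z\<close>: the solution of
  \<open>qcnj z \<odot> qi \<odot> w = 2 |z|^2 P\<close> with \<open>P\<close> purely imaginary, so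
  that the constraint holds too.\<close>

definition ks_w :: "quat \<Rightarrow> vec \<Rightarrow> quat" where
  "ks_w z P = (- 2) *\<^sub>R (qi \<odot> (z \<odot> (0, P)))"

lemma ks_P_ks_B: "ks_P z w = (1 / (2 * (norm z)\<^sup>2)) *\<^sub>R ks_B z w"
  by (simp add: ks_P_def ks_B_def)

lemma ks_w_props:
  assumes "z \<noteq> 0"
  shows "fst (qcnj z \<odot> qi \<odot> ks_w z P) = 0" "ks_P z (ks_w z P) = P"
proof -
  have "qcnj z \<odot> qi \<odot> (qi \<odot> (z \<odot> (0, P))) = (- (norm z)\<^sup>2) *\<^sub>R (0, P)"
    unfolding power2_norm_eq_inner by (rule quat_eqI) (simp_all add: quat_simps algebra_simps)
  then have *: "qcnj z \<odot> qi \<odot> ks_w z P = (2 * (norm z)\<^sup>2) *\<^sub>R (0, P)"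
    unfolding ks_w_def qm.scaleR_right by simp
  show "fst (qcnj z \<odot> qi \<odot> ks_w z P) = 0" by (simp add: *)
  show "ks_P z (ks_w z P) = P" unfolding ks_P_def * using assms by simp
qed

locale kep =
  fixes \<mu> M a :: real
  assumes pos: "\<mu> > 0" "M > 0" "a > 0"
begin

text \<open>At the value \<open>\<mu> M / (2 a)\<close> of \<open>\<phi>\<close> no rescaling of the momentum is needed.\<close>

abbreviation "\<phi> \<equiv> \<mu> * M / (2 * a)"

sublocale K: ks \<mu> M \<phi> a
  using pos by unfold_locales auto

lemma resc_1: "resc \<mu> M \<phi> a = 1"
  using pos by (simp add: resc_def)

text \<open>With rescaling factor 1, \<open>resc_eq\<close> reads
  \<open>1 / L = 2 b / a\<close>.\<close>

lemma circ_L_eq: "circ_L \<mu> M a = calL1 \<mu> M \<phi> a"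
proof -
  have "circ_L \<mu> M a > 0" using pos by (simp add: circ_L_def)
  then show ?thesis
    using K.resc_eq pos K.b(1) unfolding resc_1 K.calL1_eq by (simp add: field_simps)
qed

lemma kep_of_ks:
  assumes "(z, w) \<in> ks_level \<mu> \<phi> a" "z \<noteq> 0"
  shows "(ks_P z w, ks_Q z) \<in> kep_level \<mu> M a" "kep_shape \<mu> M (ks_P z w, ks_Q z) = ks_shape \<mu> M \<phi> (z, w)"
proof -
  have f: "fst (qcnj z \<odot> qi \<odot> w) = 0" and ax: "ks_axis \<mu> \<phi> z w = a"
    using assms(1) by (simp_all add: ks_level_def)
  show "(ks_P z w, ks_Q z) \<in> kep_level \<mu> M a"
    using ks_ellipse(1)[OF assms(2) f pos(1,2) K.\<phi>] assms(2)
    by (simp add: ax resc_1 kep_level_def ks_Q_zero_iff)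
  show "kep_shape \<mu> M (ks_P z w, ks_Q z) = ks_shape \<mu> M \<phi> (z, w)"
    using ks_ellipse(2,3)[OF assms(2) f pos(1,2) K.\<phi>]
    by (simp add: ax resc_1 kep_shape_def ks_shape_def)
qed

lemma ks_of_kep:
  assumes "z \<noteq> 0" "(P, ks_Q z) \<in> kep_level \<mu> M a"
  shows "(z, ks_w z P) \<in> ks_level \<mu> \<phi> a" "kep_shape \<mu> M (P, ks_Q z) = ks_shape \<mu> M \<phi> (z, ks_w z P)"
proof -
  define r where "r = (norm z)\<^sup>2"
  define W where "W = (norm (ks_w z P))\<^sup>2"
  have r: "r > 0" using assms by (simp add: r_def)
  have P: "(norm P)\<^sup>2 = W / (4 * r)"
    using ks_P_norm[OF ks_w_props(1)[OF assms(1), of P] assms(1)] ks_w_props(2)[OF assms(1), of P] by (simp add: r_def W_def)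
  have "- \<mu> * M / (2 * ((norm P)\<^sup>2 / (2 * \<mu>) - \<mu> * M / r)) = a"
    using assms(2) by (simp add: kep_level_def kep_axis_def ks_norm r_def)
  \<comment> \<open>Division by zero gives 0, so the positive value of the axis excludes zero
    energy.\<close>
  moreover from this have "(norm P)\<^sup>2 / (2 * \<mu>) - \<mu> * M / r \<noteq> 0" using pos(3) by force
  ultimately have "(norm P)\<^sup>2 / (2 * \<mu>) - \<mu> * M / r = - \<mu> * M / (2 * a)"
    using pos by (simp add: divide_simps)
  then have "W = (2 * a - r) * (4 * \<mu> * (\<mu> * M / a))"
    unfolding P using pos r by (simp add: field_simps)
  then have "ks_axis \<mu> \<phi> z (ks_w z P) = a"
    using pos by (simp add: ks_axis_def flip: r_def W_def)
  then show l: "(z, ks_w z P) \<in> ks_level \<mu> \<phi> a"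
    using ks_w_props[OF assms(1)] by (simp add: ks_level_def)
  show "kep_shape \<mu> M (P, ks_Q z) = ks_shape \<mu> M \<phi> (z, ks_w z P)"
    using kep_of_ks(2)[OF l assms(1)] ks_w_props(2)[OF assms(1)] by simp
qed

lemma kep_lift:
  assumes "x \<in> kep_level \<mu> M a"
  obtains z where "z \<noteq> 0" "ks_Q z = snd x" "x = (fst x, ks_Q z)"
proof -
  obtain z where z: "ks_Q z = snd x" by (rule hopf_surj)
  then have "z \<noteq> 0" using assms by (auto simp: kep_level_def ks_Q_ks_B kb.zero_left)
  with z show ?thesis by (intro that[of z]) auto
qed

text \<open>Positions are lifted by the Hopf section through \<open>z\<close> and momenta by
  \<open>ks_w\<close>, so that the symplectic form of the Kepler problem can be read off from
  \<open>ks_form\<close>.\<close>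

lemma kep_lift_vel:
  assumes cv: "curve_vel (kep_level \<mu> M a) (kep_shape \<mu> M) (P, Q) (P1, Q1) v" and z: "ks_Q z = Q" "z \<noteq> 0"
  obtains z1 where "Q1 = 2 *\<^sub>R ks_B z z1"
    "curve_vel (ks_level \<mu> \<phi> a) (ks_shape \<mu> M \<phi>) (z, ks_w z P)
      (z1, (- 2) *\<^sub>R (qi \<odot> (z \<odot> (0, P1) + z1 \<odot> (0, P)))) v"
proof -
  obtain y where y: "\<And>s. y s \<in> kep_level \<mu> M a" "y 0 = (P, Q)" "(y has_vector_derivative (P1, Q1)) (at 0)"
    "((\<lambda>s. kep_shape \<mu> M (y s)) has_vector_derivative v) (at 0)"
    using cv by (rule curve_velE) blast
  have PQ: "((\<lambda>s. fst (y s)) has_vector_derivative P1) (at 0)" "((\<lambda>s. snd (y s)) has_vector_derivative Q1) (at 0)"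
    using has_vector_derivative_fst[OF y(3)] has_vector_derivative_snd[OF y(3)] by simp_all
  have Q0: "snd (y 0) \<in> hopf_dom z" using y(2) z hopf_section_self(2)[OF z(2)] by simp
  obtain N where N: "open N" "0 \<in> N" "\<And>s. s \<in> N \<Longrightarrow> snd (y s) \<in> hopf_dom z"
    using has_vector_derivative_continuous[OF PQ(2)] open_hopf_dom[of z] Q0
    unfolding continuous_at_open by metis
  define \<zeta> where "\<zeta> s = hopf_section z (snd (y s))" for s
  have \<zeta>Q: "ks_Q (\<zeta> s) = snd (y s)" if "s \<in> N" for s
    unfolding \<zeta>_def by (rule ks_Q_hopf_section[OF z(2) N(3)[OF that]])
  have \<zeta>0: "\<zeta> 0 = z" using hopf_section_self(1)[OF z(2)] y(2) z(1) by (simp add: \<zeta>_def)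
  have ynz: "snd (y s) \<noteq> 0" for s using y(1)[of s] unfolding kep_level_def by force
  have \<zeta>nz: "\<zeta> s \<noteq> 0" if "s \<in> N" for s
    using \<zeta>Q[OF that] ynz[of s] by (auto simp: ks_Q_ks_B kb.zero_left)
  obtain z1 where z1: "(\<zeta> has_vector_derivative z1) (at 0)"
    using smooth_on_vector_derivative[OF smooth_hopf_section[OF z(2)] PQ(2) Q0] unfolding \<zeta>_def by blast
  have "((\<lambda>s. ks_Q (\<zeta> s)) has_vector_derivative ks_B (\<zeta> 0) z1 + ks_B z1 (\<zeta> 0)) (at 0)"
    unfolding ks_Q_ks_B by (rule kb.has_vector_derivative[OF z1 z1])
  then have "((\<lambda>s. snd (y s)) has_vector_derivative 2 *\<^sub>R ks_B z z1) (at 0)"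
    unfolding \<zeta>0 ks_B_commute[of z1] scaleR_2
    by (rule has_vector_derivative_transform_within_open[OF _ N(1,2)]) (simp add: \<zeta>Q)
  with PQ(2) have Q1: "Q1 = 2 *\<^sub>R ks_B z z1" by (rule vector_derivative_unique_at)
  have w: "((\<lambda>s. ks_w (\<zeta> s) (fst (y s))) has_vector_derivative
      (- 2) *\<^sub>R (qi \<odot> (\<zeta> 0 \<odot> (0, P1) + z1 \<odot> (0, fst (y 0))))) (at 0)"
    unfolding ks_w_def
    by (intro bounded_linear.has_vector_derivative[OF bounded_linear_scaleR_right]
        bounded_linear.has_vector_derivative[OF qm.bounded_linear_right]
        qm.has_vector_derivative z1 has_vector_derivative_Pair has_vector_derivative_const PQ(1))
  have l: "(\<zeta> s, ks_w (\<zeta> s) (fst (y s))) \<in> ks_level \<mu> \<phi> a"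
      "kep_shape \<mu> M (y s) = ks_shape \<mu> M \<phi> (\<zeta> s, ks_w (\<zeta> s) (fst (y s)))" if "s \<in> N" for s
  proof -
    have "(fst (y s), ks_Q (\<zeta> s)) = y s" by (simp add: \<zeta>Q[OF that])
    then show "(\<zeta> s, ks_w (\<zeta> s) (fst (y s))) \<in> ks_level \<mu> \<phi> a"
        "kep_shape \<mu> M (y s) = ks_shape \<mu> M \<phi> (\<zeta> s, ks_w (\<zeta> s) (fst (y s)))"
      using ks_of_kep[OF \<zeta>nz[OF that], of "fst (y s)"] y(1)[of s] by simp_all
  qed
  have "curve_vel (ks_level \<mu> \<phi> a) (ks_shape \<mu> M \<phi>) (\<zeta> 0, ks_w (\<zeta> 0) (fst (y 0)))
     (z1, (- 2) *\<^sub>R (qi \<odot> (\<zeta> 0 \<odot> (0, P1) + z1 \<odot> (0, fst (y 0))))) v"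
  proof (rule curve_velI[OF N(1,2) l(1)])
    show "((\<lambda>s. ks_shape \<mu> M \<phi> (\<zeta> s, ks_w (\<zeta> s) (fst (y s)))) has_vector_derivative v) (at 0)"
      by (rule has_vector_derivative_transform_within_open[OF y(4) N(1,2)]) (rule l(2))
  qed (assumption, rule has_vector_derivative_Pair[OF z1 w])
  then show ?thesis using that Q1 by (simp add: \<zeta>0 y(2))
qed

text \<open>A section for the regularized variables is pushed down by the Kustaanheimo-Stiefel map;
  its domain is shrunk to nonzero \<open>z\<close>, where that map is smooth.\<close>

lemma kep_section:
  assumes x: "x \<in> kep_level \<mu> M a"
  shows "\<exists>V \<sigma>. kep_shape \<mu> M x \<in> V \<and> smooth_on V \<sigma> \<and> \<sigma> (kep_shape \<mu> M x) = x \<and>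
    (\<forall>b\<in>V \<inter> ellipses. \<sigma> b \<in> kep_level \<mu> M a \<and> kep_shape \<mu> M (\<sigma> b) = b)"
proof -
  obtain z where z: "z \<noteq> 0" "ks_Q z = snd x" "x = (fst x, ks_Q z)" using kep_lift[OF x] .
  have x': "(fst x, ks_Q z) \<in> kep_level \<mu> M a" using x z(3) by simp
  note l = ks_of_kep[OF z(1) x']
  obtain V \<sigma> where V: "ks_shape \<mu> M \<phi> (z, ks_w z (fst x)) \<in> V" "smooth_on V \<sigma>"
    "\<sigma> (ks_shape \<mu> M \<phi> (z, ks_w z (fst x))) = (z, ks_w z (fst x))"
    "\<And>b. b \<in> V \<inter> ellipses \<Longrightarrow> \<sigma> b \<in> ks_level \<mu> \<phi> a \<and> ks_shape \<mu> M \<phi> (\<sigma> b) = b"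
    using K.ks_section[OF l(1)] by blast
  have sx: "kep_shape \<mu> M x = ks_shape \<mu> M \<phi> (z, ks_w z (fst x))" using l(2) z(3) by simp
  define V' where "V' = V \<inter> \<sigma> -` {v. fst v \<noteq> 0}"
  have "open {v :: quat \<times> quat. fst v \<noteq> 0}"
    by (intro open_Collect_neq continuous_intros)
  then have oV: "open V'" unfolding V'_def
    by (rule continuous_open_preimage[OF smooth_on_continuous[OF V(2)] smooth_on_open[OF V(2)]])
  have s: "smooth_on V' \<sigma>" by (rule smooth_on_subset[OF V(2) oV]) (auto simp: V'_def)
  define \<tau> where "\<tau> b = (ks_P (fst (\<sigma> b)) (snd (\<sigma> b)), ks_Q (fst (\<sigma> b)))" for b
  have "smooth_on V' \<tau>"
    unfolding \<tau>_def ks_P_ks_B ks_Q_ks_B power2_norm_eq_inner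
    by (intro smooth_on_Pair smooth_on_scaleR smooth_on_divide smooth_on_mult smooth_on_const smooth_on_inner
        smooth_on_bilinear[OF bilinear_ks_B] smooth_on_fst smooth_on_snd s oV) (auto simp: V'_def)
  moreover have "kep_shape \<mu> M x \<in> V'" using V z by (simp add: V'_def sx)
  moreover have "\<tau> (kep_shape \<mu> M x) = x"
    using z ks_w_props(2)[OF z(1)] by (simp add: \<tau>_def sx V(3))
  moreover have "\<tau> b \<in> kep_level \<mu> M a \<and> kep_shape \<mu> M (\<tau> b) = b" if "b \<in> V' \<inter> ellipses" for b
  proof -
    have "(fst (\<sigma> b), snd (\<sigma> b)) \<in> ks_level \<mu> \<phi> a" "ks_shape \<mu> M \<phi> (\<sigma> b) = b" "fst (\<sigma> b) \<noteq> 0"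
      using V(4)[of b] that by (auto simp: V'_def)
    with kep_of_ks[of "fst (\<sigma> b)" "snd (\<sigma> b)"] show ?thesis by (simp add: \<tau>_def)
  qed
  ultimately show ?thesis by blast
qed

text \<open>The Kustaanheimo-Stiefel map is symplectic. Left multiplication by \<open>qi\<close> and
  right multiplication by an imaginary quaternion are commuting antisymmetric maps, so their product
  is symmetric and the terms containing \<open>P\<close> cancel.\<close>

lemma ks_form_kep:
  "((- 2) *\<^sub>R (qi \<odot> (z \<odot> (0, P1) + z1 \<odot> (0, P)))) \<bullet> z2 - z1 \<bullet> ((- 2) *\<^sub>R (qi \<odot> (z \<odot> (0, P2) + z2 \<odot> (0, P)))) =
    P1 \<bullet> (2 *\<^sub>R ks_B z z2) - (2 *\<^sub>R ks_B z z1) \<bullet> P2"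
  unfolding ks_B_def by (cases z; cases z1; cases z2) (simp add: quat_simps algebra_simps)

lemma kep_form:
  assumes "curve_vel (kep_level \<mu> M a) (kep_shape \<mu> M) (P, Q) (P1, Q1) v1"
    "curve_vel (kep_level \<mu> M a) (kep_shape \<mu> M) (P, Q) (P2, Q2) v2"
  shows "P1 \<bullet> Q2 - Q1 \<bullet> P2 = - circ_L \<mu> M a / 2 * ell_area (kep_shape \<mu> M (P, Q)) v1 v2"
proof -
  have x: "(P, Q) \<in> kep_level \<mu> M a" using assms(1) unfolding curve_vel_def by (metis rangeI subsetD)
  obtain z where z: "z \<noteq> 0" "ks_Q z = Q" using kep_lift[OF x] by auto
  obtain z1 where z1: "Q1 = 2 *\<^sub>R ks_B z z1" "curve_vel (ks_level \<mu> \<phi> a) (ks_shape \<mu> M \<phi>) (z, ks_w z P)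
      (z1, (- 2) *\<^sub>R (qi \<odot> (z \<odot> (0, P1) + z1 \<odot> (0, P)))) v1"
    using kep_lift_vel[OF assms(1) z(2,1)] .
  obtain z2 where z2: "Q2 = 2 *\<^sub>R ks_B z z2" "curve_vel (ks_level \<mu> \<phi> a) (ks_shape \<mu> M \<phi>) (z, ks_w z P)
      (z2, (- 2) *\<^sub>R (qi \<odot> (z \<odot> (0, P2) + z2 \<odot> (0, P)))) v2"
    using kep_lift_vel[OF assms(2) z(2,1)] .
  have "P1 \<bullet> Q2 - Q1 \<bullet> P2 = - calL1 \<mu> M \<phi> a / 2 * ell_area (ks_shape \<mu> M \<phi> (z, ks_w z P)) v1 v2"
    unfolding z1(1) z2(1) ks_form_kep[of z P1 z1 P z2 P2, symmetric]
    using K.ks_form[of z "ks_w z P" _ _ "fst v1" "snd v1" _ _ "fst v2" "snd v2"] z1(2) z2(2)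
    by (simp only: prod.collapse)
  then show ?thesis using ks_of_kep(2)[OF z(1), of P] x z(2) by (simp add: circ_L_eq)
qed

lemma kep_submersion:
  "submersion_onto (kep_level \<mu> M a) (kep_shape \<mu> M) ellipses (\<lambda>(P, Q) (P', Q'). P \<bullet> Q' - Q \<bullet> P')
     (\<lambda>x v v'. - circ_L \<mu> M a / 2 * ell_area x v v')"
  unfolding submersion_onto_def
proof (intro conjI ballI allI impI)
  have E: "ks_shape \<mu> M \<phi> ` ks_level \<mu> \<phi> a = ellipses"
    using K.ks_submersion by (simp add: submersion_onto_def)
  show "kep_shape \<mu> M ` kep_level \<mu> M a = ellipses"
  proof (intro equalityI subsetI)
    fix s assume "s \<in> kep_shape \<mu> M ` kep_level \<mu> M a"
    then obtain x where x: "x \<in> kep_level \<mu> M a" "s = kep_shape \<mu> M x" by blast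
    obtain z where z: "z \<noteq> 0" "ks_Q z = snd x" "x = (fst x, ks_Q z)" using kep_lift[OF x(1)] .
    show "s \<in> ellipses" using ks_of_kep[OF z(1), of "fst x"] x z(3) E by auto
  next
    fix s assume s: "s \<in> ellipses"
    obtain e j where ej: "s = (e, j)" by (rule prod.exhaust)
    obtain z w where "(z, w) \<in> ks_level \<mu> \<phi> a" "ks_shape \<mu> M \<phi> (z, w) = s" "z \<noteq> 0"
      using K.ks_level_onto s unfolding ej by blast
    with kep_of_ks[of z w] show "s \<in> kep_shape \<mu> M ` kep_level \<mu> M a" by force
  qed
next
  fix x assume x: "x \<in> kep_level \<mu> M a"
  let ?U = "{y :: vec \<times> vec. snd y \<noteq> 0}"
  \<comment> \<open>The axis is replaced by its constant value \<open>a\<close>, so the extension is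
    smooth wherever the position is nonzero.\<close>
  let ?P = "\<lambda>y. ((1 / (\<mu>\<^sup>2 * M)) *\<^sub>R cross3 (fst y) (cross3 (snd y) (fst y)) - (1 / norm (snd y)) *\<^sub>R snd y,
      (1 / circ_L \<mu> M a) *\<^sub>R cross3 (snd y) (fst y))"
  have o: "open ?U" by (intro open_Collect_neq continuous_intros)
  have "smooth_on ?U ?P"
    by (intro smooth_on_Pair smooth_on_scaleR smooth_on_diff smooth_on_divide smooth_on_norm smooth_on_const
        smooth_on_bilinear[OF bilinear_cross3] smooth_on_fst smooth_on_snd smooth_on_id o) auto
  moreover have "?P y = kep_shape \<mu> M y" if "y \<in> kep_level \<mu> M a" for y
    using that by (cases y) (simp add: kep_level_def kep_shape_def kep_ecc_def kep_ang_def)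
  moreover have "x \<in> ?U" using x by (auto simp: kep_level_def)
  ultimately show "\<exists>U P. x \<in> U \<and> smooth_on U P \<and> (\<forall>y\<in>U \<inter> kep_level \<mu> M a. P y = kep_shape \<mu> M y)"
    by (intro exI[of _ ?U] exI[of _ ?P]) simp
  show "\<exists>V \<sigma>. kep_shape \<mu> M x \<in> V \<and> smooth_on V \<sigma> \<and> \<sigma> (kep_shape \<mu> M x) = x \<and>
    (\<forall>b\<in>V \<inter> ellipses. \<sigma> b \<in> kep_level \<mu> M a \<and> kep_shape \<mu> M (\<sigma> b) = b)"
    by (rule kep_section[OF x])
next
  fix x u v u' v'
  assume "curve_vel (kep_level \<mu> M a) (kep_shape \<mu> M) x u v \<and> curve_vel (kep_level \<mu> M a) (kep_shape \<mu> M) x u' v'"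
  then show "(case u of (P, Q) \<Rightarrow> \<lambda>(P', Q'). P \<bullet> Q' - Q \<bullet> P') u' =
      - circ_L \<mu> M a / 2 * ell_area (kep_shape \<mu> M x) v v'"
    using kep_form[of "fst x" "snd x" "fst u" "snd u" v "fst u'" "snd u'" v']
    by (simp add: split_beta)
qed

end

section \<open>Averages over the fast angles\<close>

lemma abs_sin_diff_le: "\<bar>sin u - sin v\<bar> \<le> \<bar>u - v :: real\<bar>"
proof -
  have "\<bar>sin u - sin v\<bar> = 2 * \<bar>sin ((u - v) / 2)\<bar> * \<bar>cos ((u + v) / 2)\<bar>"
    by (simp add: sin_diff_sin abs_mult)
  also have "\<dots> \<le> 2 * \<bar>(u - v) / 2\<bar> * 1"
    by (intro mult_mono abs_sin_x_le_abs_x) auto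
  finally show ?thesis by simp
qed

context
  fixes e :: real
  assumes e: "0 \<le> e" "e < 1"
begin

text \<open>As \<open>sin\<close> is 1-Lipschitz, the map of Kepler's equation expands distances by
  at least \<open>1 - e\<close>. This gives uniqueness of the solution and a Lipschitz
  inverse.\<close>

lemma kepler_expand: "(1 - e) * \<bar>u - v\<bar> \<le> \<bar>(u - e * sin u) - (v - e * sin v)\<bar>"
proof -
  have "\<bar>e * (sin u - sin v)\<bar> \<le> e * \<bar>u - v\<bar>"
    using e abs_sin_diff_le[of u v] by (simp add: abs_mult mult_left_mono)
  then have "\<bar>u - v\<bar> - e * \<bar>u - v\<bar> \<le> \<bar>(u - v) - e * (sin u - sin v)\<bar>" by linarith
  then show ?thesis by (simp add: algebra_simps)
qed

lemma ecc_anomaly_kepler: "ecc_anomaly e (u - e * sin u) = u"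
  unfolding ecc_anomaly_def
proof (rule the_equality)
  fix v assume "v - e * sin v = u - e * sin u"
  then have "(1 - e) * \<bar>v - u\<bar> \<le> 0" using kepler_expand[of v u] by simp
  then show "v = u" using e by (simp add: mult_le_0_iff)
qed simp

lemma kepler_ecc_anomaly: "ecc_anomaly e l - e * sin (ecc_anomaly e l) = l"
proof -
  have b: "\<bar>e * sin x\<bar> \<le> 1" for x
    using e abs_sin_le_one[of x] by (simp add: abs_mult mult_le_one)
  have "\<exists>u. l - 1 \<le> u \<and> u \<le> l + 1 \<and> u - e * sin u = l"
  proof (rule IVT')
    show "(l - 1) - e * sin (l - 1) \<le> l" "l \<le> (l + 1) - e * sin (l + 1)"
      using b[of "l - 1"] b[of "l + 1"] by linarith+
  qed (auto intro!: continuous_intros)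
  then show ?thesis using ecc_anomaly_kepler by auto
qed

lemma ecc_anomaly_periodic: "ecc_anomaly e (l + 2 * pi) = ecc_anomaly e l + 2 * pi"
proof -
  have "(ecc_anomaly e l + 2 * pi) - e * sin (ecc_anomaly e l + 2 * pi) = l + 2 * pi"
    using kepler_ecc_anomaly[of l] by simp
  from ecc_anomaly_kepler[of "ecc_anomaly e l + 2 * pi", unfolded this] show ?thesis .
qed

lemma continuous_ecc_anomaly: "continuous_on UNIV (ecc_anomaly e)"
proof -
  have "dist (ecc_anomaly e x) (ecc_anomaly e y) \<le> 1 / (1 - e) * dist x y" for x y
    using kepler_expand[of "ecc_anomaly e x" "ecc_anomaly e y"] e
    by (simp add: kepler_ecc_anomaly dist_real_def field_simps)
  then have "(1 / (1 - e))-lipschitz_on UNIV (ecc_anomaly e)"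
    using e by (intro lipschitz_onI) auto
  then show ?thesis by (rule lipschitz_on_continuous_on)
qed

end

text \<open>\<open>F x\<close> is the integral of \<open>g\<close> over the period starting at
  \<open>x\<close>; its derivative vanishes by periodicity.\<close>

lemma integral_periodic_shift:
  fixes g :: "real \<Rightarrow> real"
  assumes "continuous_on UNIV g" "\<And>x. g (x + 2 * pi) = g x"
  shows "integral {0..2 * pi} (\<lambda>x. g (x - c)) = integral {0..2 * pi} g"
proof -
  \<comment> \<open>The antiderivative is taken on a compact interval; the margins put every period
    that starts in \<open>[- |c|, |c|]\<close> into its interior.\<close>
  define A where "A = - \<bar>c\<bar> - 1"
  define B where "B = 2 * pi + \<bar>c\<bar> + 1"
  obtain H where H: "\<And>x. x \<in> {A..B} \<Longrightarrow> (H has_vector_derivative g x) (at x within {A..B})"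
    using antiderivative_continuous[of A B g] assms(1) continuous_on_subset by blast
  have H': "(H has_vector_derivative g x) (at x)" if "A < x" "x < B" for x
    using H[of x] that by (simp add: at_within_Icc_at)
  have shift: "((\<lambda>x. H (x + k)) has_vector_derivative g (x + k)) (at x)" if "A < x + k" "x + k < B" for x k
  proof -
    have "((\<lambda>x. x + k) has_vector_derivative 1) (at x)"
      by (auto intro!: derivative_eq_intros simp: has_real_derivative_iff_has_vector_derivative[symmetric])
    from vector_diff_chain_at[OF this] H'[OF that] show ?thesis by (simp add: o_def)
  qed
  have int: "((\<lambda>x. g (x + k)) has_integral H (2 * pi + k) - H k) {0..2 * pi}" if "\<bar>k\<bar> \<le> \<bar>c\<bar>" for k
  proof -
    have "((\<lambda>x. g (x + k)) has_integral H (2 * pi + k) - H (0 + k)) {0..2 * pi}"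
      using that by (intro fundamental_theorem_of_calculus has_vector_derivative_at_within[OF shift]) (auto simp: A_def B_def)
    then show ?thesis by simp
  qed
  define F where "F x = H (x + 2 * pi) - H x" for x
  have "\<exists>d. \<forall>x\<in>{- \<bar>c\<bar>..\<bar>c\<bar>}. F x = d"
  proof (rule has_vector_derivative_zero_constant[of "{- \<bar>c\<bar>..\<bar>c\<bar>}" F, rule_format])
    fix x assume "x \<in> {- \<bar>c\<bar>..\<bar>c\<bar>}"
    then have "A < x" "x < B" "A < x + 2 * pi" "x + 2 * pi < B"
      using pi_gt_zero unfolding A_def B_def atLeastAtMost_iff by linarith+
    then have "(F has_vector_derivative g (x + 2 * pi) - g x) (at x)"
      unfolding F_def by (intro has_vector_derivative_diff shift H')
    then show "(F has_vector_derivative 0) (at x within {- \<bar>c\<bar>..\<bar>c\<bar>})"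
      by (simp add: assms(2) has_vector_derivative_at_within)
  qed auto
  then have "F (- c) = F 0" by force
  moreover have "integral {0..2 * pi} (\<lambda>x. g (x - c)) = F (- c)"
    using integral_unique[OF int[of "- c"]] by (simp add: F_def add.commute)
  moreover have "integral {0..2 * pi} g = F 0"
    using integral_unique[OF int[of 0]] by (simp add: F_def)
  ultimately show ?thesis by simp
qed

text \<open>Periodicity removes the shift \<open>c\<close>; then \<open>l = v - e sin v\<close> is
  substituted, which fixes both limits because \<open>sin\<close> vanishes there.\<close>

lemma integral_ecc_anomaly:
  fixes g :: "real \<Rightarrow> real"
  assumes e: "0 \<le> e" "e < 1" and g: "continuous_on UNIV g" "\<And>x. g (x + 2 * pi) = g x"
  shows "integral {0..2 * pi} (\<lambda>l. g (ecc_anomaly e (l - c))) = integral {0..2 * pi} (\<lambda>v. (1 - e * cos v) * g v)"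
proof -
  have cg: "continuous_on UNIV (\<lambda>l. g (ecc_anomaly e l))"
    by (rule continuous_on_compose2[OF g(1) continuous_ecc_anomaly[OF e]]) simp
  have "integral {0..2 * pi} (\<lambda>l. g (ecc_anomaly e (l - c))) = integral {0..2 * pi} (\<lambda>l. g (ecc_anomaly e l))"
    by (rule integral_periodic_shift[OF cg]) (simp add: ecc_anomaly_periodic[OF e] g(2))
  also have "((\<lambda>v. (1 - e * cos v) *\<^sub>R g (ecc_anomaly e (v - e * sin v))) has_integral
      integral {0 - e * sin 0..2 * pi - e * sin (2 * pi)} (\<lambda>l. g (ecc_anomaly e l))) {0..2 * pi}"
  proof (rule has_integral_substitution[where c = "- 1" and d = "2 * pi + 1"])
    have b: "\<bar>e * sin x\<bar> \<le> 1" for x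
      using e abs_sin_le_one[of x] by (simp add: abs_mult mult_le_one)
    show "(\<lambda>v. v - e * sin v) ` {0..2 * pi} \<subseteq> {- 1..2 * pi + 1}"
    proof clarify
      fix v assume "v \<in> {0..2 * pi}"
      then show "v - e * sin v \<in> {- 1..2 * pi + 1}" using b[of v] by auto
    qed
    show "continuous_on {- 1..2 * pi + 1} (\<lambda>l. g (ecc_anomaly e l))"
      by (rule continuous_on_subset[OF cg]) simp
    show "((\<lambda>v. v - e * sin v) has_real_derivative 1 - e * cos x) (at x within {0..2 * pi})" for x
      by (auto intro!: derivative_eq_intros)
  qed auto
  then have "integral {0..2 * pi} (\<lambda>l. g (ecc_anomaly e l)) = integral {0..2 * pi} (\<lambda>v. (1 - e * cos v) * g v)"
    by (simp add: ecc_anomaly_kepler[OF e] integral_unique)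
  finally show ?thesis .
qed

section \<open>The quadrupole expansion\<close>

text \<open>With \<open>r = sqrt (1 + s)\<close>, the remainder of the Taylor polynomial of \<open>1 / r\<close> is
  \<open>(1 - r)^3 (8 + 9 r + 3 r^2) / (8 r)\<close>.\<close>

lemma inverse_sqrt_taylor:
  fixes s :: real
  assumes "\<bar>s\<bar> \<le> 1 / 2"
  shows "\<bar>1 / sqrt (1 + s) - (1 - s / 2 + 3 * s\<^sup>2 / 8)\<bar> \<le> 5 * \<bar>s\<bar> ^ 3"
proof -
  define r where "r = sqrt (1 + s)"
  have r2: "r\<^sup>2 = 1 + s" and rpos: "r > 0" using assms by (auto simp: r_def)
  \<comment> \<open>Rational bounds for \<open>sqrt (1/2)\<close> and \<open>sqrt (3/2)\<close>,
    good enough for the factor 5.\<close>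
  have r: "7 / 10 \<le> r" "r \<le> 5 / 4"
    unfolding r_def using assms
    by (intro real_le_rsqrt real_le_lsqrt; simp add: power2_eq_square abs_le_iff)+
  have s: "s = r\<^sup>2 - 1" using r2 by simp
  have "1 / r - (1 - s / 2 + 3 * s\<^sup>2 / 8) = (1 - r) ^ 3 * ((8 + 9 * r + 3 * r\<^sup>2) / (8 * r))"
    using rpos unfolding s by (simp add: field_simps eval_nat_numeral)
  then have *: "\<bar>1 / r - (1 - s / 2 + 3 * s\<^sup>2 / 8)\<bar> = \<bar>1 - r\<bar> ^ 3 * ((8 + 9 * r + 3 * r\<^sup>2) / (8 * r))"
    using rpos by (simp add: abs_mult power_abs)
  have "\<bar>1 - r\<bar> * 1 \<le> \<bar>1 - r\<bar> * (1 + r)" using rpos by (intro mult_left_mono) auto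
  also have "\<dots> = \<bar>(1 - r) * (1 + r)\<bar>" using rpos by (simp add: abs_mult)
  also have "\<dots> = \<bar>s\<bar>" unfolding s by (simp add: algebra_simps power2_eq_square abs_minus_commute)
  finally have "\<bar>1 - r\<bar> ^ 3 \<le> \<bar>s\<bar> ^ 3" by (intro power_mono) auto
  moreover have "(8 + 9 * r + 3 * r\<^sup>2) / (8 * r) \<le> 5"
  proof -
    have "r * r \<le> 5 / 4 * r" using r rpos by (intro mult_right_mono) auto
    then have "8 + 9 * r + 3 * (r * r) \<le> 5 * (8 * r)" using r by linarith
    then show ?thesis using rpos by (simp add: divide_le_eq power2_eq_square)
  qed
  ultimately have "\<bar>1 - r\<bar> ^ 3 * ((8 + 9 * r + 3 * r\<^sup>2) / (8 * r)) \<le> \<bar>s\<bar> ^ 3 * 5"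
    using rpos by (intro mult_mono) (auto intro!: divide_nonneg_pos add_nonneg_nonneg)
  then have "\<bar>1 / r - (1 - s / 2 + 3 * s\<^sup>2 / 8)\<bar> \<le> 5 * \<bar>s\<bar> ^ 3"
    by (simp only: * mult.commute)
  then show ?thesis by (simp only: r_def)
qed

text \<open>The polynomial collects the Legendre terms of degree at most 2, with
  \<open>\<beta>\<close> in the role of \<open>\<eta>\<close> times a cosine. For
  \<open>s = \<eta>^2 - 2 \<beta>\<close>, the Taylor remainder with
  \<open>|s| \<le> 3 \<eta>\<close> costs \<open>5 * 27 = 135\<close>, and the terms left over from
  \<open>3 s^2 / 8\<close> cost at most 2.\<close>

lemma legendre_estimate:
  fixes \<beta> \<eta> :: real
  assumes "\<bar>\<beta>\<bar> \<le> \<eta>" "\<eta> \<le> 1 / 6"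
  shows "\<bar>1 / sqrt (1 - 2 * \<beta> + \<eta>\<^sup>2) - (1 + \<beta> + (3 * \<beta>\<^sup>2 - \<eta>\<^sup>2) / 2)\<bar> \<le> 137 * \<eta> ^ 3"
proof -
  have \<eta>: "0 \<le> \<eta>" using assms by linarith
  define s where "s = - 2 * \<beta> + \<eta>\<^sup>2"
  have e2: "\<eta>\<^sup>2 \<le> \<eta>" using \<eta> assms(2) by (simp add: power2_eq_square mult_left_le_one_le)
  have s3: "\<bar>s\<bar> \<le> 3 * \<eta>" unfolding s_def using assms(1) e2 zero_le_power2[of \<eta>] by linarith
  then have "\<bar>s\<bar> ^ 3 \<le> (3 * \<eta>) ^ 3" by (intro power_mono) auto
  then have 1: "5 * \<bar>s\<bar> ^ 3 \<le> 135 * \<eta> ^ 3" by (simp add: power_mult_distrib)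
  have eq: "1 - s / 2 + 3 * s\<^sup>2 / 8 - (1 + \<beta> + (3 * \<beta>\<^sup>2 - \<eta>\<^sup>2) / 2) = 3 / 8 * (\<eta> ^ 4 - 4 * \<beta> * \<eta>\<^sup>2)"
    unfolding s_def by (simp add: power2_eq_square eval_nat_numeral field_simps)
  have Y: "\<bar>\<eta> ^ 4 - 4 * \<beta> * \<eta>\<^sup>2\<bar> \<le> 5 * \<eta> ^ 3"
  proof -
    have "\<eta> ^ 4 \<le> \<eta> ^ 3" using \<eta> assms(2) by (intro power_decreasing) auto
    moreover have "\<bar>\<beta>\<bar> * \<eta>\<^sup>2 \<le> \<eta> * \<eta>\<^sup>2" using assms(1) by (intro mult_right_mono) auto
    then have "\<bar>\<beta> * \<eta>\<^sup>2\<bar> \<le> \<eta> ^ 3" by (simp add: abs_mult eval_nat_numeral)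
    moreover have "0 \<le> \<eta> ^ 4" by simp
    ultimately show ?thesis by linarith
  qed
  have 2: "\<bar>1 - s / 2 + 3 * s\<^sup>2 / 8 - (1 + \<beta> + (3 * \<beta>\<^sup>2 - \<eta>\<^sup>2) / 2)\<bar> \<le> 2 * \<eta> ^ 3"
  proof -
    have "\<bar>3 / 8 * (\<eta> ^ 4 - 4 * \<beta> * \<eta>\<^sup>2)\<bar> = 3 / 8 * \<bar>\<eta> ^ 4 - 4 * \<beta> * \<eta>\<^sup>2\<bar>"
      unfolding abs_mult by simp
    also have "\<dots> \<le> 3 / 8 * (5 * \<eta> ^ 3)" by (intro mult_left_mono Y) auto
    also have "\<dots> \<le> 2 * \<eta> ^ 3" using zero_le_power[OF \<eta>, of 3] by simp
    finally show ?thesis unfolding eq .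
  qed
  have "\<bar>s\<bar> \<le> 1 / 2" using s3 assms(2) by linarith
  from inverse_sqrt_taylor[OF this] 1 2 show ?thesis
    unfolding s_def by (simp add: algebra_simps)
qed

text \<open>Twice the term of degree 2 in \<open>x\<close> in the expansion of
  \<open>1 / |y - x|\<close>.\<close>

definition quad_kernel :: "vec \<Rightarrow> vec \<Rightarrow> real" where
  "quad_kernel x y = 3 * (x \<bullet> y)\<^sup>2 / norm y ^ 5 - (norm x)\<^sup>2 / norm y ^ 3"

lemma newton_expand:
  fixes x y :: vec
  assumes "y \<noteq> 0" "\<bar>t\<bar> * norm x / norm y \<le> 1 / 6"
  shows "\<bar>1 / norm (y - t *\<^sub>R x) - (1 / norm y + t * (x \<bullet> y) / norm y ^ 3 + t\<^sup>2 / 2 * quad_kernel x y)\<bar>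
    \<le> 137 * (\<bar>t\<bar> * norm x / norm y) ^ 3 / norm y"
proof -
  define \<eta> where "\<eta> = \<bar>t\<bar> * norm x / norm y"
  define \<beta> where "\<beta> = t * (x \<bullet> y) / (norm y)\<^sup>2"
  have y: "norm y > 0" using assms by simp
  have "\<bar>t * (x \<bullet> y)\<bar> \<le> \<bar>t\<bar> * (norm x * norm y)"
    unfolding abs_mult by (intro mult_left_mono Cauchy_Schwarz_ineq2) auto
  then have b: "\<bar>\<beta>\<bar> \<le> \<eta>"
    using y by (simp add: \<beta>_def \<eta>_def field_simps power2_eq_square)
  have "(norm (y - t *\<^sub>R x))\<^sup>2 = (norm y)\<^sup>2 * (1 - 2 * \<beta> + \<eta>\<^sup>2)"
    using y unfolding power2_norm_eq_inner \<beta>_def \<eta>_def power_mult_distrib power_divide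
    by (simp add: power2_norm_eq_inner inner_diff_left inner_diff_right inner_commute field_simps power2_eq_square)
  then have "norm (y - t *\<^sub>R x) = norm y * sqrt (1 - 2 * \<beta> + \<eta>\<^sup>2)"
    by (metis real_sqrt_abs abs_norm_cancel real_sqrt_mult)
  then have n: "1 / norm (y - t *\<^sub>R x) = (1 / norm y) * (1 / sqrt (1 - 2 * \<beta> + \<eta>\<^sup>2))" by simp
  have p: "1 / norm y + t * (x \<bullet> y) / norm y ^ 3 + t\<^sup>2 / 2 * quad_kernel x y
      = (1 / norm y) * (1 + \<beta> + (3 * \<beta>\<^sup>2 - \<eta>\<^sup>2) / 2)"
    using y by (simp add: quad_kernel_def \<beta>_def \<eta>_def power_mult_distrib power_divide field_simps eval_nat_numeral)
  have "\<bar>(1 / norm y) * (1 / sqrt (1 - 2 * \<beta> + \<eta>\<^sup>2) - (1 + \<beta> + (3 * \<beta>\<^sup>2 - \<eta>\<^sup>2) / 2))\<bar> \<le> (1 / norm y) * (137 * \<eta> ^ 3)"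
    unfolding abs_mult using legendre_estimate[OF b] assms(2) y
    by (intro mult_mono) (auto simp: \<eta>_def)
  then show ?thesis unfolding n p by (simp add: right_diff_distrib \<eta>_def)
qed

text \<open>The terms linear in \<open>x\<close> of the two summands of \<open>Fpert\<close> cancel.\<close>

lemma Fpert_expand:
  assumes m: "m0 > 0" "m1 > 0" "m2 > 0" and \<Lambda>: "\<Lambda> > 0" and d: "d > 0" "norm y \<ge> d" and \<rho>: "norm x \<le> \<rho>"
    and small: "\<rho> / (\<Lambda> * d) \<le> 1 / 6"
  shows "\<bar>Fpert m0 m1 m2 x (\<Lambda> *\<^sub>R y) - (- mu1 m0 m1 * m2 / 2 * quad_kernel x y) / \<Lambda> ^ 3\<bar>
    \<le> mu1 m0 m1 * m2 * 274 * \<rho> ^ 3 / d ^ 4 / \<Lambda> ^ 4"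
proof -
  define s0 where "s0 = 1 / (1 + m1 / m0)"
  define s1 where "s1 = 1 / (1 + m0 / m1)"
  have s: "0 < s0" "s0 \<le> 1" "0 < s1" "s1 \<le> 1" "s0 + s1 = 1"
  proof -
    have *: "s0 = m0 / (m0 + m1)" "s1 = m1 / (m0 + m1)"
      using m by (simp_all add: s0_def s1_def field_simps)
    show "0 < s0" "s0 \<le> 1" "0 < s1" "s1 \<le> 1" "s0 + s1 = 1"
      using m by (simp_all add: * add_divide_distrib[symmetric])
  qed
  have y: "norm y > 0" "y \<noteq> 0" using d by auto
  have \<rho>0: "\<rho> \<ge> 0" using \<rho> norm_ge_zero[of x] by linarith
  define N where "N = 1 / norm y"
  define D where "D = (x \<bullet> y) / norm y ^ 3"
  define W where "W = quad_kernel x y"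
  define E where "E = 137 * \<rho> ^ 3 / d ^ 4 / \<Lambda> ^ 3"
  have one: "\<bar>1 / norm (\<Lambda> *\<^sub>R y - \<tau> *\<^sub>R x) - (1 / \<Lambda>) * (N + (\<tau> / \<Lambda>) * D + (\<tau> / \<Lambda>)\<^sup>2 / 2 * W)\<bar> \<le> \<bar>\<tau>\<bar> * E / \<Lambda>"
    if \<tau>: "\<bar>\<tau>\<bar> \<le> 1" for \<tau>
  proof -
    have le: "\<bar>\<tau> / \<Lambda>\<bar> * norm x / norm y \<le> \<bar>\<tau>\<bar> * (\<rho> / (\<Lambda> * d))"
    proof -
      have "norm x / norm y \<le> \<rho> / d" using \<rho> d \<rho>0 y by (intro frac_le) auto
      then have "(\<bar>\<tau>\<bar> / \<Lambda>) * (norm x / norm y) \<le> (\<bar>\<tau>\<bar> / \<Lambda>) * (\<rho> / d)" using \<Lambda> by (intro mult_left_mono) auto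
      then show ?thesis using \<Lambda> by simp
    qed
    also have le1: "\<dots> \<le> 1 * (1 / 6)" using \<tau> small \<Lambda> d \<rho>0 by (intro mult_mono) auto
    finally have "\<bar>1 / norm (y - (\<tau> / \<Lambda>) *\<^sub>R x) - (N + (\<tau> / \<Lambda>) * D + (\<tau> / \<Lambda>)\<^sup>2 / 2 * W)\<bar>
        \<le> 137 * (\<bar>\<tau> / \<Lambda>\<bar> * norm x / norm y) ^ 3 / norm y"
      using newton_expand[OF y(2), of "\<tau> / \<Lambda>" x] by (simp add: N_def D_def W_def)
    also have "\<dots> \<le> 137 * (\<bar>\<tau>\<bar> * (\<rho> / (\<Lambda> * d))) ^ 3 / d"
    proof -
      have "0 \<le> \<bar>\<tau>\<bar> * (\<rho> / (\<Lambda> * d))" using \<rho>0 d \<Lambda> by simp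
      moreover have "(\<bar>\<tau> / \<Lambda>\<bar> * norm x / norm y) ^ 3 \<le> (\<bar>\<tau>\<bar> * (\<rho> / (\<Lambda> * d))) ^ 3"
        using le y by (intro power_mono) auto
      ultimately show ?thesis using d zero_le_power by (intro frac_le mult_left_mono) auto
    qed
    also have "\<dots> = \<bar>\<tau>\<bar> ^ 3 * E"
      using d \<Lambda> by (simp add: E_def power_mult_distrib power_divide field_simps eval_nat_numeral)
    \<comment> \<open>One factor \<open>|\<tau>|\<close> is retained, since the remainders get
      divided by \<open>s0\<close> and \<open>s1\<close> in \<open>Fpert\<close>.\<close>
    also have "\<dots> \<le> \<bar>\<tau>\<bar> * E"
    proof -
      have "\<bar>\<tau>\<bar> ^ 3 \<le> \<bar>\<tau>\<bar> ^ 1" using \<tau> by (intro power_decreasing) auto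
      then show ?thesis using d \<Lambda> \<rho>0 by (intro mult_right_mono) (auto simp: E_def)
    qed
    finally have *: "\<bar>1 / norm (y - (\<tau> / \<Lambda>) *\<^sub>R x) - (N + (\<tau> / \<Lambda>) * D + (\<tau> / \<Lambda>)\<^sup>2 / 2 * W)\<bar> \<le> \<bar>\<tau>\<bar> * E" .
    have "\<Lambda> *\<^sub>R y - \<tau> *\<^sub>R x = \<Lambda> *\<^sub>R (y - (\<tau> / \<Lambda>) *\<^sub>R x)" using \<Lambda> by (simp add: scaleR_diff_right)
    then have "1 / norm (\<Lambda> *\<^sub>R y - \<tau> *\<^sub>R x) = (1 / \<Lambda>) * (1 / norm (y - (\<tau> / \<Lambda>) *\<^sub>R x))" using \<Lambda> by simp
    then have "\<bar>1 / norm (\<Lambda> *\<^sub>R y - \<tau> *\<^sub>R x) - (1 / \<Lambda>) * (N + (\<tau> / \<Lambda>) * D + (\<tau> / \<Lambda>)\<^sup>2 / 2 * W)\<bar> =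
        (1 / \<Lambda>) * \<bar>1 / norm (y - (\<tau> / \<Lambda>) *\<^sub>R x) - (N + (\<tau> / \<Lambda>) * D + (\<tau> / \<Lambda>)\<^sup>2 / 2 * W)\<bar>"
      using \<Lambda> by (simp only: right_diff_distrib[symmetric] abs_mult) simp
    also have "\<dots> \<le> (1 / \<Lambda>) * (\<bar>\<tau>\<bar> * E)" using * \<Lambda> by (intro mult_left_mono) auto
    finally show ?thesis by simp
  qed
  define R0 where "R0 = 1 / norm (\<Lambda> *\<^sub>R y - s0 *\<^sub>R x) - (1 / \<Lambda>) * (N + (s0 / \<Lambda>) * D + (s0 / \<Lambda>)\<^sup>2 / 2 * W)"
  define R1 where "R1 = 1 / norm (\<Lambda> *\<^sub>R y + s1 *\<^sub>R x) - (1 / \<Lambda>) * (N - (s1 / \<Lambda>) * D + (s1 / \<Lambda>)\<^sup>2 / 2 * W)"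
  have R: "\<bar>R0\<bar> \<le> s0 * E / \<Lambda>" "\<bar>R1\<bar> \<le> s1 * E / \<Lambda>"
    using one[of s0] one[of "- s1"] s by (simp_all add: R0_def R1_def)
  have "1 / norm (\<Lambda> *\<^sub>R y) = (1 / \<Lambda>) * N" using \<Lambda> by (simp add: N_def)
  then have F: "Fpert m0 m1 m2 x (\<Lambda> *\<^sub>R y) = - mu1 m0 m1 * m2 *
      (1 / s0 * (R0 + (1 / \<Lambda>) * ((s0 / \<Lambda>) * D + (s0 / \<Lambda>)\<^sup>2 / 2 * W)) +
       1 / s1 * (R1 + (1 / \<Lambda>) * (- (s1 / \<Lambda>) * D + (s1 / \<Lambda>)\<^sup>2 / 2 * W)))"
    unfolding Fpert_def Let_def s0_def[symmetric] s1_def[symmetric] by (simp add: R0_def R1_def algebra_simps)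
  have AB: "1 / s0 * (R0 + (1 / \<Lambda>) * ((s0 / \<Lambda>) * D + (s0 / \<Lambda>)\<^sup>2 / 2 * W)) = R0 / s0 + D / \<Lambda>\<^sup>2 + s0 * W / (2 * \<Lambda> ^ 3)"
      "1 / s1 * (R1 + (1 / \<Lambda>) * (- (s1 / \<Lambda>) * D + (s1 / \<Lambda>)\<^sup>2 / 2 * W)) = R1 / s1 - D / \<Lambda>\<^sup>2 + s1 * W / (2 * \<Lambda> ^ 3)"
    using s \<Lambda> by (simp_all add: field_simps eval_nat_numeral)
  have C: "s0 * W / (2 * \<Lambda> ^ 3) + s1 * W / (2 * \<Lambda> ^ 3) = W / (2 * \<Lambda> ^ 3)"
    using s(5) by (metis add_divide_distrib distrib_right mult_1)
  have "Fpert m0 m1 m2 x (\<Lambda> *\<^sub>R y) = - mu1 m0 m1 * m2 * (R0 / s0 + R1 / s1 + W / (2 * \<Lambda> ^ 3))"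
    unfolding F AB C[symmetric] by simp
  then have "Fpert m0 m1 m2 x (\<Lambda> *\<^sub>R y) - (- mu1 m0 m1 * m2 / 2 * W) / \<Lambda> ^ 3 = - (mu1 m0 m1 * m2) * (R0 / s0 + R1 / s1)"
    using \<Lambda> by (simp add: field_simps)
  then have "\<bar>Fpert m0 m1 m2 x (\<Lambda> *\<^sub>R y) - (- mu1 m0 m1 * m2 / 2 * W) / \<Lambda> ^ 3\<bar> = mu1 m0 m1 * m2 * \<bar>R0 / s0 + R1 / s1\<bar>"
    using m by (simp add: abs_mult mu1_def)
  also have "\<dots> \<le> mu1 m0 m1 * m2 * (E / \<Lambda> + E / \<Lambda>)"
  proof -
    have "\<bar>R0 / s0\<bar> \<le> E / \<Lambda>" "\<bar>R1 / s1\<bar> \<le> E / \<Lambda>"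
      using R s \<Lambda> by (simp_all add: field_simps)
    then have "\<bar>R0 / s0 + R1 / s1\<bar> \<le> E / \<Lambda> + E / \<Lambda>" by linarith
    then show ?thesis using m by (intro mult_left_mono) (auto simp: mu1_def)
  qed
  also have "\<dots> = mu1 m0 m1 * m2 * 274 * \<rho> ^ 3 / d ^ 4 / \<Lambda> ^ 4"
    using \<Lambda> d by (simp add: E_def field_simps eval_nat_numeral)
  finally show ?thesis by (simp add: W_def)
qed

section \<open>Radius and radial momentum along an ellipse\<close>

lemma ell_frame:
  assumes "e \<bullet> j = 0" "(norm e)\<^sup>2 + (norm j)\<^sup>2 = 1" "e \<noteq> 0"
  shows "sgn e \<bullet> sgn e = 1" "sgn e \<bullet> cross3 j (sgn e) = 0"
    "cross3 j (sgn e) \<bullet> cross3 j (sgn e) = 1 - (norm e)\<^sup>2"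
proof -
  show 1: "sgn e \<bullet> sgn e = 1" using assms(3) by (simp add: norm_eq_1[symmetric] norm_sgn)
  show "sgn e \<bullet> cross3 j (sgn e) = 0" by (simp add: dot_cross_self)
  have "j \<bullet> sgn e = 0" using assms(1) by (simp add: sgn_div_norm inner_commute)
  then show "cross3 j (sgn e) \<bullet> cross3 j (sgn e) = 1 - (norm e)\<^sup>2"
    using assms(2) 1 norm_cross[of j "sgn e"] by (simp flip: power2_norm_eq_inner)
qed

lemma inner_combination:
  fixes p q :: "'a::real_inner"
  shows "(A *\<^sub>R p + B *\<^sub>R q) \<bullet> (C *\<^sub>R p + D *\<^sub>R q) = A * C * (p \<bullet> p) + B * D * (q \<bullet> q) + (A * D + B * C) * (p \<bullet> q)"
  by (simp add: inner_add_left inner_add_right inner_commute[of q p] algebra_simps)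

lemma ecc_le_1: "(norm e)\<^sup>2 + (norm j)\<^sup>2 = 1 \<Longrightarrow> norm e \<le> 1" for e j :: vec
  using power2_le_imp_le[of "norm e" 1] zero_le_power2[of "norm j"] by simp

lemma ecc_lt_1:
  fixes e j :: vec
  assumes "(norm e)\<^sup>2 + (norm j)\<^sup>2 = 1" "j \<noteq> 0"
  shows "norm e < 1"
proof -
  have "0 < (norm j)\<^sup>2" using assms(2) by simp
  then have "(norm e)\<^sup>2 < 1\<^sup>2" using assms(1) unfolding one_power2 by linarith
  then show ?thesis by (rule power2_less_imp_less) simp
qed

lemma norm_ell_pos:
  assumes "e \<bullet> j = 0" "(norm e)\<^sup>2 + (norm j)\<^sup>2 = 1" "e \<noteq> 0" "a \<ge> 0"
  shows "norm (ell_pos a e j u) = a * (1 - norm e * cos u)"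
proof (rule power2_eq_imp_eq)
  note f = ell_frame[OF assms(1-3)]
  have "(norm (ell_pos a e j u))\<^sup>2 = a\<^sup>2 * ((cos u - norm e)\<^sup>2 + (sin u)\<^sup>2 * (1 - (norm e)\<^sup>2))"
    unfolding power2_norm_eq_inner ell_pos_def inner_combination f by (simp add: power2_norm_eq_inner[symmetric] power2_eq_square distrib_left mult_ac)
  also have "(cos u - norm e)\<^sup>2 + (sin u)\<^sup>2 * (1 - (norm e)\<^sup>2) = (1 - norm e * cos u)\<^sup>2"
    unfolding sin_squared_eq by (simp add: power2_eq_square algebra_simps)
  finally show "(norm (ell_pos a e j u))\<^sup>2 = (a * (1 - norm e * cos u))\<^sup>2" by (simp add: power_mult_distrib)
  have "norm e * \<bar>cos u\<bar> \<le> 1 * 1" by (intro mult_mono ecc_le_1[OF assms(2)]) auto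
  moreover have "norm e * cos u \<le> norm e * \<bar>cos u\<bar>" by (intro mult_left_mono) auto
  ultimately have "norm e * cos u \<le> 1" by linarith
  then show "0 \<le> a * (1 - norm e * cos u)" using assms(4) by simp
qed simp

text \<open>The denominator of \<open>ell_mom\<close> cancels. Hence the shift between
  \<open>l2'\<close> and \<open>l2\<close> is a constant times \<open>sin u\<close>, continuous even
  through collisions.\<close>

lemma ell_mom_inner_pos:
  assumes "e \<bullet> j = 0" "(norm e)\<^sup>2 + (norm j)\<^sup>2 = 1" "e \<noteq> 0"
  shows "ell_mom \<mu> M a e j u \<bullet> ell_pos a e j u = \<mu> * sqrt (M / a ^ 3) * a\<^sup>2 * (norm e * sin u)"
proof -
  note f = ell_frame[OF assms]
  let ?k = "\<mu> * sqrt (M / a ^ 3)"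
  have *: "ell_mom \<mu> M a e j u \<bullet> ell_pos a e j u = ?k / (1 - norm e * cos u) *
      (- (a * sin u) * (a * (cos u - norm e)) + (a * cos u) * (a * sin u) * (1 - (norm e)\<^sup>2))"
    unfolding ell_mom_def ell_pos_def inner_scaleR_left inner_combination f by simp
  have "- (a * sin u) * (a * (cos u - norm e)) + (a * cos u) * (a * sin u) * (1 - (norm e)\<^sup>2)
      = a\<^sup>2 * (norm e * sin u) * (1 - norm e * cos u)"
    by (simp add: power2_eq_square algebra_simps)
  then have **: "ell_mom \<mu> M a e j u \<bullet> ell_pos a e j u =
      ?k / (1 - norm e * cos u) * (a\<^sup>2 * (norm e * sin u) * (1 - norm e * cos u))"
    unfolding * by simp
  show ?thesis
  proof (cases "1 - norm e * cos u = 0")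
    \<comment> \<open>This happens only at a collision on a degenerate ellipse. There
      \<open>ell_mom\<close> is 0 by division by zero, and \<open>|cos u| = 1\<close> makes the
      right side vanish too.\<close>
    case True
    have "1 \<le> \<bar>cos u\<bar>"
    proof -
      have "1 = norm e * cos u" using True by simp
      also have "\<dots> \<le> norm e * \<bar>cos u\<bar>" by (intro mult_left_mono) auto
      also have "\<dots> \<le> 1 * \<bar>cos u\<bar>" by (intro mult_right_mono ecc_le_1[OF assms(2)]) auto
      finally show ?thesis by simp
    qed
    then have "\<bar>cos u\<bar> = 1" using abs_cos_le_one[of u] by linarith
    then have "(cos u)\<^sup>2 = 1" by (metis power2_abs one_power2)
    then have "sin u = 0" using sin_squared_eq[of u] by simp
    then show ?thesis unfolding ** by simp
  qed (simp add: **)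
qed

lemma continuous_on_ell_pos [continuous_intros]:
  fixes S :: "'a::t2_space set"
  assumes "continuous_on S e" "continuous_on S j" "continuous_on S u" "\<And>x. x \<in> S \<Longrightarrow> e x \<noteq> 0"
  shows "continuous_on S (\<lambda>x. ell_pos a (e x) (j x) (u x))"
  unfolding ell_pos_def using assms
  by (intro continuous_intros continuous_on_cross) auto

lemma continuous_on_quad_kernel [continuous_intros]:
  assumes "continuous_on S f" "continuous_on S g" "\<And>x. x \<in> S \<Longrightarrow> g x \<noteq> 0"
  shows "continuous_on S (\<lambda>x. quad_kernel (f x) (g x))"
  unfolding quad_kernel_def using assms by (intro continuous_intros) auto

lemma continuous_on_Fpert:
  assumes m: "m0 > 0" "m1 > 0" and c: "continuous_on S f" "continuous_on S g"
    and n: "\<And>x. x \<in> S \<Longrightarrow> norm (f x) < norm (g x)"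
  shows "continuous_on S (\<lambda>x. Fpert m0 m1 m2 (f x) (g x))"
proof -
  have nz: "g x - \<tau> *\<^sub>R f x \<noteq> 0" if "x \<in> S" "\<bar>\<tau>\<bar> \<le> 1" for x \<tau>
  proof
    assume "g x - \<tau> *\<^sub>R f x = 0"
    then have "norm (g x) = \<bar>\<tau>\<bar> * norm (f x)" by simp
    also have "\<dots> \<le> norm (f x)" using that(2) by (simp add: mult_left_le_one_le)
    finally show False using n[OF that(1)] by simp
  qed
  have s: "\<bar>1 / (1 + m1 / m0)\<bar> \<le> 1" "\<bar>1 / (1 + m0 / m1)\<bar> \<le> 1" "\<bar>- (1 / (1 + m0 / m1))\<bar> \<le> 1"
    using m by (simp_all add: field_simps)
  have "g x \<noteq> 0" if "x \<in> S" for x using n[OF that] by auto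
  moreover have "g x + (1 / (1 + m0 / m1)) *\<^sub>R f x \<noteq> 0" if "x \<in> S" for x
    using nz[OF that s(3)] by simp
  ultimately show ?thesis
    unfolding Fpert_def Let_def using c nz[OF _ s(1)]
    by (intro continuous_intros) auto
qed

definition good_shapes :: "shape set" where
  "good_shapes = {(e1, j1, e2, j2). e1 \<bullet> j1 = 0 \<and> (norm e1)\<^sup>2 + (norm j1)\<^sup>2 = 1 \<and>
      e2 \<bullet> j2 = 0 \<and> (norm e2)\<^sup>2 + (norm j2)\<^sup>2 = 1 \<and> noncirc (e1, j1, e2, j2)}"

text \<open>Up to \<open>4 pi^2\<close>, the average of the quadrupole kernel over the mean
  anomalies. The two weights are the Jacobians of the change to eccentric anomalies, which keeps the
  integrand continuous at \<open>j1 = 0\<close>. The outer ellipse is scaled to semi major axis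
  1.\<close>

definition quad_avg :: "real \<Rightarrow> shape \<Rightarrow> real" where
  "quad_avg a s = integral (cbox (0, 0) (2 * pi, 2 * pi)) (\<lambda>t.
     (1 - norm (fst s) * cos (fst t)) * ((1 - norm (fst (snd (snd s))) * cos (snd t)) *
       quad_kernel (ell_pos a (fst s) (fst (snd s)) (fst t)) (ell_pos 1 (fst (snd (snd s))) (snd (snd (snd s))) (snd t))))"

lemma ell_pos_scale: "ell_pos (c * a) e j u = c *\<^sub>R ell_pos a e j u"
  by (simp add: ell_pos_def scaleR_add_right mult.assoc)

lemma ell_pos_periodic: "ell_pos a e j (u + 2 * pi) = ell_pos a e j u"
  by (simp add: ell_pos_def)

locale shape_data =
  fixes m0 m1 m2 a1 :: real and e1 j1 e2 j2 :: vec
  assumes m: "m0 > 0" "m1 > 0" "m2 > 0" and a1: "a1 > 0"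
    and 1: "e1 \<bullet> j1 = 0" "(norm e1)\<^sup>2 + (norm j1)\<^sup>2 = 1" "e1 \<noteq> 0"
    and 2: "e2 \<bullet> j2 = 0" "(norm e2)\<^sup>2 + (norm j2)\<^sup>2 = 1" "e2 \<noteq> 0" "j2 \<noteq> 0"
begin

abbreviation "X \<equiv> ell_pos a1 e1 j1"
abbreviation "Y \<equiv> ell_pos 1 e2 j2"

text \<open>The inner of two iterated integrals, that is, the one over the outer ellipse.\<close>

definition inner_avg :: "real \<Rightarrow> real \<Rightarrow> real" where
  "inner_avg \<alpha> \<delta> = integral {0..2 * pi} (\<lambda>v. (1 - norm e2 * cos v) * Fpert m0 m1 m2 (X \<delta>) ((a1 / \<alpha>) *\<^sub>R Y v))"

text \<open>The form that both \<open>Fsec\<close> and \<open>FFsec\<close> take for small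
  \<open>\<alpha>\<close>, up to constant factors.\<close>

definition secular :: "real \<Rightarrow> real" where
  "secular \<alpha> = integral {0..2 * pi} (\<lambda>\<delta>. (1 - norm e1 * cos \<delta>) * inner_avg \<alpha> \<delta>)"

lemma e2: "0 < norm e2" "norm e2 < 1"
  using 2 ecc_lt_1[OF 2(2,4)] by auto

lemma weight: "norm e * cos u \<le> norm e" "- norm e \<le> norm e * cos u" for e :: vec
  using mult_left_mono[OF cos_le_one[of u], of "norm e"] mult_left_mono[OF cos_ge_minus_one[of u], of "norm e"] by auto

lemma norm_X: "norm (X u) = a1 * (1 - norm e1 * cos u)" "norm (X u) \<le> 2 * a1"
proof -
  show *: "norm (X u) = a1 * (1 - norm e1 * cos u)" using norm_ell_pos[OF 1] a1 by simp
  have "1 - norm e1 * cos u \<le> 2" using weight(2)[of e1 u] ecc_le_1[OF 1(2)] by linarith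
  then show "norm (X u) \<le> 2 * a1" unfolding * using a1 by simp
qed

lemma norm_Y: "norm (Y v) = 1 - norm e2 * cos v" "norm (Y v) \<ge> 1 - norm e2" "Y v \<noteq> 0"
proof -
  show *: "norm (Y v) = 1 - norm e2 * cos v" using norm_ell_pos[OF 2(1-3), of 1] by simp
  show **: "norm (Y v) \<ge> 1 - norm e2" unfolding * using weight(1)[of e2 v] by linarith
  show "Y v \<noteq> 0" using ** e2 by auto
qed

context
  fixes \<alpha> :: real
  assumes \<alpha>: "0 < \<alpha>" "\<alpha> \<le> (1 - norm e2) / 12"
begin

text \<open>Explains the 12 in the bound on \<open>\<alpha>\<close>: the inner radius is at most
  \<open>2 a1\<close>, the outer one at least \<open>(1 - |e2|) a1 / \<alpha>\<close>, and the
  expansion wants a ratio of at most \<open>1 / 6\<close>.\<close>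

lemma small: "2 * a1 / (a1 / \<alpha> * (1 - norm e2)) \<le> 1 / 6"
proof -
  have "2 * a1 / (a1 / \<alpha> * (1 - norm e2)) = 2 * \<alpha> / (1 - norm e2)" using a1 by simp
  also have "\<dots> \<le> 1 / 6" using \<alpha> e2 by (simp add: field_simps)
  finally show ?thesis .
qed

lemma separated: "norm (X u) < norm ((a1 / \<alpha>) *\<^sub>R Y v)"
proof -
  have "12 * a1 = (a1 / \<alpha>) * (12 * \<alpha>)" using \<alpha>(1) by simp
  also have "\<dots> \<le> (a1 / \<alpha>) * (1 - norm e2)" using \<alpha> a1 by (intro mult_left_mono) auto
  also have "\<dots> \<le> (a1 / \<alpha>) * norm (Y v)" using norm_Y(2) \<alpha> a1 by (intro mult_left_mono) auto
  finally show ?thesis using norm_X(2)[of u] \<alpha> a1 by simp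
qed

lemma continuous_Fpert_orbit:
  fixes S :: "'s::t2_space set"
  assumes "continuous_on S f" "continuous_on S g"
  shows "continuous_on S (\<lambda>t. Fpert m0 m1 m2 (X (f t)) ((a1 / \<alpha>) *\<^sub>R Y (g t)))"
  using assms 1(3) 2(3)
  by (intro continuous_on_Fpert m separated continuous_intros) auto

lemma inner_avg_eq:
  "integral {0..2 * pi} (\<lambda>l. Fpert m0 m1 m2 (X \<delta>) ((a1 / \<alpha>) *\<^sub>R Y (ecc_anomaly (norm e2) (l - c)))) = inner_avg \<alpha> \<delta>"
  unfolding inner_avg_def
  by (rule integral_ecc_anomaly) (use e2 in \<open>auto simp: ell_pos_periodic intro!: continuous_Fpert_orbit continuous_intros\<close>)

lemma continuous_inner_avg: "continuous_on UNIV (inner_avg \<alpha>)"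
proof -
  have "continuous_on (UNIV \<times> cbox 0 (2 * pi)) (\<lambda>(\<delta>, v). (1 - norm e2 * cos v) * Fpert m0 m1 m2 (X \<delta>) ((a1 / \<alpha>) *\<^sub>R Y v))"
    unfolding split_beta by (intro continuous_intros continuous_Fpert_orbit)
  from integral_continuous_on_param[OF this] show ?thesis
    by (simp add: inner_avg_def[abs_def])
qed

text \<open>For fixed \<open>\<delta>1\<close> the passage from \<open>l2'\<close> to
  \<open>l2\<close> is a translation by \<open>\<psi>\<close>, invisible to an integral over a full
  period; hence the integral over \<open>l2'\<close> is done first. The inner weight is supplied by
  the factor \<open>norm Q1\<close>.\<close>

lemma FFsec_secular: "FFsec m0 m1 m2 f a1 (e1, j1, e2, j2) \<alpha> = a1 / (4 * pi\<^sup>2) * secular \<alpha>"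
proof -
  define \<mu> where "\<mu> = mu1 m0 m1"
  define M where "M = Mass1 m0 m1"
  define L2 where "L2 = circ_L (mu2 m0 m1 m2) (Mass2 m0 m1 m2) (a1 / \<alpha>)"
  define \<phi> where "\<phi> = f1 m0 m1 m2 f L2"
  define \<phi>' where "\<phi>' = deriv (f1 m0 m1 m2 f) L2"
  define C where "C = \<phi>' / (2 * \<phi>) * ((1 / resc \<mu> M \<phi> a1) * (\<mu> * sqrt (M / a1 ^ 3) * a1\<^sup>2))"
  define \<psi> where "\<psi> \<delta> = C * (norm e1 * sin \<delta>)" for \<delta>
  let ?G = "\<lambda>\<delta> l. norm (X \<delta>) * Fpert m0 m1 m2 (X \<delta>) ((a1 / \<alpha>) *\<^sub>R Y (ecc_anomaly (norm e2) (l - \<psi> \<delta>)))"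
  have shift: "\<phi>' / (2 * \<phi>) * (((1 / resc \<mu> M \<phi> a1) *\<^sub>R ell_mom \<mu> M a1 e1 j1 \<delta>) \<bullet> X \<delta>) = \<psi> \<delta>" for \<delta>
    by (simp add: ell_mom_inner_pos[OF 1] \<psi>_def C_def)
  have Yscale: "ell_pos (a1 / \<alpha>) e2 j2 v = (a1 / \<alpha>) *\<^sub>R Y v" for v
    using ell_pos_scale[of "a1 / \<alpha>" 1 e2 j2 v] by simp
  have "FFsec m0 m1 m2 f a1 (e1, j1, e2, j2) \<alpha> =
      1 / (4 * pi\<^sup>2) * integral (cbox (0, 0) (2 * pi, 2 * pi)) (\<lambda>(\<delta>, l). ?G \<delta> l)"
    unfolding FFsec_def Let_def prod.case \<mu>_def[symmetric] M_def[symmetric] L2_def[symmetric] \<phi>_def[symmetric]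
      \<phi>'_def[symmetric] shift Yscale ..
  also have "integral (cbox (0, 0) (2 * pi, 2 * pi)) (\<lambda>(\<delta>, l). ?G \<delta> l) =
      integral (cbox 0 (2 * pi)) (\<lambda>\<delta>. integral (cbox 0 (2 * pi)) (\<lambda>l. ?G \<delta> l))"
  proof (subst integral_prod_continuous)
    have "continuous_on UNIV (\<lambda>t :: real \<times> real. ecc_anomaly (norm e2) (snd t - \<psi> (fst t)))"
      unfolding \<psi>_def
      by (rule continuous_on_compose2[OF continuous_ecc_anomaly]) (use e2 in \<open>auto intro!: continuous_intros\<close>)
    then have "continuous_on (cbox (0, 0) (2 * pi, 2 * pi)) (\<lambda>t :: real \<times> real. ecc_anomaly (norm e2) (snd t - \<psi> (fst t)))"
      by (rule continuous_on_subset) simp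
    then show "continuous_on (cbox (0, 0) (2 * pi, 2 * pi)) (\<lambda>(\<delta>, l). ?G \<delta> l)"
      unfolding split_beta using 1(3) by (intro continuous_intros continuous_Fpert_orbit) auto
  qed simp
  also have "\<dots> = integral (cbox 0 (2 * pi)) (\<lambda>\<delta>. a1 * ((1 - norm e1 * cos \<delta>) * inner_avg \<alpha> \<delta>))"
    by (simp add: inner_avg_eq norm_X(1) mult.assoc)
  also have "\<dots> = a1 * secular \<alpha>" by (simp add: secular_def)
  finally show ?thesis by simp
qed

text \<open>Here the inner weight arises from Kepler's equation; \<open>j1 \<noteq> 0\<close> puts
  the eccentricity below 1, as \<open>integral_ecc_anomaly\<close> demands.\<close>

lemma Fsec_secular:
  assumes "j1 \<noteq> 0"
  shows "Fsec m0 m1 m2 a1 (e1, j1, e2, j2) \<alpha> = 1 / (4 * pi\<^sup>2) * secular \<alpha>"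
proof -
  have e1: "0 \<le> norm e1" "norm e1 < 1" using ecc_lt_1[OF 1(2) assms] by auto
  let ?G = "\<lambda>l1 l2. Fpert m0 m1 m2 (X (ecc_anomaly (norm e1) l1)) ((a1 / \<alpha>) *\<^sub>R Y (ecc_anomaly (norm e2) l2))"
  have Yscale: "ell_pos (a1 / \<alpha>) e2 j2 v = (a1 / \<alpha>) *\<^sub>R Y v" for v
    using ell_pos_scale[of "a1 / \<alpha>" 1 e2 j2 v] by simp
  have "Fsec m0 m1 m2 a1 (e1, j1, e2, j2) \<alpha> =
      1 / (4 * pi\<^sup>2) * integral (cbox (0, 0) (2 * pi, 2 * pi)) (\<lambda>(l1, l2). ?G l1 l2)"
    unfolding Fsec_def prod.case Yscale ..
  also have "integral (cbox (0, 0) (2 * pi, 2 * pi)) (\<lambda>(l1, l2). ?G l1 l2) =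
      integral (cbox 0 (2 * pi)) (\<lambda>l1. integral (cbox 0 (2 * pi)) (\<lambda>l2. ?G l1 l2))"
  proof (subst integral_prod_continuous)
    have c: "continuous_on S (\<lambda>t. ecc_anomaly e (g t))" if "0 \<le> e" "e < 1" "continuous_on S g" for e S and g :: "real \<times> real \<Rightarrow> real"
      by (rule continuous_on_compose2[OF continuous_ecc_anomaly[OF that(1,2)] that(3)]) simp
    show "continuous_on (cbox (0, 0) (2 * pi, 2 * pi)) (\<lambda>(l1, l2). ?G l1 l2)"
      unfolding split_beta by (intro continuous_Fpert_orbit c e1 e2 less_imp_le[OF e2(1)] continuous_intros)
  qed simp
  also have "\<dots> = integral {0..2 * pi} (\<lambda>l1. inner_avg \<alpha> (ecc_anomaly (norm e1) l1))"
    using inner_avg_eq[where c = 0] by simp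
  also have "\<dots> = secular \<alpha>"
    using integral_ecc_anomaly[OF e1 continuous_inner_avg, of 0]
    by (simp add: secular_def inner_avg_def ell_pos_periodic)
  finally show ?thesis .
qed

text \<open>\<open>Fpert_expand\<close> integrated over the torus, with
  \<open>\<Lambda> = a1 / \<alpha>\<close>, \<open>d = 1 - |e2|\<close> and
  \<open>\<rho> = 2 a1\<close>. Each weight is at most 2, whence the factor 4; the torus has area
  \<open>4 pi^2\<close>.\<close>

lemma secular_expand:
  "\<bar>secular \<alpha> - (- mu1 m0 m1 * m2 / (2 * a1 ^ 3)) * quad_avg a1 (e1, j1, e2, j2) * \<alpha> ^ 3\<bar>
    \<le> (4 * pi\<^sup>2 * (4 * (mu1 m0 m1 * m2 * 274 * (2 * a1) ^ 3 / (1 - norm e2) ^ 4 / a1 ^ 4))) * \<alpha> ^ 4"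
proof -
  let ?D = "cbox (0, 0) (2 * pi, 2 * pi) :: (real \<times> real) set"
  define A where "A t = (1 - norm e1 * cos (fst t)) * ((1 - norm e2 * cos (snd t)) *
      Fpert m0 m1 m2 (X (fst t)) ((a1 / \<alpha>) *\<^sub>R Y (snd t)))" for t
  define B where "B t = (1 - norm e1 * cos (fst t)) * ((1 - norm e2 * cos (snd t)) * quad_kernel (X (fst t)) (Y (snd t)))" for t
  define k where "k = (- mu1 m0 m1 * m2 / 2) / (a1 / \<alpha>) ^ 3"
  define E where "E = mu1 m0 m1 * m2 * 274 * (2 * a1) ^ 3 / (1 - norm e2) ^ 4 / (a1 / \<alpha>) ^ 4"
  have cA: "continuous_on ?D A"
    unfolding A_def by (intro continuous_intros continuous_Fpert_orbit)
  have cB: "continuous_on ?D B"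
    unfolding B_def using 1(3) 2(3) norm_Y(3) by (intro continuous_intros) auto
  have sA: "secular \<alpha> = integral ?D A"
    unfolding integral_prod_continuous[OF cA] by (simp add: A_def secular_def inner_avg_def)
  have qB: "quad_avg a1 (e1, j1, e2, j2) = integral ?D B" by (simp add: quad_avg_def B_def[abs_def])
  have iA: "A integrable_on ?D" "B integrable_on ?D"
    using cA cB integrable_continuous by blast+
  have ptw: "\<bar>A t - k * B t\<bar> \<le> 4 * E" for t
  proof -
    have w1: "0 \<le> 1 - norm e1 * cos (fst t)" "1 - norm e1 * cos (fst t) \<le> 2"
      using weight[of e1 "fst t"] ecc_le_1[OF 1(2)] by linarith+
    have w2: "0 \<le> 1 - norm e2 * cos (snd t)" "1 - norm e2 * cos (snd t) \<le> 2"
      using weight[of e2 "snd t"] e2 by linarith+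
    have F: "\<bar>Fpert m0 m1 m2 (X (fst t)) ((a1 / \<alpha>) *\<^sub>R Y (snd t)) - k * quad_kernel (X (fst t)) (Y (snd t))\<bar> \<le> E"
      using Fpert_expand[OF m _ _ norm_Y(2) norm_X(2) small, of "fst t" "snd t"] a1 \<alpha> e2
      by (simp add: k_def E_def)
    have "A t - k * B t = (1 - norm e1 * cos (fst t)) * ((1 - norm e2 * cos (snd t)) *
        (Fpert m0 m1 m2 (X (fst t)) ((a1 / \<alpha>) *\<^sub>R Y (snd t)) - k * quad_kernel (X (fst t)) (Y (snd t))))"
      by (simp add: A_def B_def algebra_simps)
    then have "\<bar>A t - k * B t\<bar> = (1 - norm e1 * cos (fst t)) * ((1 - norm e2 * cos (snd t)) *
        \<bar>Fpert m0 m1 m2 (X (fst t)) ((a1 / \<alpha>) *\<^sub>R Y (snd t)) - k * quad_kernel (X (fst t)) (Y (snd t))\<bar>)"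
      using w1 w2 by (simp add: abs_mult)
    also have "\<dots> \<le> 2 * (2 * E)" using w1 w2 F by (intro mult_mono mult_nonneg_nonneg) auto
    finally show ?thesis by simp
  qed
  have "secular \<alpha> - k * quad_avg a1 (e1, j1, e2, j2) = integral ?D (\<lambda>t. A t - k * B t)"
    unfolding sA qB using iA by (subst integral_diff) (auto intro: integrable_on_mult_right)
  also have "\<bar>\<dots>\<bar> \<le> integral ?D (\<lambda>t. 4 * E)"
    unfolding real_norm_def[symmetric]
    by (rule integral_norm_bound_integral[OF integrable_diff[OF iA(1) integrable_on_mult_right[OF iA(2)]] integrable_const])
      (use ptw in simp)
  also have "\<dots> = 4 * pi\<^sup>2 * (4 * E)"
    using pi_ge_zero by (simp add: content_Pair power2_eq_square)
  finally show ?thesis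
    using \<alpha> a1 unfolding k_def E_def by (simp add: power_divide field_simps)
qed

end

text \<open>The definite description is well defined: two candidates differ by an amount that is at
  most a constant times \<open>\<alpha>\<close>, for all small positive
  \<open>\<alpha>\<close>.\<close>

lemma cubic_coeff_eqI:
  assumes "(\<lambda>\<alpha>. F \<alpha> - q * \<alpha> ^ 3) \<in> O[at_right 0](\<lambda>\<alpha>. \<alpha> ^ 4)"
  shows "cubic_coeff F = q"
  unfolding cubic_coeff_def
proof (rule the_equality)
  fix q' assume "(\<lambda>\<alpha>. F \<alpha> - q' * \<alpha> ^ 3) \<in> O[at_right 0](\<lambda>\<alpha>. \<alpha> ^ 4)"
  from sum_in_bigo(2)[OF assms this] have "(\<lambda>\<alpha> :: real. (q' - q) * \<alpha> ^ 3) \<in> O[at_right 0](\<lambda>\<alpha>. \<alpha> ^ 4)"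
    by (simp add: algebra_simps)
  then obtain c where c: "c > 0" "\<forall>\<^sub>F \<alpha> in at_right 0. norm ((q' - q) * \<alpha> ^ 3) \<le> c * norm (\<alpha> ^ 4 :: real)"
    by (elim landau_o.bigE)
  have "\<forall>\<^sub>F \<alpha> :: real in at_right 0. \<alpha> > 0" by (simp add: eventually_at_right_less)
  with c(2) have "\<forall>\<^sub>F \<alpha> in at_right 0. \<bar>q' - q\<bar> \<le> c * \<alpha>"
  proof eventually_elim
    case (elim \<alpha>)
    have "\<bar>q' - q\<bar> * \<alpha> ^ 3 \<le> (c * \<alpha>) * \<alpha> ^ 3"
      using elim by (simp add: abs_mult eval_nat_numeral mult.assoc)
    then show ?case using elim(2) by simp
  qed
  moreover have "((\<lambda>\<alpha>. c * \<alpha>) \<longlongrightarrow> c * 0) (at_right (0 :: real))" by (intro tendsto_intros)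
  ultimately have "\<bar>q' - q\<bar> \<le> c * 0"
    by (intro tendsto_lowerbound[where F = "at_right (0 :: real)" and f = "\<lambda>\<alpha>. c * \<alpha>"]) auto
  then show "q' = q" by simp
qed (rule assms)

lemma cubic_coeff_secular:
  assumes "\<And>\<alpha>. 0 < \<alpha> \<Longrightarrow> \<alpha> \<le> (1 - norm e2) / 12 \<Longrightarrow> F \<alpha> = c * secular \<alpha>"
  shows "cubic_coeff F = c * ((- mu1 m0 m1 * m2 / (2 * a1 ^ 3)) * quad_avg a1 (e1, j1, e2, j2))"
proof (rule cubic_coeff_eqI)
  let ?q = "(- mu1 m0 m1 * m2 / (2 * a1 ^ 3)) * quad_avg a1 (e1, j1, e2, j2)"
  let ?b = "4 * pi\<^sup>2 * (4 * (mu1 m0 m1 * m2 * 274 * (2 * a1) ^ 3 / (1 - norm e2) ^ 4 / a1 ^ 4))"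
  have "\<forall>\<^sub>F \<alpha> in at_right 0. \<alpha> \<in> {0<..<(1 - norm e2) / 12}"
    using e2 by (intro eventually_at_right_real) simp
  then have "\<forall>\<^sub>F \<alpha> in at_right 0. norm (F \<alpha> - c * ?q * \<alpha> ^ 3) \<le> (\<bar>c\<bar> * ?b) * norm (\<alpha> ^ 4)"
  proof eventually_elim
    case (elim \<alpha>)
    then have \<alpha>: "0 < \<alpha>" "\<alpha> \<le> (1 - norm e2) / 12" by auto
    have "F \<alpha> - c * ?q * \<alpha> ^ 3 = c * (secular \<alpha> - ?q * \<alpha> ^ 3)"
      unfolding assms[OF \<alpha>] by (simp only: right_diff_distrib mult.assoc)
    then have "norm (F \<alpha> - c * ?q * \<alpha> ^ 3) = \<bar>c\<bar> * \<bar>secular \<alpha> - ?q * \<alpha> ^ 3\<bar>"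
      by (simp only: real_norm_def abs_mult)
    also have "\<dots> \<le> \<bar>c\<bar> * (?b * \<alpha> ^ 4)"
      using secular_expand[OF \<alpha>] by (intro mult_left_mono) auto
    finally show ?case by (simp add: mult.assoc)
  qed
  then show "(\<lambda>\<alpha>. F \<alpha> - c * ?q * \<alpha> ^ 3) \<in> O[at_right 0](\<lambda>\<alpha>. \<alpha> ^ 4)"
    by (rule bigoI)
qed

text \<open>Degenerate inner ellipses are included without a limit, because the eccentric anomaly is
  regular on them.\<close>

lemma FFquad_eq:
  "FFquad m0 m1 m2 f a1 (e1, j1, e2, j2) =
    a1 / (4 * pi\<^sup>2) * ((- mu1 m0 m1 * m2 / (2 * a1 ^ 3)) * quad_avg a1 (e1, j1, e2, j2))"
  unfolding FFquad_def by (rule cubic_coeff_secular) (rule FFsec_secular)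

lemma cubic_coeff_Fsec:
  "j1 \<noteq> 0 \<Longrightarrow> cubic_coeff (Fsec m0 m1 m2 a1 (e1, j1, e2, j2)) =
    1 / (4 * pi\<^sup>2) * ((- mu1 m0 m1 * m2 / (2 * a1 ^ 3)) * quad_avg a1 (e1, j1, e2, j2))"
  by (rule cubic_coeff_secular) (rule Fsec_secular)

end

text \<open>Serves to identify the limit in \<open>Fquad\<close> at degenerate inner ellipses with
  the same integral taken there.\<close>

lemma continuous_quad_avg: "continuous_on good_shapes (quad_avg a)"
proof -
  have nz: "ell_pos 1 e j u \<noteq> 0" if "e \<bullet> j = 0" "(norm e)\<^sup>2 + (norm j)\<^sup>2 = 1" "e \<noteq> 0" "j \<noteq> 0" for e j u
  proof -
    have "norm e * cos u \<le> norm e * 1" by (intro mult_left_mono) auto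
    then have "norm (ell_pos 1 e j u) > 0"
      using norm_ell_pos[OF that(1-3), of 1 u] ecc_lt_1[OF that(2,4)] by simp
    then show ?thesis by simp
  qed
  have "continuous_on (good_shapes \<times> cbox (0, 0) (2 * pi, 2 * pi)) (\<lambda>(s, t).
     (1 - norm (fst s) * cos (fst t)) * ((1 - norm (fst (snd (snd s))) * cos (snd t)) *
       quad_kernel (ell_pos a (fst s) (fst (snd s)) (fst t)) (ell_pos 1 (fst (snd (snd s))) (snd (snd (snd s))) (snd t))))"
    unfolding split_beta
    by (intro continuous_intros) (auto simp: good_shapes_def noncirc_def nz)
  from integral_continuous_on_param[OF this] show ?thesis
    by (simp add: quad_avg_def[abs_def])
qed

lemma proper_shapes_iff: "s \<in> proper_shapes \<longleftrightarrow> s \<in> good_shapes \<and> fst (snd s) \<noteq> 0"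
  by (auto simp: proper_shapes_def good_shapes_def split: prod.splits)

text \<open>Along a trivial filter \<open>Lim\<close> would be unspecified. The arc \<open>c\<close>
  reaches the degenerate shape through ellipses whose normalized angular momentum has length
  \<open>sin t\<close> and is orthogonal to \<open>e1\<close>.\<close>

lemma degenerate_limit:
  assumes "s \<in> good_shapes" "fst (snd s) = 0"
  shows "at s within proper_shapes \<noteq> bot"
proof -
  obtain e1 e2 j2 where s: "s = (e1, 0, e2, j2)" using assms(2) by (cases s) auto
  have e1: "(norm e1)\<^sup>2 = 1" "e1 \<noteq> 0" using assms(1) by (auto simp: s good_shapes_def noncirc_def)
  obtain n where n: "n \<noteq> 0" "orthogonal e1 n"
    using orthogonal_to_vector_exists[of e1] by auto
  define c where "c t = (cos t *\<^sub>R e1, sin t *\<^sub>R sgn n, e2, j2)" for t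
  have ns: "norm (sgn n) = 1" "e1 \<bullet> sgn n = 0" using n by (auto simp: norm_sgn sgn_div_norm orthogonal_def)
  have "continuous_on UNIV c" unfolding c_def by (intro continuous_intros)
  then have "(c \<longlongrightarrow> c 0) (at_right 0)"
    by (metis UNIV_I continuous_on_def tendsto_within_subset top_greatest)
  then have lim: "(c \<longlongrightarrow> s) (at_right 0)" by (simp add: c_def s)
  have "\<forall>\<^sub>F t in at_right 0. t \<in> {0<..<pi / 2}"
    by (intro eventually_at_right_real) simp
  then have ev: "\<forall>\<^sub>F t in at_right 0. c t \<in> proper_shapes \<and> c t \<noteq> s"
  proof eventually_elim
    case (elim t)
    then have "sin t > 0" "cos t > 0" by (auto intro: sin_gt_zero cos_gt_zero)
    moreover have "(cos t)\<^sup>2 + (sin t)\<^sup>2 = 1" by simp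
    ultimately show ?case
      using assms(1) ns e1 n(1) by (auto simp: s c_def proper_shapes_def good_shapes_def noncirc_def power_mult_distrib sgn_zero_iff)
  qed
  have "filterlim c (at s within proper_shapes) (at_right 0)"
    using lim ev by (simp add: filterlim_at)
  then show ?thesis
    using filterlim_iff trivial_limit_at_right_real[of "0 :: real"] by (metis filterlim_def bot.extremum_uniqueI filtermap_bot_iff)
qed

lemma Fquad_eq:
  assumes m: "m0 > 0" "m1 > 0" "m2 > 0" "a > 0" and s: "s \<in> good_shapes"
  shows "Fquad m0 m1 m2 a s = 1 / (4 * pi\<^sup>2) * ((- mu1 m0 m1 * m2 / (2 * a ^ 3)) * quad_avg a s)"
proof -
  let ?k = "\<lambda>q. 1 / (4 * pi\<^sup>2) * ((- mu1 m0 m1 * m2 / (2 * a ^ 3)) * q)"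
  have *: "cubic_coeff (Fsec m0 m1 m2 a s) = ?k (quad_avg a s)" if "s \<in> good_shapes" "fst (snd s) \<noteq> 0" for s
  proof -
    obtain e1 j1 e2 j2 where s': "s = (e1, j1, e2, j2)" by (rule prod_cases4)
    interpret shape_data m0 m1 m2 a e1 j1 e2 j2
      using that m by unfold_locales (auto simp: good_shapes_def noncirc_def s')
    show ?thesis using cubic_coeff_Fsec that by (simp add: s')
  qed
  show ?thesis
  proof (cases "fst (snd s) = 0")
    case True
    have "(quad_avg a \<longlongrightarrow> quad_avg a s) (at s within good_shapes)"
      using continuous_quad_avg s by (simp add: continuous_on_def)
    then have "(quad_avg a \<longlongrightarrow> quad_avg a s) (at s within proper_shapes)"
      by (rule tendsto_within_subset) (auto simp: proper_shapes_iff)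
    then have "((\<lambda>s'. ?k (quad_avg a s')) \<longlongrightarrow> ?k (quad_avg a s)) (at s within proper_shapes)"
      by (intro tendsto_intros)
    moreover have "\<forall>\<^sub>F s' in at s within proper_shapes. ?k (quad_avg a s') = cubic_coeff (Fsec m0 m1 m2 a s')"
      by (simp add: eventually_at_filter proper_shapes_iff *)
    ultimately have "((\<lambda>s'. cubic_coeff (Fsec m0 m1 m2 a s')) \<longlongrightarrow> ?k (quad_avg a s)) (at s within proper_shapes)"
      by (rule Lim_transform_eventually)
    from tendsto_Lim[OF degenerate_limit[OF s True] this] show ?thesis
      using True by (simp add: Fquad_def)
  next
    case False
    then show ?thesis using *[OF s False] by (simp add: Fquad_def)
  qed
qed

lemma quad_avg_rotate:
  assumes "same_shape s s'" shows "quad_avg a s' = quad_avg a s"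
proof -
  obtain e1 j1 e2 j2 where s: "s = (e1, j1, e2, j2)" by (rule prod_cases4)
  obtain R where R: "rotation_matrix R" "s' = (R *v e1, R *v j1, R *v e2, R *v j2)"
    using assms by (auto simp: same_shape_def s)
  have o: "orthogonal_transformation ((*v) R)"
    using R(1) by (simp add: rotation_matrix_def orthogonal_transformation_matrix matrix_of_matrix_vector_mul)
  have n: "norm (R *v v) = norm v" for v using orthogonal_transformation_norm[OF o] by simp
  have i: "(R *v v) \<bullet> (R *v w) = v \<bullet> w" for v w using o by (simp add: orthogonal_transformation_def)
  have sg: "sgn (R *v v) = R *v sgn v" for v
    by (simp add: sgn_div_norm n matrix_vector_mult_scaleR)
  have p: "ell_pos b (R *v e) (R *v j) u = R *v ell_pos b e j u" for b e j u
    by (simp add: ell_pos_def n sg cross_rotation_matrix[OF R(1)] matrix_vector_right_distrib matrix_vector_mult_scaleR)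
  show ?thesis unfolding quad_avg_def by (simp add: s R(2) p n quad_kernel_def i)
qed

text \<open>The factor \<open>a\<close> comes from \<open>|Q1| = a (1 - |e1| cos u)\<close>. The
  quotient \<open>m2 / m2'\<close> appears because \<open>Fpert\<close> is linear in the outer mass,
  which \<open>mu1\<close> does not contain.\<close>

lemma FFquad_Fquad:
  assumes pos: "m0 > 0" "m1 > 0" "m2 > 0" "m2' > 0" "a > 0" and s: "s \<in> good_shapes" "s' \<in> good_shapes" "same_shape s s'"
  shows "FFquad m0 m1 m2 f a s = a * m2 / m2' * Fquad m0 m1 m2' a s'"
proof -
  obtain e1 j1 e2 j2 where s': "s = (e1, j1, e2, j2)" by (rule prod_cases4)
  interpret shape_data m0 m1 m2 a e1 j1 e2 j2
    using s(1) pos by unfold_locales (auto simp: good_shapes_def noncirc_def s')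
  show ?thesis
    using FFquad_eq[of f] Fquad_eq[OF pos(1,2,4,5) s(2)] quad_avg_rotate[OF s(3), of a] pos by (simp add: s')
qed

section \<open>The two reduced systems\<close>

lemma equivp_same_shape: "equivp same_shape"
proof (rule equivpI)
  show "reflp same_shape"
    by (rule reflpI) (auto simp: same_shape_def rotation_matrix_def orthogonal_matrix_id det_I intro!: exI[of _ "mat 1"])
  show "symp same_shape"
  proof (rule sympI)
    fix s s' assume "same_shape s s'"
    then obtain e1 j1 e2 j2 R where R: "s = (e1, j1, e2, j2)" "rotation_matrix R" "R *v axis 3 1 = axis 3 1"
      "s' = (R *v e1, R *v j1, R *v e2, R *v j2)" by (cases s) (auto simp: same_shape_def)
    have inv: "transpose R *v (R *v v) = v" for v
      using R(2) by (simp add: matrix_vector_mul_assoc rotation_matrix_def orthogonal_matrix_def)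
    have "rotation_matrix (transpose R)" using R(2) by (simp add: rotation_matrix_def det_transpose)
    moreover have "transpose R *v axis 3 1 = axis 3 1" using inv[of "axis 3 1"] R(3) by simp
    ultimately show "same_shape s' s" using inv by (auto simp: same_shape_def R(1,4) intro!: exI[of _ "transpose R"])
  qed
  show "transp same_shape"
  proof (rule transpI)
    fix s s' s'' assume a: "same_shape s s'" "same_shape s' s''"
    obtain e1 j1 e2 j2 R where R: "s = (e1, j1, e2, j2)" "rotation_matrix R" "R *v axis 3 1 = axis 3 1"
      "s' = (R *v e1, R *v j1, R *v e2, R *v j2)" using a(1) by (cases s) (auto simp: same_shape_def)
    obtain R' where R': "rotation_matrix R'" "R' *v axis 3 1 = axis 3 1"
      "s'' = (R' *v (R *v e1), R' *v (R *v j1), R' *v (R *v e2), R' *v (R *v j2))"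
      using a(2) by (auto simp: same_shape_def R(4))
    have "rotation_matrix (R' ** R)" using R(2) R'(1) by (simp add: rotation_matrix_def orthogonal_matrix_mul det_mul)
    moreover have "(R' ** R) *v axis 3 1 = axis 3 1" by (simp add: R(3) R'(2) flip: matrix_vector_mul_assoc)
    ultimately show "same_shape s s''"
      by (auto simp: same_shape_def R(1) R'(3) matrix_vector_mul_assoc intro!: exI[of _ "R' ** R"])
  qed
qed

text \<open>The linear relation is the momentum constraint, as \<open>L j\<close> is the angular
  momentum of an ellipse; \<open>L1\<close> stands for \<open>circ_L\<close> or for
  \<open>calL1\<close>.\<close>

definition base :: "real \<Rightarrow> real \<Rightarrow> real \<Rightarrow> shape set" where
  "base L1 L2 C = {(e1, j1, e2, j2). (e1, j1) \<in> ellipses \<and> (e2, j2) \<in> ellipses \<and>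
     noncirc (e1, j1, e2, j2) \<and> L1 *\<^sub>R j1 + L2 *\<^sub>R j2 = C *\<^sub>R axis 3 1}"

definition base_form :: "real \<Rightarrow> real \<Rightarrow> shape \<Rightarrow> shape \<Rightarrow> shape \<Rightarrow> real" where
  "base_form L1 L2 = (\<lambda>(e, j, s) (e', j', s') (e'', j'', s'').
     - L1 / 2 * ell_area (e, j) (e', j') (e'', j'') + - L2 / 2 * ell_area s s' s'')"

text \<open>Only the ratios of \<open>L1\<close>, \<open>L2\<close> and \<open>C\<close> matter,
  which is what the fictitious mass and the rescaled \<open>C'\<close> exploit.\<close>

lemma base_scale:
  assumes "r \<noteq> 0" shows "base (r * L1) (r * L2) (r * C) = base L1 L2 C"
proof -
  have "(r * L1) *\<^sub>R x + (r * L2) *\<^sub>R y = (r * C) *\<^sub>R z \<longleftrightarrow> L1 *\<^sub>R x + L2 *\<^sub>R y = C *\<^sub>R z" for x y z :: vec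
  proof -
    have "(r * L1) *\<^sub>R x + (r * L2) *\<^sub>R y = r *\<^sub>R (L1 *\<^sub>R x + L2 *\<^sub>R y)" "(r * C) *\<^sub>R z = r *\<^sub>R (C *\<^sub>R z)"
      by (simp_all add: scaleR_add_right)
    then show ?thesis using assms by (simp only: scaleR_cancel_left) simp
  qed
  then show ?thesis by (simp add: base_def)
qed

lemma base_good: "base L1 L2 C \<subseteq> good_shapes"
  by (auto simp: base_def good_shapes_def ellipses_def)

lemma ell_area_scale: "ell_area x v (c *\<^sub>R v') = c * ell_area x v v'"
  by (cases x; cases v; cases v')
    (simp add: ell_area_def cross_mult_right algebra_simps flip: scaleR_add_right scaleR_diff_right)

lemma base_form_scale:
  "base_form (r * L1) (r * L2) x v v' = r * base_form L1 L2 x v v'"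
  "base_form L1 L2 x v (c *\<^sub>R v') = c * base_form L1 L2 x v v'"
proof -
  show "base_form (r * L1) (r * L2) x v v' = r * base_form L1 L2 x v v'"
    by (cases x; cases v; cases v') (simp add: base_form_def algebra_simps)
  obtain e j s e' j' s' e'' j'' s'' where *: "x = (e, j, s)" "v = (e', j', s')" "v' = (e'', j'', s'')"
    by (metis surj_pair)
  show "base_form L1 L2 x v (c *\<^sub>R v') = c * base_form L1 L2 x v v'"
    using ell_area_scale[of "(e, j)" "(e', j')" c "(e'', j'')"] ell_area_scale[of s s' c s'']
    by (simp add: base_form_def * algebra_simps)
qed

locale masses =
  fixes m0 m1 m2 a1 a2 :: real
  assumes m: "m0 > 0" "m1 > 0" "m2 > 0" and a: "a1 > 0" "a2 > 0"
begin

abbreviation "\<mu> \<equiv> mu1 m0 m1"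
abbreviation "M \<equiv> Mass1 m0 m1"
abbreviation "\<mu>' \<equiv> mu2 m0 m1 m2"
abbreviation "M' \<equiv> Mass2 m0 m1 m2"

lemma mass_pos: "\<mu> > 0" "M > 0" "\<mu>' > 0" "M' > 0"
  using m by (auto simp: mu1_def Mass1_def mu2_def Mass2_def intro!: divide_pos_pos add_pos_pos)

sublocale I: kep \<mu> M a1
  using mass_pos a by unfold_locales

sublocale O: kep \<mu>' M' a2
  using mass_pos a by unfold_locales

lemma circ_pos: "circ_L \<mu> M a1 > 0" "circ_L \<mu>' M' a2 > 0"
  using mass_pos a by (auto simp: circ_L_def)

lemma quad_submersion:
  "submersion_onto (level (quad_system m0 m1 m2 a1 a2 C)) (shape_of m0 m1 m2)
     (base (circ_L \<mu> M a1) (circ_L \<mu>' M' a2) C) (form (quad_system m0 m1 m2 a1 a2 C))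
     (base_form (circ_L \<mu> M a1) (circ_L \<mu>' M' a2))"
proof -
  define N where "N = {(e1, j1, e2, j2). noncirc (e1, j1, e2, j2) \<and>
     circ_L \<mu> M a1 *\<^sub>R j1 + circ_L \<mu>' M' a2 *\<^sub>R j2 = C *\<^sub>R axis 3 1}"
  have sh: "(\<lambda>(x, y, z). (fst (kep_shape \<mu> M (x, y)), snd (kep_shape \<mu> M (x, y)), kep_shape \<mu>' M' z)) = shape_of m0 m1 m2"
    by (auto simp: shape_of_def kep_shape_def)
  have ang: "circ_L \<mu> M a1 *\<^sub>R kep_ang \<mu> M P Q = cross3 Q P" if "kep_axis \<mu> M P Q = a1" for P Q
    using that circ_pos by (simp add: kep_ang_def)
  have ang': "circ_L \<mu>' M' a2 *\<^sub>R kep_ang \<mu>' M' P Q = cross3 Q P" if "kep_axis \<mu>' M' P Q = a2" for P Q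
    using that circ_pos by (simp add: kep_ang_def)
  have iff: "(P, Q) \<in> kep_level \<mu> M a1 \<and> (P', Q') \<in> kep_level \<mu>' M' a2 \<and> shape_of m0 m1 m2 (P, Q, P', Q') \<in> N \<longleftrightarrow>
      (P, Q, P', Q') \<in> level (quad_system m0 m1 m2 a1 a2 C)" for P Q P' Q'
  proof (cases "kep_axis \<mu> M P Q = a1 \<and> kep_axis \<mu>' M' P' Q' = a2")
    case True
    then show ?thesis
      using ang[of P Q] ang'[of P' Q'] by (auto simp: quad_system_def kep_level_def N_def shape_of_def)
  qed (auto simp: quad_system_def kep_level_def)
  have lev: "{(x, y, z). (x, y) \<in> kep_level \<mu> M a1 \<and> z \<in> kep_level \<mu>' M' a2 \<and> shape_of m0 m1 m2 (x, y, z) \<in> N}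
      = level (quad_system m0 m1 m2 a1 a2 C)"
  proof (rule set_eqI, goal_cases)
    case (1 x)
    show ?case using iff[of "fst x" "fst (snd x)" "fst (snd (snd x))" "snd (snd (snd x))"]
      by (simp only: mem_Collect_eq prod.collapse split_beta)
  qed
  have bas: "{(d, e, f). (d, e) \<in> ellipses \<and> f \<in> ellipses \<and> (d, e, f) \<in> N} =
      base (circ_L \<mu> M a1) (circ_L \<mu>' M' a2) C"
    by (auto simp: base_def N_def)
  from submersion_prod[OF I.kep_submersion O.kep_submersion, of N, unfolded sh lev bas]
  show ?thesis
    by (simp add: quad_system_def base_form_def split_beta' add_diff_eq)
qed

end

locale regularized = masses +
  fixes f :: real
  assumes f1: "f1 m0 m1 m2 f (circ_L (mu2 m0 m1 m2) (Mass2 m0 m1 m2) a2) > 0"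
begin

abbreviation "\<phi>1 \<equiv> f1 m0 m1 m2 f (circ_L \<mu>' M' a2)"

sublocale J: ks \<mu> M \<phi>1 a1
  using mass_pos a f1 by unfold_locales

text \<open>\<open>calL1\<close> has two roles that must agree: weight of the inner area form, and
  factor that turns \<open>ks_ang\<close> into the angular momentum \<open>ks_G\<close>. Both come
  to \<open>a1 / (2 b)\<close>.\<close>

lemma rquad_submersion:
  "submersion_onto (level (rquad_system m0 m1 m2 a1 a2 f C)) (rshape_of m0 m1 m2 f)
     (base (calL1 \<mu> M \<phi>1 a1) (circ_L \<mu>' M' a2) C) (form (rquad_system m0 m1 m2 a1 a2 f C))
     (base_form (calL1 \<mu> M \<phi>1 a1) (circ_L \<mu>' M' a2))"
proof -
  define N where "N = {(e1, j1, e2, j2). noncirc (e1, j1, e2, j2) \<and>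
     calL1 \<mu> M \<phi>1 a1 *\<^sub>R j1 + circ_L \<mu>' M' a2 *\<^sub>R j2 = C *\<^sub>R axis 3 1}"
  \<comment> \<open>\<open>rshape_of\<close> with \<open>f1\<close> frozen at its value on the level
    set, so that it splits into an inner and an outer factor.\<close>
  define p where "p = (\<lambda>(x, y, z). (fst (ks_shape \<mu> M \<phi>1 (x, y)), snd (ks_shape \<mu> M \<phi>1 (x, y)), kep_shape \<mu>' M' z))"
  have rf: "rf1 m0 m1 m2 f P Q = \<phi>1" if "kep_axis \<mu>' M' P Q = a2" for P Q
    using that by (simp add: rf1_def Let_def)
  have pr: "p (z, w, P, Q) = rshape_of m0 m1 m2 f (z, w, P, Q)" if "kep_axis \<mu>' M' P Q = a2" for z w P Q
    using rf[OF that] by (simp add: p_def rshape_of_def ks_shape_def kep_shape_def Let_def)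
  have ang: "calL1 \<mu> M \<phi>1 a1 *\<^sub>R ks_ang \<mu> M \<phi>1 z w = ks_G z w" if "ks_axis \<mu> \<phi>1 z w = a1" for z w
    using J.level_shape[OF that] J.b(1) J.a by (simp add: ks_shape_def J.calL1_eq)
  have ang': "circ_L \<mu>' M' a2 *\<^sub>R kep_ang \<mu>' M' P Q = cross3 Q P" if "kep_axis \<mu>' M' P Q = a2" for P Q
    using that circ_pos by (simp add: kep_ang_def)
  have nz: "(z, w) \<noteq> (0, 0)" if "ks_axis \<mu> \<phi>1 z w = a1" for z w
    using that a by (auto simp: ks_axis_def)
  have iff: "(z, w) \<in> ks_level \<mu> \<phi>1 a1 \<and> (P, Q) \<in> kep_level \<mu>' M' a2 \<and> p (z, w, P, Q) \<in> N \<longleftrightarrow>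
      (z, w, P, Q) \<in> level (rquad_system m0 m1 m2 a1 a2 f C)" for z w P Q
  proof (cases "kep_axis \<mu>' M' P Q = a2")
    case True
    show ?thesis
    proof (cases "ks_axis \<mu> \<phi>1 z w = a1")
      case ax: True
      show ?thesis
        unfolding pr[OF True] using nz[OF ax] rf[OF True] ang[OF ax] ang'[OF True] True ax
        by (auto simp: rquad_system_def ks_level_def kep_level_def N_def rshape_of_def Let_def)
    qed (auto simp: rquad_system_def ks_level_def rf[OF True])
  qed (auto simp: rquad_system_def kep_level_def)
  have lev: "{(x, y, z). (x, y) \<in> ks_level \<mu> \<phi>1 a1 \<and> z \<in> kep_level \<mu>' M' a2 \<and> p (x, y, z) \<in> N}
      = level (rquad_system m0 m1 m2 a1 a2 f C)"
  proof (rule set_eqI, goal_cases)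
    case (1 x)
    show ?case using iff[of "fst x" "fst (snd x)" "fst (snd (snd x))" "snd (snd (snd x))"]
      by (simp only: mem_Collect_eq prod.collapse split_beta)
  qed
  have bas: "{(d, e, f). (d, e) \<in> ellipses \<and> f \<in> ellipses \<and> (d, e, f) \<in> N} =
      base (calL1 \<mu> M \<phi>1 a1) (circ_L \<mu>' M' a2) C"
    by (auto simp: base_def N_def)
  have "submersion_onto (level (rquad_system m0 m1 m2 a1 a2 f C)) p
     (base (calL1 \<mu> M \<phi>1 a1) (circ_L \<mu>' M' a2) C) (form (rquad_system m0 m1 m2 a1 a2 f C))
     (base_form (calL1 \<mu> M \<phi>1 a1) (circ_L \<mu>' M' a2))"
    using submersion_prod[OF J.ks_submersion O.kep_submersion, of N, folded p_def, unfolded lev bas]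
    by (simp add: rquad_system_def base_form_def split_beta' add_diff_eq)
  then show ?thesis
  proof (rule submersion_cong)
    fix x assume "x \<in> level (rquad_system m0 m1 m2 a1 a2 f C)"
    then show "rshape_of m0 m1 m2 f x = p x"
      by (cases x) (simp add: rquad_system_def pr)
  qed
qed

end

text \<open>The left side is \<open>s m / sqrt (s + m)\<close>. Squaring turns the equation into
  \<open>s^2 m^2 - y^2 m - s y^2 = 0\<close>, whose positive root is the witness.\<close>

lemma mass_circ_solution:
  fixes s y :: real
  assumes "s > 0" "y > 0"
  obtains m where "m > 0" "1 / (1 / s + 1 / m) * sqrt (s + m) = y"
proof
  define D where "D = sqrt (y ^ 4 + 4 * s ^ 3 * y\<^sup>2)"
  define m where "m = (y\<^sup>2 + D) / (2 * s\<^sup>2)"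
  have D: "D\<^sup>2 = y ^ 4 + 4 * s ^ 3 * y\<^sup>2" "D > 0" using assms by (simp_all add: D_def add_pos_pos)
  show m: "m > 0" using assms D by (simp add: m_def add_pos_pos)
  have "2 * s\<^sup>2 * m - y\<^sup>2 = D" using assms by (simp add: m_def)
  then have "(2 * s\<^sup>2 * m - y\<^sup>2)\<^sup>2 = y ^ 4 + 4 * s ^ 3 * y\<^sup>2" using D by simp
  then have "(4 * s\<^sup>2) * ((s * m)\<^sup>2 - y\<^sup>2 * (s + m)) = 0"
    by (simp add: power2_eq_square eval_nat_numeral algebra_simps)
  then have "(s * m)\<^sup>2 = y\<^sup>2 * (s + m)" using assms by simp
  also have "\<dots> = (y * sqrt (s + m))\<^sup>2" using assms m by (simp add: power_mult_distrib)
  finally have "s * m = y * sqrt (s + m)" using assms m by (simp add: power2_eq_iff_nonneg)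
  moreover have "1 / (1 / s + 1 / m) = s * m / (s + m)" using assms m by (simp add: field_simps)
  ultimately show "1 / (1 / s + 1 / m) * sqrt (s + m) = y" using assms m by (simp add: mult.assoc)
qed

theorem theorem1p1:
  "\<exists>\<epsilon>>0. \<exists>K :: real \<Rightarrow> real \<Rightarrow> real \<Rightarrow> real. \<forall>m0>0. \<forall>m1>0.
     \<exists>\<kappa> :: real \<Rightarrow> real \<Rightarrow> real \<Rightarrow> real. \<forall>m2>0. \<forall>a1>0. \<forall>a2>0. \<forall>f>0. \<forall>C>0.
       a1 / a2 < \<epsilon> \<longrightarrow>
       f1 m0 m1 m2 f (circ_L (mu2 m0 m1 m2) (Mass2 m0 m1 m2) a2) > 0 \<longrightarrow>
       (\<exists>m2'>0.
          let \<mu> = mu1 m0 m1; M = Mass1 m0 m1;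
              \<phi>1 = f1 m0 m1 m2 f (circ_L (mu2 m0 m1 m2) (Mass2 m0 m1 m2) a2);
              C' = C * circ_L \<mu> M a1 / calL1 \<mu> M \<phi>1 a1;
              S = rquad_system m0 m1 m2 a1 a2 f C;
              T = quad_system m0 m1 m2' a1 a2 C'
          in K a1 m2 m2' > 0 \<and> \<kappa> a1 m2 m2' > 0 \<and>
             (\<exists>\<Phi>. rconjugate S T (\<kappa> a1 m2 m2') \<Phi> \<and>
                (\<forall>x\<in>level S. \<forall>y\<in>level T. \<Phi> (proj S x) = proj T y \<longrightarrow>
                   ham S x = K a1 m2 m2' * ham T y)))"
proof (rule exI[of _ 1], rule conjI[OF zero_less_one], rule exI[of _ "\<lambda>a1 m2 m2'. a1 * m2 / m2'"], intro allI impI)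
  fix m0 m1 :: real assume m: "m0 > 0" "m1 > 0"
  \<comment> \<open>Isolates the outer mass in \<open>L2 = h m2 * sqrt a2\<close>; at equal outer
    axes the ratio of the \<open>L2\<close> is that of \<open>h\<close>.\<close>
  define h where "h m2 = mu2 m0 m1 m2 * sqrt (Mass2 m0 m1 m2)" for m2
  have h: "h m2 > 0" if "m2 > 0" for m2
    using m that by (auto simp: h_def mu2_def Mass2_def intro!: mult_pos_pos divide_pos_pos add_pos_pos)
  have L: "circ_L (mu2 m0 m1 m2) (Mass2 m0 m1 m2) a2 = h m2 * sqrt a2" for m2 a2
    by (simp add: circ_L_def h_def real_sqrt_mult)
  show "\<exists>\<kappa>. \<forall>m2>0. \<forall>a1>0. \<forall>a2>0. \<forall>f>0. \<forall>C>0. a1 / a2 < 1 \<longrightarrow>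
       f1 m0 m1 m2 f (circ_L (mu2 m0 m1 m2) (Mass2 m0 m1 m2) a2) > 0 \<longrightarrow>
       (\<exists>m2'>0.
          let \<mu> = mu1 m0 m1; M = Mass1 m0 m1;
              \<phi>1 = f1 m0 m1 m2 f (circ_L (mu2 m0 m1 m2) (Mass2 m0 m1 m2) a2);
              C' = C * circ_L \<mu> M a1 / calL1 \<mu> M \<phi>1 a1;
              S = rquad_system m0 m1 m2 a1 a2 f C;
              T = quad_system m0 m1 m2' a1 a2 C'
          in a1 * m2 / m2' > 0 \<and> \<kappa> a1 m2 m2' > 0 \<and>
             (\<exists>\<Phi>. rconjugate S T (\<kappa> a1 m2 m2') \<Phi> \<and>
                (\<forall>x\<in>level S. \<forall>y\<in>level T. \<Phi> (proj S x) = proj T y \<longrightarrow>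
                   ham S x = a1 * m2 / m2' * ham T y)))"
  \<comment> \<open>The factor must be named before \<open>a2\<close> and \<open>f\<close>, on which
    the ratio \<open>r\<close> below depends; for the chosen \<open>m2'\<close> that ratio equals
    \<open>h m2' / h m2\<close>.\<close>
  proof (intro exI[of _ "\<lambda>a1 m2 m2'. a1 * m2 / m2' * (h m2' / h m2)"] allI impI)
    fix m2 a1 a2 f C :: real
    assume m2: "m2 > 0" and a: "a1 > 0" "a2 > 0"
      and f1: "f1 m0 m1 m2 f (circ_L (mu2 m0 m1 m2) (Mass2 m0 m1 m2) a2) > 0"
    interpret R: regularized m0 m1 m2 a1 a2 f using m m2 a f1 by unfold_locales
    define r where "r = circ_L R.\<mu> R.M a1 / calL1 R.\<mu> R.M R.\<phi>1 a1"
    have r: "r > 0" using R.circ_pos R.J.calL1_pos by (simp add: r_def)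
    \<comment> \<open>The fictitious mass scales \<open>L2\<close> by the same ratio
      \<open>r\<close> that leads from \<open>calL1\<close> to \<open>circ_L\<close> for the inner
      ellipse.\<close>
    obtain m2' where m2': "m2' > 0" "h m2' = r * h m2"
    proof -
      obtain m2' where "m2' > 0" "1 / (1 / (m0 + m1) + 1 / m2') * sqrt (m0 + m1 + m2') = r * h m2"
        by (rule mass_circ_solution[of "m0 + m1" "r * h m2"]) (use m h[OF m2] r in auto)
      then show thesis by (intro that) (auto simp: h_def mu2_def Mass2_def)
    qed
    interpret Q: masses m0 m1 m2' a1 a2 using m m2' a by unfold_locales
    define S where "S = rquad_system m0 m1 m2 a1 a2 f C"
    define T where "T = quad_system m0 m1 m2' a1 a2 (r * C)"
    define K where "K = a1 * m2 / m2'"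
    have K: "K > 0" using a m2 m2' by (simp add: K_def)
    have L1: "circ_L R.\<mu> R.M a1 = r * calL1 R.\<mu> R.M R.\<phi>1 a1" using R.J.calL1_pos by (simp add: r_def)
    have L2: "circ_L Q.\<mu>' Q.M' a2 = r * circ_L R.\<mu>' R.M' a2" by (simp add: L m2')
    have sT: "submersion_onto (level T) (shape_of m0 m1 m2') (base (calL1 R.\<mu> R.M R.\<phi>1 a1) (circ_L R.\<mu>' R.M' a2) C) (form T)
       (base_form (r * calL1 R.\<mu> R.M R.\<phi>1 a1) (r * circ_L R.\<mu>' R.M' a2))"
      using Q.quad_submersion[of "r * C"] base_scale[of r] r unfolding L1 L2 T_def by simp
    have sS: "submersion_onto (level S) (rshape_of m0 m1 m2 f) (base (calL1 R.\<mu> R.M R.\<phi>1 a1) (circ_L R.\<mu>' R.M' a2) C) (form S)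
       (base_form (calL1 R.\<mu> R.M R.\<phi>1 a1) (circ_L R.\<mu>' R.M' a2))"
      using R.rquad_submersion[of C] by (simp add: S_def)
    have good: "rshape_of m0 m1 m2 f x \<in> good_shapes" if "x \<in> level S" for x
      by (rule subsetD[OF base_good submersion_mem[OF sS that]])
    have good': "shape_of m0 m1 m2' y \<in> good_shapes" if "y \<in> level T" for y
      by (rule subsetD[OF base_good submersion_mem[OF sT that]])
    have ham: "ham S x = K * ham T y" if "x \<in> level S" "y \<in> level T"
        "same_shape (rshape_of m0 m1 m2 f x) (shape_of m0 m1 m2' y)" for x y
      using FFquad_Fquad[OF m m2 m2'(1) a(1) good[OF that(1)] good'[OF that(2)] that(3), of f]
      by (simp add: S_def T_def rquad_system_def quad_system_def K_def)
    \<comment> \<open>The Hamiltonian of \<open>S\<close> is \<open>K\<close> times that of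
      \<open>T\<close>, while the form of \<open>T\<close> is \<open>r\<close> times that of
      \<open>S\<close>; so the vector field of \<open>S\<close> is \<open>K * r\<close> times that
      of \<open>T\<close>.\<close>
    interpret B: common_base S T "rshape_of m0 m1 m2 f" "shape_of m0 m1 m2'"
      "base (calL1 R.\<mu> R.M R.\<phi>1 a1) (circ_L R.\<mu>' R.M' a2) C" same_shape
      "base_form (calL1 R.\<mu> R.M R.\<phi>1 a1) (circ_L R.\<mu>' R.M' a2)"
      "base_form (r * calL1 R.\<mu> R.M R.\<phi>1 a1) (r * circ_L R.\<mu>' R.M' a2)" K "K * r"
    proof
      show "K * base_form (r * calL1 R.\<mu> R.M R.\<phi>1 a1) (r * circ_L R.\<mu>' R.M' a2) b v ((1 / (K * r)) *\<^sub>R v') =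
          base_form (calL1 R.\<mu> R.M R.\<phi>1 a1) (circ_L R.\<mu>' R.M' a2) b v v'" for b v v'
        using K r by (simp add: base_form_scale)
    qed (use sS sT equivp_same_shape ham K r in \<open>auto simp: S_def T_def rquad_system_def quad_system_def\<close>)
    have C: "C * circ_L R.\<mu> R.M a1 / calL1 R.\<mu> R.M R.\<phi>1 a1 = r * C" by (simp add: r_def)
    have k: "a1 * m2 / m2' * (h m2' / h m2) = K * r" using h[OF m2] by (simp add: K_def m2')
    have "K > 0 \<and> K * r > 0 \<and> (\<exists>\<Phi>. rconjugate S T (K * r) \<Phi> \<and>
        (\<forall>x\<in>level S. \<forall>y\<in>level T. \<Phi> (proj S x) = proj T y \<longrightarrow> ham S x = K * ham T y))"
      using K r B.rconjugate B.corr_projD ham by (intro conjI exI[of _ B.corr]) auto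
    then show "\<exists>m2'>0.
          let \<mu> = mu1 m0 m1; M = Mass1 m0 m1;
              \<phi>1 = f1 m0 m1 m2 f (circ_L (mu2 m0 m1 m2) (Mass2 m0 m1 m2) a2);
              C' = C * circ_L \<mu> M a1 / calL1 \<mu> M \<phi>1 a1;
              S = rquad_system m0 m1 m2 a1 a2 f C;
              T = quad_system m0 m1 m2' a1 a2 C'
          in a1 * m2 / m2' > 0 \<and> a1 * m2 / m2' * (h m2' / h m2) > 0 \<and>
             (\<exists>\<Phi>. rconjugate S T (a1 * m2 / m2' * (h m2' / h m2)) \<Phi> \<and>
                (\<forall>x\<in>level S. \<forall>y\<in>level T. \<Phi> (proj S x) = proj T y \<longrightarrow>
                   ham S x = a1 * m2 / m2' * ham T y))"
      unfolding Let_def by (intro exI[of _ m2'] conjI m2'(1)) (simp_all only: C k S_def T_def K_def)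
  qed
qed

end
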